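(* For $i\in I$ and $e\in\{\pm1\}$, there are $\mathbb{Q}(v)$-algebra automorphisms $T''_{i,e}$ of $\widetilde U$ such that $\psi T''_{i,e}\psi=T''_{i,-e}$. Moreover, for all $j\in I$, $$T''_{i,e}(\tilde K_j)=\tilde K_i^{-c_{ij}}\tilde K_j,\qquad T''_{i,e}(\tilde K'_j)=(\tilde K'_i)^{-c_{ij}}\tilde K'_j,$$ $$T''_{i,1}(F_i)=-\tilde K_i^{-1}E_i,\quad T''_{i,1}(E_i)=-F_i(\tilde K'_i)^{-1},\quad T''_{i,-1}(F_i)=-(\tilde K'_i)^{-1}E_i,\quad T''_{i,-1}(E_i)=-F_i\tilde K_i^{-1},$$ and for $j\ne i$ $$T''_{i,-e}(F_j)=\sum_{r=0}^{-c_{ij}}(-1)^rv^{-er}F_i^{(r)}F_jF_i^{(-c_{ij}-r)},\qquad T''_{i,-e}(E_j)=\sum_{r=0}^{-c_{ij}}(-1)^rv^{er}E_i^{(-c_{ij}-r)}E_jE_i^{(r)}.$$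
   Context: Let $I$ be a finite set and $C=(c_{ij})_{i,j\in I}$ a symmetric generalized Cartan matrix ($c_{ii}=2$, $c_{ij}=c_{ji}\in\mathbb{Z}_{\le0}$ for $i\ne j$). Let $v$ be an indeterminate, $[m]=\frac{v^m-v^{-m}}{v-v^{-1}}$, $[r]^!=\prod_{i=1}^r[i]$, $\begin{bmatrix}m\\ r\end{bmatrix}=\frac{[m][m-1]\cdots[m-r+1]}{[r]^!}$, and $X^{(m)}=X^m/[m]^!$ for $X=E_i$ or $F_i$. $\widetilde U$ (the Drinfeld double quantum group) is the $\mathbb{Q}(v)$-algebra generated by $E_i,F_i,\tilde K_i,\tilde K_i'$ ($i\in I$), with $\tilde K_i,\tilde K'_i$ invertible, subject to: all $\tilde K_i,\tilde K'_j$ commute with each other; $[E_i,F_j]=\delta_{ij}\frac{\tilde K_i-\tilde K'_i}{v-v^{-1}}$; $\tilde K_iE_j=v^{c_{ij}}E_j\tilde K_i$, $\tilde K_iF_j=v^{-c_{ij}}F_j\tilde K_i$, $\tilde K'_iE_j=v^{-c_{ij}}E_j\tilde K'_i$, $\tilde K'_iF_j=v^{c_{ij}}F_j\tilde K'_i$; and for $i\ne j$ the quantum Serre relations $\sum_{r=0}^{1-c_{ij}}(-1)^r\begin{bmatrix}1-c_{ij}\\ r\end{bmatrix}X_i^rX_jX_i^{1-c_{ij}-r}=0$ for $X=E$ and for $X=F$. The bar involution $\psi$ is the $\mathbb{Q}$-algebra automorphism of $\widetilde U$ with $\psi(v)=v^{-1}$, $\psi(\tilde K_i)=\tilde K'_i$,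 $\psi(\tilde K'_i)=\tilde K_i$, $\psi(E_i)=E_i$, $\psi(F_i)=F_i$. *)

theory Defs
  imports
    "HOL-Computational_Algebra.Polynomial_Factorial"
    "HOL-Library.Poly_Mapping"
    "HOL-Algebra.QuotRing"
    "HOL-Algebra.Module"
begin

section \<open>The field of rational functions and quantum integers\<close>

type_synonym Qv = "rat poly fract"

definition vv :: Qv where
  "vv = to_fract [:0, 1:]"

definition qint :: "int \<Rightarrow> Qv" where
  "qint m = (vv powi m - vv powi (- m)) / (vv - inverse vv)"

definition qfact :: "nat \<Rightarrow> Qv" where
  "qfact r = (\<Prod>k = 1..r. qint (int k))"

definition qbinom :: "int \<Rightarrow> nat \<Rightarrow> Qv" where
  "qbinom m r = (\<Prod>k<r. qint (m - int k)) / qfact r"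


section \<open>Symmetric generalized Cartan matrices\<close>

definition symmetric_gcm :: "('i \<Rightarrow> 'i \<Rightarrow> int) \<Rightarrow> bool" where
  "symmetric_gcm c \<longleftrightarrow>
     (\<forall>i. c i i = 2) \<and> (\<forall>i j. c i j = c j i) \<and> (\<forall>i j. i \<noteq> j \<longrightarrow> c i j \<le> 0)"


section \<open>Free associative algebras\<close>

text \<open>The free algebra on a set of generators is the monoid algebra of the free monoid; the
  free monoid is written additively because \<^theory>\<open>HOL-Library.Poly_Mapping\<close> defines the
  convolution product for additive monoids (commutativity is not required).\<close>

datatype 'g fmonoid = FM (letters: "'g list")

instantiation fmonoid :: (type) monoid_add
begin
definition "0 = FM []"
definition "x + y = FM (letters x @ letters y)"
instance
  by standard (simp_all add: zero_fmonoid_def plus_fmonoid_def)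
end

type_synonym 'g free_alg = "'g fmonoid \<Rightarrow>\<^sub>0 Qv"

definition gen :: "'g \<Rightarrow> 'g free_alg" where
  "gen g = Poly_Mapping.single (FM [g]) 1"

definition scal :: "Qv \<Rightarrow> 'g free_alg" where
  "scal k = Poly_Mapping.single 0 k"

definition free_ring :: "'g free_alg ring" where
  "free_ring = \<lparr>carrier = UNIV, mult = (*), one = 1, zero = 0, add = (+)\<rparr>"


section \<open>The Drinfeld double quantum group\<close>

text \<open>\<open>KtI\<close> and \<open>KpI\<close> are the formal inverses of the generators \<open>Kt\<close> (the K with a tilde)
  and \<open>Kp\<close> (its primed version).\<close>

datatype 'i ugen = Eg 'i | Fg 'i | Kt 'i | KtI 'i | Kp 'i | KpI 'i

definition serre :: "('i \<Rightarrow> 'i \<Rightarrow> int) \<Rightarrow> ('i \<Rightarrow> 'i ugen) \<Rightarrow> 'i \<Rightarrow> 'i \<Rightarrow> 'i ugen free_alg" where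
  "serre c X i j =
     (\<Sum>r\<le>nat (1 - c i j). scal ((- 1) ^ r * qbinom (1 - c i j) r)
        * (gen (X i) ^ r * gen (X j) * gen (X i) ^ (nat (1 - c i j) - r)))"

text \<open>A relation lhs = rhs is represented by the element lhs - rhs of the free algebra.\<close>

inductive_set urel :: "('i \<Rightarrow> 'i \<Rightarrow> int) \<Rightarrow> 'i ugen free_alg set"
  for c :: "'i \<Rightarrow> 'i \<Rightarrow> int" where
  Kt_inv_r: "gen (Kt i) * gen (KtI i) - 1 \<in> urel c"
| Kt_inv_l: "gen (KtI i) * gen (Kt i) - 1 \<in> urel c"
| Kp_inv_r: "gen (Kp i) * gen (KpI i) - 1 \<in> urel c"
| Kp_inv_l: "gen (KpI i) * gen (Kp i) - 1 \<in> urel c"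
| Kt_Kt: "gen (Kt i) * gen (Kt j) - gen (Kt j) * gen (Kt i) \<in> urel c"
| Kt_Kp: "gen (Kt i) * gen (Kp j) - gen (Kp j) * gen (Kt i) \<in> urel c"
| Kp_Kp: "gen (Kp i) * gen (Kp j) - gen (Kp j) * gen (Kp i) \<in> urel c"
| E_F: "gen (Eg i) * gen (Fg j) - gen (Fg j) * gen (Eg i)
      - (if i = j then scal (1 / (vv - inverse vv)) * (gen (Kt i) - gen (Kp i)) else 0) \<in> urel c"
| Kt_E: "gen (Kt i) * gen (Eg j) - scal (vv powi c i j) * (gen (Eg j) * gen (Kt i)) \<in> urel c"
| Kt_F: "gen (Kt i) * gen (Fg j) - scal (vv powi (- c i j)) * (gen (Fg j) * gen (Kt i)) \<in> urel c"
| Kp_E: "gen (Kp i) * gen (Eg j) - scal (vv powi (- c i j)) * (gen (Eg j) * gen (Kp i)) \<in> urel c"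
| Kp_F: "gen (Kp i) * gen (Fg j) - scal (vv powi c i j) * (gen (Fg j) * gen (Kp i)) \<in> urel c"
| Serre_E: "i \<noteq> j \<Longrightarrow> serre c Eg i j \<in> urel c"
| Serre_F: "i \<noteq> j \<Longrightarrow> serre c Fg i j \<in> urel c"

definition uideal :: "('i \<Rightarrow> 'i \<Rightarrow> int) \<Rightarrow> 'i ugen free_alg set" where
  "uideal c = genideal free_ring (urel c)"

definition ucls :: "('i \<Rightarrow> 'i \<Rightarrow> int) \<Rightarrow> 'i ugen free_alg \<Rightarrow> 'i ugen free_alg set" where
  "ucls c x = uideal c +>\<^bsub>free_ring\<^esub> x"

definition Ut :: "('i \<Rightarrow> 'i \<Rightarrow> int) \<Rightarrow> (Qv, 'i ugen free_alg set) module" where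
  "Ut c = ring.extend (free_ring Quot uideal c)
     (module.fields (\<lambda>k X. ucls c (scal k) \<otimes>\<^bsub>free_ring Quot uideal c\<^esub> X))"

definition uE :: "('i \<Rightarrow> 'i \<Rightarrow> int) \<Rightarrow> 'i \<Rightarrow> 'i ugen free_alg set" where
  "uE c i = ucls c (gen (Eg i))"

definition uF :: "('i \<Rightarrow> 'i \<Rightarrow> int) \<Rightarrow> 'i \<Rightarrow> 'i ugen free_alg set" where
  "uF c i = ucls c (gen (Fg i))"

definition uK :: "('i \<Rightarrow> 'i \<Rightarrow> int) \<Rightarrow> 'i \<Rightarrow> 'i ugen free_alg set" where
  "uK c i = ucls c (gen (Kt i))"

definition uK' :: "('i \<Rightarrow> 'i \<Rightarrow> int) \<Rightarrow> 'i \<Rightarrow> 'i ugen free_alg set" where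
  "uK' c i = ucls c (gen (Kp i))"

definition divpow :: "('i \<Rightarrow> 'i \<Rightarrow> int) \<Rightarrow> 'i ugen free_alg set \<Rightarrow> nat \<Rightarrow> 'i ugen free_alg set" where
  "divpow c X m = inverse (qfact m) \<odot>\<^bsub>Ut c\<^esub> (X [^]\<^bsub>Ut c\<^esub> m)"

text \<open>Automorphisms of a unital associative algebra given as a module record. The locale
  \<^locale>\<open>algebra\<close> of HOL-Algebra is not used since it requires commutativity.\<close>

definition alg_auto :: "('k, 'a) module \<Rightarrow> ('a \<Rightarrow> 'a) set" where
  "alg_auto A = {T \<in> ring_iso A A. \<forall>k. \<forall>x\<in>carrier A. T (k \<odot>\<^bsub>A\<^esub> x) = k \<odot>\<^bsub>A\<^esub> T x}"


section \<open>The bar involution\<close>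

text \<open>On coefficients: substitute the inverse of the indeterminate in numerator and
  denominator.\<close>

definition subst_inv :: "rat poly \<Rightarrow> Qv" where
  "subst_inv p = poly (map_poly (\<lambda>q. to_fract [:q:]) p) (inverse vv)"

definition bar_coeff :: "Qv \<Rightarrow> Qv" where
  "bar_coeff f = (THE g. \<exists>a b. b \<noteq> 0 \<and> f = Fract a b \<and> g = subst_inv a / subst_inv b)"

fun bar_gen :: "'i ugen \<Rightarrow> 'i ugen" where
  "bar_gen (Eg i) = Eg i"
| "bar_gen (Fg i) = Fg i"
| "bar_gen (Kt i) = Kp i"
| "bar_gen (KtI i) = KpI i"
| "bar_gen (Kp i) = Kt i"
| "bar_gen (KpI i) = KtI i"

definition bar_word :: "'i ugen fmonoid \<Rightarrow> 'i ugen fmonoid" where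
  "bar_word w = FM (map bar_gen (letters w))"

definition bar_free :: "'i ugen free_alg \<Rightarrow> 'i ugen free_alg" where
  "bar_free p = (\<Sum>w\<in>Poly_Mapping.keys p.
     Poly_Mapping.single (bar_word w) (bar_coeff (Poly_Mapping.lookup p w)))"

text \<open>The ideal of relations is stable under \<^const>\<open>bar_free\<close>, so taking images of cosets is
  the induced map on the quotient; \<open>bar_ring_iso\<close> and the lemmas after it show that this is
  the semilinear automorphism prescribed on generators.\<close>

definition bar :: "'i ugen free_alg set \<Rightarrow> 'i ugen free_alg set" where
  "bar X = bar_free ` X"


subsection \<open>Well-definedness\<close>

lemma vv_nonzero [simp]: "vv \<noteq> 0"
  by (simp add: vv_def flip: to_fract_0)

lemma subst_inv_pCons [simp]:
  "subst_inv (pCons a p) = to_fract [:a:] + inverse vv * subst_inv p"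
  by (cases "a = 0 \<and> p = 0") (auto simp: subst_inv_def map_poly_pCons)

lemma subst_inv_0 [simp]: "subst_inv 0 = 0"
  by (simp add: subst_inv_def)

lemma subst_inv_add: "subst_inv (p + q) = subst_inv p + subst_inv q"
proof (induction p q rule: poly_induct2)
  case (pCons a p b q)
  have "to_fract [:a + b:] = to_fract [:a:] + (to_fract [:b:] :: Qv)"
    by (simp flip: to_fract_add)
  with pCons show ?case by (simp add: algebra_simps)
qed auto

lemma subst_inv_smult: "subst_inv (Polynomial.smult a p) = to_fract [:a:] * subst_inv p"
proof (induction p)
  case (pCons b p)
  have "to_fract [:a * b:] = to_fract [:a:] * (to_fract [:b:] :: Qv)"
    by (simp flip: to_fract_mult)
  with pCons show ?case by (simp add: algebra_simps)
qed auto

lemma subst_inv_mult: "subst_inv (p * q) = subst_inv p * subst_inv q"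
  by (induction p) (simp_all add: subst_inv_add subst_inv_smult algebra_simps)

lemma poly_const_vv: "poly (map_poly (\<lambda>q. to_fract [:q:]) p) vv = to_fract p"
proof (induction p)
  case (pCons a p)
  have "to_fract (pCons a p) = to_fract [:a:] + vv * to_fract p"
    unfolding vv_def by (simp flip: to_fract_add to_fract_mult)
  with pCons show ?case by (simp add: map_poly_pCons)
qed auto

lemma subst_inv_nonzero:
  assumes "p \<noteq> 0" shows "subst_inv p \<noteq> 0"
proof -
  let ?h = "map_poly (\<lambda>q::rat. to_fract [:q:])"
  have deg: "degree (?h p) = degree p"
    by (rule degree_map_poly) auto
  have "reflect_poly (?h p) = ?h (reflect_poly p)"
    by (intro poly_eqI) (auto simp: coeff_reflect_poly coeff_map_poly deg)
  hence "to_fract (reflect_poly p) = vv ^ degree p * subst_inv p"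
    using poly_reflect_poly_nz[of vv "?h p"] by (simp add: poly_const_vv subst_inv_def deg)
  moreover have "to_fract (reflect_poly p) \<noteq> (0 :: Qv)"
    using assms by simp
  ultimately show ?thesis by auto
qed

lemma bar_coeff_Fract:
  assumes "b \<noteq> 0" shows "bar_coeff (Fract a b) = subst_inv a / subst_inv b"
  unfolding bar_coeff_def
proof (rule the_equality)
  show "\<exists>a' b'. b' \<noteq> 0 \<and> Fract a b = Fract a' b' \<and>
          subst_inv a / subst_inv b = subst_inv a' / subst_inv b'"
    using assms by blast
next
  fix g
  assume "\<exists>a' b'. b' \<noteq> 0 \<and> Fract a b = Fract a' b' \<and> g = subst_inv a' / subst_inv b'"
  then obtain a' b' where *: "b' \<noteq> 0" "Fract a b = Fract a' b'" "g = subst_inv a' / subst_inv b'"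
    by blast
  hence "a * b' = a' * b" using assms by (simp add: eq_fract)
  hence "subst_inv a * subst_inv b' = subst_inv a' * subst_inv b"
    by (simp flip: subst_inv_mult)
  thus "g = subst_inv a / subst_inv b"
    using subst_inv_nonzero[OF assms] subst_inv_nonzero[OF *(1)] by (simp add: *(3) frac_eq_eq)
qed

lemma subst_inv_1 [simp]: "subst_inv 1 = 1"
proof -
  have "subst_inv [:1:] = 1"
    unfolding subst_inv_pCons by (simp flip: one_pCons)
  thus ?thesis by (simp add: one_pCons)
qed

lemma bar_coeff_to_fract: "bar_coeff (to_fract p) = subst_inv p"
  by (simp add: to_fract_def bar_coeff_Fract)

lemma bar_coeff_0 [simp]: "bar_coeff 0 = 0"
  using bar_coeff_to_fract[of 0] by simp

lemma bar_coeff_1 [simp]: "bar_coeff 1 = 1"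
  using bar_coeff_to_fract[of 1] by simp

lemma bar_coeff_add: "bar_coeff (x + y) = bar_coeff x + bar_coeff y"
proof (cases x; cases y)
  fix a b c d :: "rat poly"
  assume "x = Fract a b" "b \<noteq> 0" "y = Fract c d" "d \<noteq> 0"
  thus ?thesis
    by (simp add: bar_coeff_Fract subst_inv_add subst_inv_mult subst_inv_nonzero field_simps)
qed

lemma bar_coeff_mult: "bar_coeff (x * y) = bar_coeff x * bar_coeff y"
proof (cases x; cases y)
  fix a b c d :: "rat poly"
  assume "x = Fract a b" "b \<noteq> 0" "y = Fract c d" "d \<noteq> 0"
  thus ?thesis
    by (simp add: bar_coeff_Fract subst_inv_mult)
qed

lemma bar_coeff_uminus: "bar_coeff (- x) = - bar_coeff x"
  using bar_coeff_add[of x "- x"] by (simp add: eq_neg_iff_add_eq_0 add.commute)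

lemma bar_coeff_diff: "bar_coeff (x - y) = bar_coeff x - bar_coeff y"
  using bar_coeff_add[of x "- y"] by (simp add: bar_coeff_uminus)

lemma bar_coeff_inverse: "bar_coeff (inverse x) = inverse (bar_coeff x)"
proof (cases "x = 0")
  case False
  hence "bar_coeff x * bar_coeff (inverse x) = 1"
    by (simp flip: bar_coeff_mult)
  thus ?thesis by (metis inverse_unique)
qed auto

lemma bar_coeff_divide: "bar_coeff (x / y) = bar_coeff x / bar_coeff y"
  by (simp add: divide_inverse bar_coeff_mult bar_coeff_inverse)

lemma bar_coeff_power: "bar_coeff (x ^ n) = bar_coeff x ^ n"
  by (induction n) (simp_all add: bar_coeff_mult)

lemma bar_coeff_prod: "bar_coeff (prod f A) = (\<Prod>x\<in>A. bar_coeff (f x))"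
  by (induction A rule: infinite_finite_induct) (simp_all add: bar_coeff_mult)

lemma bar_coeff_vv [simp]: "bar_coeff vv = inverse vv"
proof -
  have "to_fract [:1:] = (1 :: Qv)" by (simp flip: one_pCons)
  thus ?thesis unfolding vv_def bar_coeff_to_fract by (simp add: vv_def)
qed

lemma bar_coeff_subst_inv: "bar_coeff (subst_inv p) = to_fract p"
proof (induction p)
  case (pCons a p)
  have "to_fract (pCons a p) = to_fract [:a:] + vv * to_fract p"
    unfolding vv_def by (simp flip: to_fract_add to_fract_mult)
  with pCons show ?case
    by (simp add: bar_coeff_add bar_coeff_mult bar_coeff_inverse bar_coeff_to_fract)
qed auto

lemma bar_coeff_bar_coeff [simp]: "bar_coeff (bar_coeff x) = x"
proof (cases x)
  case (Fract a b)
  thus ?thesis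
    by (simp add: bar_coeff_Fract bar_coeff_divide bar_coeff_subst_inv to_fract_def)
qed

lemma bar_coeff_powi: "bar_coeff (vv powi m) = vv powi (- m)"
  by (simp add: power_int_def bar_coeff_power bar_coeff_inverse)

lemma bar_coeff_qint: "bar_coeff (qint m) = qint m"
proof -
  have "bar_coeff (qint m) = (- (vv powi m - vv powi (- m))) / (- (vv - inverse vv))"
    by (simp add: qint_def bar_coeff_divide bar_coeff_diff bar_coeff_powi bar_coeff_inverse)
  thus ?thesis unfolding qint_def by (simp only: minus_divide_divide)
qed

lemma bar_coeff_qbinom: "bar_coeff (qbinom m r) = qbinom m r"
  by (simp add: qbinom_def qfact_def bar_coeff_divide bar_coeff_prod bar_coeff_qint)

lemma bar_gen_bar_gen [simp]: "bar_gen (bar_gen g) = g"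
  by (cases g) auto

lemma bar_word_bar_word [simp]: "bar_word (bar_word w) = w"
  by (cases w) (simp add: bar_word_def comp_def)

lemma bar_word_plus: "bar_word (a + b) = bar_word a + bar_word b"
  by (simp add: bar_word_def plus_fmonoid_def)

lemma bar_word_0 [simp]: "bar_word 0 = 0"
  by (simp add: bar_word_def zero_fmonoid_def)

lemma lookup_bar_free:
  "Poly_Mapping.lookup (bar_free p) w = bar_coeff (Poly_Mapping.lookup p (bar_word w))"
proof -
  have eq: "bar_word u = w \<longleftrightarrow> u = bar_word w" for u by auto
  have "Poly_Mapping.lookup (bar_free p) w =
      (\<Sum>u\<in>Poly_Mapping.keys p. if u = bar_word w then bar_coeff (Poly_Mapping.lookup p u) else 0)"
    unfolding bar_free_def lookup_sum
    by (intro sum.cong) (auto simp: lookup_single when_def eq)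
  also have "\<dots> = bar_coeff (Poly_Mapping.lookup p (bar_word w))"
    by (auto simp: in_keys_iff)
  finally show ?thesis .
qed

lemma bar_free_add: "bar_free (p + q) = bar_free p + bar_free q"
  by (intro poly_mapping_eqI) (simp add: lookup_bar_free lookup_add bar_coeff_add)

lemma bar_free_0 [simp]: "bar_free 0 = 0"
  by (simp add: bar_free_def)

lemma bar_free_uminus: "bar_free (- p) = - bar_free p"
  by (intro poly_mapping_eqI) (simp add: lookup_bar_free bar_coeff_uminus)

lemma bar_free_diff: "bar_free (p - q) = bar_free p - bar_free q"
  by (intro poly_mapping_eqI) (simp add: lookup_bar_free lookup_minus bar_coeff_diff)

lemma bar_free_sum: "bar_free (sum f A) = (\<Sum>x\<in>A. bar_free (f x))"
  by (induction A rule: infinite_finite_induct) (simp_all add: bar_free_add)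

lemma bar_free_bar_free [simp]: "bar_free (bar_free p) = p"
  by (intro poly_mapping_eqI) (simp add: lookup_bar_free)

lemma bar_free_single:
  "bar_free (Poly_Mapping.single w k) = Poly_Mapping.single (bar_word w) (bar_coeff k)"
  by (cases "k = 0") (simp_all add: bar_free_def)

lemma free_alg_expand:
  "(p :: 'g free_alg) = (\<Sum>w\<in>Poly_Mapping.keys p. Poly_Mapping.single w (Poly_Mapping.lookup p w))"
proof (rule poly_mapping_eqI)
  fix u
  have "(\<Sum>w\<in>Poly_Mapping.keys p. Poly_Mapping.lookup (Poly_Mapping.single w (Poly_Mapping.lookup p w)) u)
      = (\<Sum>w\<in>Poly_Mapping.keys p. if w = u then Poly_Mapping.lookup p w else 0)"
    by (intro sum.cong) (auto simp: lookup_single when_def)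
  thus "Poly_Mapping.lookup p u = Poly_Mapping.lookup
      (\<Sum>w\<in>Poly_Mapping.keys p. Poly_Mapping.single w (Poly_Mapping.lookup p w)) u"
    by (simp add: lookup_sum in_keys_iff)
qed

lemma bar_free_mult: "bar_free (p * q) = bar_free p * bar_free q"
proof -
  obtain A f where p: "p = (\<Sum>w\<in>A. Poly_Mapping.single w (f w))"
    by (rule that[OF free_alg_expand])
  obtain B g where q: "q = (\<Sum>u\<in>B. Poly_Mapping.single u (g u))"
    by (rule that[OF free_alg_expand])
  show ?thesis
    by (simp add: p q sum_product bar_free_sum bar_free_single mult_single bar_word_plus bar_coeff_mult)
qed

lemma bar_free_1 [simp]: "bar_free 1 = 1"
  using bar_free_single[of 0 1] by simp

lemma bar_free_power: "bar_free (p ^ n) = bar_free p ^ n"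
  by (induction n) (simp_all add: bar_free_mult)

lemma bar_free_gen [simp]: "bar_free (gen g) = gen (bar_gen g)"
  by (simp add: gen_def bar_free_single bar_word_def)

lemma bar_free_scal [simp]: "bar_free (scal k) = scal (bar_coeff k)"
  by (simp add: scal_def bar_free_single)

lemma free_ring_simps [simp]:
  "carrier free_ring = UNIV" "mult free_ring = (*)" "one free_ring = 1"
  "zero free_ring = 0" "add free_ring = (+)"
  by (simp_all add: free_ring_def)

lemma ring_free_ring: "ring free_ring"
proof (rule ringI)
  show "abelian_group free_ring"
    by (rule abelian_groupI) (auto simp: algebra_simps intro: exI[of _ "- x" for x])
  show "Group.monoid free_ring"
    by (rule monoidI) (auto simp: algebra_simps)
qed (auto simp: algebra_simps)

lemma ideal_uideal: "ideal (uideal c) free_ring"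
  unfolding uideal_def by (rule ring.genideal_ideal[OF ring_free_ring]) auto

lemma urel_subset_uideal: "urel c \<subseteq> uideal c"
  unfolding uideal_def by (rule ring.genideal_self[OF ring_free_ring]) auto

lemma a_inv_free_ring: "a_inv free_ring x = - x"
proof -
  interpret ring free_ring by (rule ring_free_ring)
  show ?thesis using minus_equality[of "- x" x] by simp
qed

lemma uideal_closed:
  "0 \<in> uideal c"
  "x \<in> uideal c \<Longrightarrow> y \<in> uideal c \<Longrightarrow> x + y \<in> uideal c"
  "x \<in> uideal c \<Longrightarrow> - x \<in> uideal c"
  "x \<in> uideal c \<Longrightarrow> y * x \<in> uideal c"
  "x \<in> uideal c \<Longrightarrow> x * y \<in> uideal c"
proof -
  interpret ideal "uideal c" free_ring by (rule ideal_uideal)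
  show "0 \<in> uideal c" using additive_subgroup.zero_closed[OF is_additive_subgroup] by simp
  show "x \<in> uideal c \<Longrightarrow> y \<in> uideal c \<Longrightarrow> x + y \<in> uideal c" using additive_subgroup.a_closed[OF is_additive_subgroup] by simp
  show "x \<in> uideal c \<Longrightarrow> - x \<in> uideal c" using I_l_closed[of x "- 1"] by simp
  show "x \<in> uideal c \<Longrightarrow> y * x \<in> uideal c" using I_l_closed[of x y] by simp
  show "x \<in> uideal c \<Longrightarrow> x * y \<in> uideal c" using I_r_closed[of x y] by simp
qed

lemma bar_free_serre:
  assumes "\<And>i. bar_gen (X i) = X i"
  shows "bar_free (serre c X i j) = serre c X i j"
  unfolding serre_def
  by (simp add: bar_free_sum bar_free_mult bar_free_power assms bar_coeff_mult bar_coeff_power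
        bar_coeff_uminus bar_coeff_qbinom)

lemma bar_free_urel:
  assumes "x \<in> urel c" shows "bar_free x \<in> uideal c"
  using assms
proof cases
  case (Kt_Kp i j)
  have "- bar_free x = gen (Kt j) * gen (Kp i) - gen (Kp i) * gen (Kt j)"
    by (simp add: Kt_Kp bar_free_diff bar_free_mult)
  also have "\<dots> \<in> uideal c" using urel_subset_uideal urel.Kt_Kp by fast
  finally show ?thesis using uideal_closed(3)[of "- bar_free x" c] by simp
next
  case (E_F i j)
  have "scal (inverse (inverse vv - vv)) = - (scal (inverse (vv - inverse vv)) :: 'a ugen free_alg)"
    unfolding scal_def by (metis inverse_minus_eq minus_diff_eq single_uminus)
  hence "bar_free x = x"
    by (simp add: E_F bar_free_add bar_free_diff bar_free_mult bar_coeff_divide bar_coeff_diff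
        bar_coeff_inverse divide_inverse right_diff_distrib)
  thus ?thesis using assms urel_subset_uideal by auto
qed (use urel_subset_uideal[of c] in \<open>auto simp: bar_free_diff bar_free_mult bar_coeff_powi
      bar_free_serre intro!: urel.intros\<close>)+

lemma bar_free_uideal:
  assumes "x \<in> uideal c" shows "bar_free x \<in> uideal c"
proof -
  have "ideal {x. bar_free x \<in> uideal c} free_ring"
  proof (rule idealI[OF ring_free_ring])
    show "subgroup {x. bar_free x \<in> uideal c} (add_monoid free_ring)"
    proof
      show "inv\<^bsub>add_monoid free_ring\<^esub> x \<in> {x. bar_free x \<in> uideal c}"
        if "x \<in> {x. bar_free x \<in> uideal c}" for x
        using that a_inv_free_ring[of x]
        by (simp add: a_inv_def bar_free_uminus uideal_closed)
    qed (auto simp: uideal_closed bar_free_add)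
  qed (auto simp: bar_free_mult uideal_closed)
  hence "uideal c \<subseteq> {x. bar_free x \<in> uideal c}"
    using ring.genideal_minimal[OF ring_free_ring] bar_free_urel unfolding uideal_def[of c]
    by (metis (no_types, lifting) mem_Collect_eq subsetI uideal_def)
  thus ?thesis using assms by auto
qed

lemma ucls_eq: "ucls c x = {y. y - x \<in> uideal c}"
  by (force simp: ucls_def a_r_coset_def r_coset_def)

lemma Ut_simps:
  "carrier (Ut c) = range (ucls c)" "one (Ut c) = ucls c 1" "zero (Ut c) = ucls c 0"
  "ucls c x \<otimes>\<^bsub>Ut c\<^esub> ucls c y = ucls c (x * y)"
  "ucls c x \<oplus>\<^bsub>Ut c\<^esub> ucls c y = ucls c (x + y)"
  "k \<odot>\<^bsub>Ut c\<^esub> ucls c x = ucls c (scal k * x)"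
proof -
  interpret ideal "uideal c" free_ring by (rule ideal_uideal)
  have m: "ucls c x \<otimes>\<^bsub>free_ring Quot uideal c\<^esub> ucls c y = ucls c (x * y)" for x y
    using rcoset_mult_add[of x y] by (simp add: ucls_def FactRing_def)
  have a: "ucls c x \<oplus>\<^bsub>free_ring Quot uideal c\<^esub> ucls c y = ucls c (x + y)" for x y
    using a_rcos_sum[of x y] by (simp add: ucls_def FactRing_def)
  show "ucls c x \<otimes>\<^bsub>Ut c\<^esub> ucls c y = ucls c (x * y)"
    "ucls c x \<oplus>\<^bsub>Ut c\<^esub> ucls c y = ucls c (x + y)"
    "k \<odot>\<^bsub>Ut c\<^esub> ucls c x = ucls c (scal k * x)"
    using m a by (simp_all add: Ut_def ring.defs module.defs)
  show "carrier (Ut c) = range (ucls c)"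
    by (auto simp: Ut_def ring.defs module.defs FactRing_def A_RCOSETS_def RCOSETS_def ucls_def
        a_r_coset_def)
  show "one (Ut c) = ucls c 1"
    by (simp add: Ut_def ring.defs module.defs FactRing_def ucls_def)
  show "zero (Ut c) = ucls c 0"
    by (simp add: Ut_def ring.defs module.defs FactRing_def ucls_eq)
qed

lemma ring_Ut: "ring (Ut c)"
proof (rule ringI)
  show "abelian_group (Ut c)"
  proof (rule abelian_groupI)
    show "\<exists>y\<in>carrier (Ut c). y \<oplus>\<^bsub>Ut c\<^esub> x = \<zero>\<^bsub>Ut c\<^esub>" if "x \<in> carrier (Ut c)" for x
    proof -
      from that obtain a where "x = ucls c a" by (auto simp: Ut_simps)
      thus ?thesis by (intro bexI[of _ "ucls c (- a)"]) (auto simp: Ut_simps)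
    qed
  qed (auto simp: Ut_simps algebra_simps)
  show "Group.monoid (Ut c)"
    by (rule monoidI) (auto simp: Ut_simps algebra_simps)
qed (auto simp: Ut_simps algebra_simps)

lemma scal_commute: "scal k * x = x * (scal k :: 'g free_alg)"
proof -
  obtain A f where x: "x = (\<Sum>w\<in>A. Poly_Mapping.single w (f w))"
    by (rule that[OF free_alg_expand])
  show ?thesis
    by (simp add: x sum_distrib_left sum_distrib_right scal_def mult_single mult.commute)
qed

lemma Ut_smult_mult:
  assumes "x \<in> carrier (Ut c)" "y \<in> carrier (Ut c)"
  shows "(k \<odot>\<^bsub>Ut c\<^esub> x) \<otimes>\<^bsub>Ut c\<^esub> y = k \<odot>\<^bsub>Ut c\<^esub> (x \<otimes>\<^bsub>Ut c\<^esub> y)"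
    and "x \<otimes>\<^bsub>Ut c\<^esub> (k \<odot>\<^bsub>Ut c\<^esub> y) = k \<odot>\<^bsub>Ut c\<^esub> (x \<otimes>\<^bsub>Ut c\<^esub> y)"
proof -
  obtain a b where ab: "x = ucls c a" "y = ucls c b" using assms by (auto simp: Ut_simps)
  show "(k \<odot>\<^bsub>Ut c\<^esub> x) \<otimes>\<^bsub>Ut c\<^esub> y = k \<odot>\<^bsub>Ut c\<^esub> (x \<otimes>\<^bsub>Ut c\<^esub> y)"
    by (simp add: ab Ut_simps mult.assoc)
  have "a * (scal k * b) = scal k * (a * b)"
    by (metis mult.assoc scal_commute)
  thus "x \<otimes>\<^bsub>Ut c\<^esub> (k \<odot>\<^bsub>Ut c\<^esub> y) = k \<odot>\<^bsub>Ut c\<^esub> (x \<otimes>\<^bsub>Ut c\<^esub> y)"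
    by (simp add: ab Ut_simps)
qed

lemma bar_ucls: "bar (ucls c x) = ucls c (bar_free x)"
proof -
  have *: "bar_free ` ucls c x \<subseteq> ucls c (bar_free x)" for x
    using bar_free_uideal[of _ c] by (auto simp: ucls_eq simp flip: bar_free_diff)
  show ?thesis
  proof
    show "ucls c (bar_free x) \<subseteq> bar (ucls c x)"
    proof
      fix y assume "y \<in> ucls c (bar_free x)"
      hence "bar_free y \<in> ucls c x" using *[of "bar_free x"] by auto
      thus "y \<in> bar (ucls c x)" unfolding bar_def by (rule rev_image_eqI) simp
    qed
  qed (use * in \<open>simp add: bar_def\<close>)
qed

lemma bar_bar [simp]: "bar (bar X) = X"
  by (auto simp: bar_def image_image)

lemma bar_ring_iso: "bar \<in> ring_iso (Ut c) (Ut c)"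
proof -
  have "bij_betw bar (carrier (Ut c)) (carrier (Ut c))"
    by (rule bij_betwI[where g = bar]) (auto simp: Ut_simps bar_ucls)
  moreover have "bar \<in> ring_hom (Ut c) (Ut c)"
    by (rule ring_hom_memI) (auto simp: Ut_simps bar_ucls bar_free_mult bar_free_add)
  ultimately show ?thesis by (simp add: ring_iso_def)
qed

lemma bar_smult:
  assumes "x \<in> carrier (Ut c)"
  shows "bar (k \<odot>\<^bsub>Ut c\<^esub> x) = bar_coeff k \<odot>\<^bsub>Ut c\<^esub> bar x"
  using assms by (auto simp: Ut_simps bar_ucls bar_free_mult)

lemma bar_generators:
  "bar (uE c i) = uE c i" "bar (uF c i) = uF c i" "bar (uK c i) = uK' c i" "bar (uK' c i) = uK c i"
  by (simp_all add: uE_def uF_def uK_def uK'_def bar_ucls)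

end

theory Submission
  imports Defs
begin

text \<open>
  Fix \<open>i\<close> and let \<open>a = - c i j\<close> for \<open>j \<noteq> i\<close>. Under the quantum adjoint action of the rank one
  subalgebra generated by \<open>E\<^sub>i, F\<^sub>i, K\<^sub>i, K'\<^sub>i\<close>, the root vector \<open>E\<^sub>j\<close> is a lowest weight
  vector of weight \<open>-a\<close>, and the Serre relation says that its string
  \<open>z\<^sub>m = ad E\<^sub>i\<^bsup>(m)\<^esup> (E\<^sub>j)\<close> stops at \<open>z\<^sub>a\<close>. The proposed image of \<open>E\<^sub>j\<close> under
  \<open>T = T''\<^bsub>i,1\<^esub>\<close> is exactly the top \<open>z\<^sub>a\<close>, that is, \<open>T\<close> exchanges the two ends of the string,
  as a simple reflection should. Everything follows from this picture.

  That the images satisfy the defining relations (\<open>drinfeld_double_T\<close>) splits into three kinds of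
  statements. For the Serre relations not involving \<open>i\<close>, the Leibniz rule for the adjoint
  action shows that passing from the bottom to the top of a string is multiplicative
  (\<open>extremal_mult\<close>). So a divided power of the adjoint action transforms the Serre relation
  between \<open>E\<^sub>j\<close> and \<open>E\<^sub>k\<close> into the one between their images. If \<open>i\<close> is involved,
  one of the images is \<open>- F\<^sub>i K'\<^sub>i\<^sup>-\<^sup>1\<close>. Twisted
  commutators with this element lower the string, so \<open>a + 1\<close> of them annihilate the
  top (\<open>qserre_lower_top\<close>). In the other order, the Serre relation between \<open>E\<^sub>j\<close> and \<open>E\<^sub>i\<close> becomes the
  desired one after a divided power of the adjoint action two degrees short of the maximal one is
  applied (\<open>qserre_top_lower\<close>). Finally, the commutators of a string of \<open>E\<close>'s with a string of \<open>F\<close>'s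
  satisfy a recursion, which shows that they vanish for \<open>j \<noteq> k\<close> and yields the reflected torus
  elements for \<open>j = k\<close> (\<open>commuting_strings\<close>, \<open>dual_strings_top\<close>). The relations among the \<open>F\<close>'s
  follow by the Chevalley involution, which commutes with \<open>T\<close> up to scalars.

  For bijectivity let \<open>\<sigma>\<close> be the anti-automorphism that fixes the \<open>E\<close>'s and \<open>F\<close>'s and exchanges
  \<open>K\<close> and \<open>K'\<close>. Lowering the top of a string down to its bottom gives \<open>T \<sigma> T = \<sigma>\<close>
  (\<open>braid_anti_braid\<close>), so \<open>T\<close> is invertible. The operator for the sign \<open>-1\<close> is the conjugate of
  \<open>T\<close> by the bar involution.

  The relations are manipulated in an algebra type rather than among cosets: the quantum double
  embeds into the type \<open>univ_alg\<close>, a product of the doubles of all matrices.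
\<close>

section \<open>Quantum integers\<close>

lemma vv_power_neq_1:
  assumes "n > 0" shows "vv ^ n \<noteq> 1"
proof
  assume "vv ^ n = 1"
  moreover have "to_fract [:0, 1::rat:] ^ k = to_fract ([:0, 1:] ^ k)" for k
    by (induction k) (simp_all only: power_0 power_Suc to_fract_1 to_fract_mult)
  ultimately have "to_fract ([:0, 1::rat:] ^ n) = to_fract 1"
    by (simp add: vv_def)
  hence "[:0, 1::rat:] ^ n = 1" by (simp only: to_fract_eq_iff)
  hence "poly ([:0, 1::rat:] ^ n) 0 = 1" by simp
  thus False using assms by (simp add: poly_power zero_power)
qed

lemma vv_neq_inverse [simp]: "vv \<noteq> inverse vv"
proof
  assume "vv = inverse vv"
  hence "vv * vv = 1" by (metis right_inverse vv_nonzero)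
  thus False using vv_power_neq_1[of 2] by (simp add: power2_eq_square)
qed

lemma vv_powi_add: "vv powi (m + n) = vv powi m * vv powi n"
  by (rule power_int_add) simp

lemma vv_powi_minus: "vv powi (- m) = inverse (vv powi m)"
  by (rule power_int_minus)

lemma vv_powi_mult: "(vv powi m) ^ n = vv powi (int n * m)"
  by (metis mult.commute power_int_mult power_int_of_nat)

lemma vv_powi_nonzero [simp]: "vv powi m \<noteq> 0"
  by simp

lemma qint_0 [simp]: "qint 0 = 0"
  by (simp add: qint_def)

lemma qint_1 [simp]: "qint 1 = 1"
  by (simp add: qint_def)

lemma qint_minus: "qint (- m) = - qint m"
  unfolding qint_def by (metis minus_diff_eq minus_divide_left minus_minus)

lemma qint_nonzero:
  assumes "m > 0" shows "qint m \<noteq> 0"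
proof
  assume "qint m = 0"
  hence "vv powi m = vv powi (- m)" using vv_neq_inverse by (simp add: qint_def)
  hence "vv powi m * vv powi m = 1" by (metis right_inverse vv_powi_minus vv_powi_nonzero)
  hence "vv powi (2 * m) = 1" by (simp flip: vv_powi_add)
  hence "vv ^ nat (2 * m) = 1" using assms by (simp add: power_int_def)
  thus False using vv_power_neq_1[of "nat (2 * m)"] assms by simp
qed

lemma qint_add: "qint (m + n) = vv powi (- n) * qint m + vv powi m * qint n"
  unfolding qint_def times_divide_eq_right add_divide_distrib[symmetric]
  by (simp add: right_diff_distrib algebra_simps flip: vv_powi_add)

lemma qint_add': "qint (m + n) = vv powi n * qint m + vv powi (- m) * qint n"
  using qint_add[of n m] by (simp add: add.commute)

lemma qfact_0 [simp]: "qfact 0 = 1"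
  by (simp add: qfact_def)

lemma qfact_Suc: "qfact (Suc n) = qint (int (Suc n)) * qfact n"
  by (simp add: qfact_def prod.atLeastAtMost_shift_0 atLeast0AtMost lessThan_Suc_atMost prod.nat_ivl_Suc' del: of_nat_Suc)

lemma qfact_nonzero [simp]: "qfact n \<noteq> 0"
  by (induction n) (simp_all add: qfact_Suc qint_nonzero del: of_nat_Suc)

lemma qbinom_0 [simp]: "qbinom m 0 = 1"
  by (simp add: qbinom_def)

lemma qbinom_Suc: "qbinom m (Suc r) = qbinom m r * qint (m - int r) / qint (int (Suc r))"
  by (simp add: qbinom_def qfact_Suc mult.commute del: of_nat_Suc)

lemma qbinom_Suc_left:
  "qbinom (m + 1) (Suc r) = qint (m + 1) / qint (int (Suc r)) * qbinom m r"
proof -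
  have "(\<Prod>k<Suc r. qint (m + 1 - int k)) = qint (m + 1) * (\<Prod>k<r. qint (m - int k))"
    by (subst prod.lessThan_Suc_shift) simp
  thus ?thesis by (simp add: qbinom_def qfact_Suc del: of_nat_Suc)
qed

text \<open>Both forms of the quantum Pascal rule are instances of this lemma, with \<open>q\<close> equal to
  \<^const>\<open>vv\<close> or to its inverse; the quantum binomials do not see the difference.\<close>

lemma qbinom_pascal:
  assumes "q = vv \<or> q = inverse vv"
  shows "qbinom (m + 1) (Suc r) =
    q powi int (Suc r) * qbinom m (Suc r) + q powi (int r - m) * qbinom m r"
proof -
  have nz: "qint (int (Suc r)) \<noteq> 0" by (rule qint_nonzero) simp
  have "qint (m + 1) = q powi int (Suc r) * qint (m - int r) + q powi (int r - m) * qint (int (Suc r))"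
    using assms qint_add[of "m - int r" "int (Suc r)"] qint_add'[of "m - int r" "int (Suc r)"]
    by (auto simp: power_int_inverse simp flip: vv_powi_minus)
  hence "qbinom (m + 1) (Suc r) = (q powi int (Suc r) * qint (m - int r)
      + q powi (int r - m) * qint (int (Suc r))) / qint (int (Suc r)) * qbinom m r"
    by (simp only: qbinom_Suc_left)
  thus ?thesis using nz
    by (simp add: qbinom_Suc add_divide_distrib ring_distribs mult_ac del: of_nat_Suc)
qed

lemma qbinom_eq_0: "n < r \<Longrightarrow> qbinom (int n) r = 0"
  by (auto simp: qbinom_def intro!: prod_zero bexI[of _ n])

lemma qbinom_qfact:
  "r \<le> n \<Longrightarrow> qbinom (int n) r = qfact n / (qfact r * qfact (n - r))"
proof (induction r)
  case (Suc r)
  have *: "qfact (n - r) = qint (int n - int r) * qfact (n - Suc r)"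
    using Suc.prems qfact_Suc[of "n - Suc r"] by (simp add: Suc_diff_Suc of_nat_diff)
  have "qint (int n - int r) \<noteq> 0" using Suc.prems by (intro qint_nonzero) simp
  thus ?case using Suc by (simp add: qbinom_Suc qfact_Suc * del: of_nat_Suc)
qed simp

text \<open>The partial sums telescope by the Pascal rule, and the last one carries the factor
  \<open>[n - 1 choose n] = 0\<close>.\<close>

lemma qbinom_alternating_sum:
  assumes "n > 0" "q = vv \<or> q = inverse vv"
  shows "(\<Sum>r\<le>n. (- 1) ^ r * qbinom (int n) r * (q powi (int n - 1)) ^ r) = 0"
proof -
  have q: "q \<noteq> 0" using assms(2) by auto
  have p: "(q powi m) ^ k = q powi (int k * m)" for m k
    by (metis mult.commute power_int_mult power_int_of_nat)
  have "(\<Sum>r\<le>u. (- 1) ^ r * qbinom (int n) r * (q powi (int n - 1)) ^ r) =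
      (- 1) ^ u * q powi (int u * int n) * qbinom (int n - 1) u" for u
  proof (induction u)
    case (Suc u)
    have a: "qbinom (int n) (Suc u) =
        q powi int (Suc u) * qbinom (int n - 1) (Suc u) + q powi (int u - (int n - 1)) * qbinom (int n - 1) u"
      using qbinom_pascal[OF assms(2), of "int n - 1" u] by simp
    have e1: "q powi (int (Suc u) * (int n - 1)) * q powi int (Suc u) = q powi (int (Suc u) * int n)"
      using q by (simp add: power_int_add[symmetric] algebra_simps)
    have e2: "q powi (int (Suc u) * (int n - 1)) * q powi (int u - (int n - 1)) = q powi (int u * int n)"
      using q by (simp add: power_int_add[symmetric] algebra_simps)
    have "qbinom (int n) (Suc u) * q powi (int (Suc u) * (int n - 1)) =
        q powi (int (Suc u) * int n) * qbinom (int n - 1) (Suc u) + q powi (int u * int n) * qbinom (int n - 1) u"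
      unfolding a e1[symmetric] e2[symmetric] by (simp only: ring_distribs mult_ac)
    thus ?case
      unfolding sum.atMost_Suc Suc p[of _ "Suc u"] by (simp add: ring_distribs mult.assoc)
  qed simp
  from this[of n] have "(\<Sum>r\<le>n. (- 1) ^ r * qbinom (int n) r * (q powi (int n - 1)) ^ r) =
      (- 1) ^ n * q powi (int n * int n) * qbinom (int (n - 1)) n"
    using assms(1) by (simp add: of_nat_diff)
  also have "qbinom (int (n - 1)) n = 0" using assms(1) by (intro qbinom_eq_0) simp
  finally show ?thesis by simp
qed


section \<open>Skew commutators in algebras over the field of rational functions\<close>

text \<open>Calculations with generators and relations take place in a type of this class, where products
can be normalized by rewriting. The scalar operation is kept apart from multiplication, so that
scalars can be collected in front of a non-commutative monomial.\<close>

class qalg = ring_1 +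
  fixes qscale :: "Qv \<Rightarrow> 'a \<Rightarrow> 'a"  (infixr "\<star>" 75)
  assumes qscale_add_right: "k \<star> (x + y) = k \<star> x + k \<star> y"
    and qscale_add_left: "(k + l) \<star> x = k \<star> x + l \<star> x"
    and qscale_qscale [simp]: "k \<star> l \<star> x = (k * l) \<star> x"
    and qscale_one [simp]: "1 \<star> x = x"
    and qscale_mult_left [simp]: "(k \<star> x) * y = k \<star> (x * y)"
    and qscale_mult_right [simp]: "x * (k \<star> y) = k \<star> (x * y)"
begin

lemma qscale_0_right [simp]: "k \<star> 0 = 0"
  using qscale_add_right[of k 0 0] by simp

lemma qscale_0_left [simp]: "0 \<star> x = 0"
  using qscale_add_left[of 0 0 x] by simp

lemma qscale_minus_right [simp]: "k \<star> (- x) = - (k \<star> x)"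
  using qscale_add_right[of k x "- x"] by (simp add: eq_neg_iff_add_eq_0 add.commute)

lemma qscale_minus_left [simp]: "(- k) \<star> x = - (k \<star> x)"
  using qscale_add_left[of k "- k" x] by (simp add: eq_neg_iff_add_eq_0 add.commute)

lemma qscale_diff_right: "k \<star> (x - y) = k \<star> x - k \<star> y"
  using qscale_add_right[of k x "- y"] by simp

lemma qscale_diff_left: "(k - l) \<star> x = k \<star> x - l \<star> x"
  using qscale_add_left[of k "- l" x] by simp

lemma qscale_sum_right: "k \<star> sum g A = (\<Sum>x\<in>A. k \<star> g x)"
  by (induction A rule: infinite_finite_induct) (simp_all add: qscale_add_right)

lemma qscale_sum_left: "sum g A \<star> x = (\<Sum>y\<in>A. g y \<star> x)"
  by (induction A rule: infinite_finite_induct) (simp_all add: qscale_add_left)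

lemmas qscale_distribs =
  qscale_add_right qscale_add_left qscale_diff_right qscale_diff_left
  qscale_sum_right qscale_sum_left

lemma qscale_cancel:
  assumes "k \<noteq> 0" shows "k \<star> x = k \<star> y \<longleftrightarrow> x = y"
proof
  assume "k \<star> x = k \<star> y"
  hence "inverse k \<star> k \<star> x = inverse k \<star> k \<star> y" by (rule arg_cong)
  thus "x = y" using assms by simp
qed simp

lemma qscale_eq_iff:
  assumes "k \<noteq> 0" shows "k \<star> x = y \<longleftrightarrow> x = inverse k \<star> y"
  using qscale_cancel[OF assms, of x "inverse k \<star> y"] assms by simp

end

lemma qint_cancel:
  fixes x :: "'a::qalg"
  assumes "qint (int (Suc n)) \<star> x = qint (int (Suc n)) \<star> y" shows "x = y"
proof -
  have "qint (int (Suc n)) \<noteq> 0" by (rule qint_nonzero) simp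
  thus ?thesis using qscale_cancel assms by blast
qed

lemma qscale_power:
  fixes x :: "'a::qalg" shows "(k \<star> x) ^ n = (k ^ n) \<star> x ^ n"
  by (induction n) (simp_all add: mult_ac)

lemma inverse_q_commute:
  fixes g :: "'a::qalg"
  assumes "g * g' = 1" "g' * g = 1" "g * x = t \<star> (x * g)" "t \<noteq> 0"
  shows "g' * x = inverse t \<star> (x * g')"
proof -
  have "x * g' = g' * (g * x) * g'" by (simp add: assms(2) flip: mult.assoc)
  also have "\<dots> = t \<star> (g' * x)" by (simp add: assms mult.assoc)
  finally show ?thesis using assms(4) by simp
qed

text \<open>\<open>m\<close>-fold application of the operators \<open>x \<mapsto> e x - t q\<^bsup>2k\<^esup> x e\<close> for
\<open>k = 0, \<dots>, m - 1\<close>. Powers of a quantum adjoint action and quantum Serre polynomials are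
both of this form.\<close>

primrec skew_comm :: "Qv \<Rightarrow> Qv \<Rightarrow> 'a::qalg \<Rightarrow> nat \<Rightarrow> 'a \<Rightarrow> 'a" where
  "skew_comm q t e 0 x = x"
| "skew_comm q t e (Suc m) x =
     e * skew_comm q t e m x - (t * q ^ (2 * m)) \<star> (skew_comm q t e m x * e)"

text \<open>This is the quantum binomial theorem: the operators above are polynomials in left and right
multiplication by \<open>e\<close>, which commute.\<close>

lemma skew_comm_expand:
  fixes e x :: "'a::qalg"
  assumes q: "q = vv \<or> q = inverse vv"
  shows "skew_comm q t e m x = (\<Sum>r\<le>m.
    ((- 1) ^ r * qbinom (int m) r * (t * q powi (int m - 1)) ^ r) \<star> (e ^ (m - r) * x * e ^ r))"
proof (induction m)
  case (Suc m)
  have q0: "q \<noteq> 0" using q by auto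
  have q': "inverse q = vv \<or> inverse q = inverse vv" using q by auto
  define c where "c m r = (- 1) ^ r * qbinom (int m) r * (t * q powi (int m - 1)) ^ r" for m r
  have p: "(q powi n) ^ k = q powi (int k * n)" for n k
    by (metis mult.commute power_int_mult power_int_of_nat)
  have c_Suc: "c (Suc m) (Suc r) = c m (Suc r) - t * q ^ (2 * m) * c m r" for r
  proof -
    have pascal: "qbinom (int (Suc m)) (Suc r) =
        q powi (- int (Suc r)) * qbinom (int m) (Suc r) + q powi (int m - int r) * qbinom (int m) r"
      using qbinom_pascal[OF q', of "int m" r]
      by (simp only: power_int_inverse power_int_minus[symmetric] minus_diff_eq of_nat_Suc add.commute)
    have e1: "q powi (int (Suc r) * int m) * q powi (- int (Suc r)) = q powi (int (Suc r) * (int m - 1))"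
      using q0 by (simp add: power_int_add[symmetric] algebra_simps)
    have e2: "q powi (int (Suc r) * int m) * q powi (int m - int r) = q ^ (2 * m) * q powi (int r * (int m - 1))"
      using q0 by (simp only: power_int_of_nat[symmetric] power_int_add[symmetric] not_False_eq_True simp_thms)
        (simp add: algebra_simps)
    have "qbinom (int (Suc m)) (Suc r) * q powi (int (Suc r) * int m) =
        q powi (int (Suc r) * (int m - 1)) * qbinom (int m) (Suc r)
        + q ^ (2 * m) * q powi (int r * (int m - 1)) * qbinom (int m) r"
      unfolding pascal e1[symmetric] e2[symmetric] by (simp only: ring_distribs mult_ac)
    hence "(- t) ^ Suc r * (qbinom (int (Suc m)) (Suc r) * q powi (int (Suc r) * int m)) =
      (- t) ^ Suc r * (q powi (int (Suc r) * (int m - 1)) * qbinom (int m) (Suc r)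
        + q ^ (2 * m) * q powi (int r * (int m - 1)) * qbinom (int m) r)" by simp
    moreover have "int (Suc m) - 1 = int m" by simp
    ultimately show ?thesis unfolding c_def power_mult_distrib p power_minus[of t]
      by (simp add: ring_distribs mult_ac)
  qed
  let ?w = "\<lambda>r. e ^ (m - r) * x * e ^ Suc r"
  have IH: "skew_comm q t e m x = (\<Sum>r\<le>m. c m r \<star> (e ^ (m - r) * x * e ^ r))"
    using Suc by (simp add: c_def)
  have "e * skew_comm q t e m x = (\<Sum>r\<le>m. c m r \<star> (e ^ (Suc m - r) * x * e ^ r))"
    unfolding IH sum_distrib_left
    by (intro sum.cong refl) (simp add: Suc_diff_le mult.assoc)
  also have "\<dots> = (\<Sum>r\<le>Suc m. c m r \<star> (e ^ (Suc m - r) * x * e ^ r))"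
    by (simp add: c_def qbinom_eq_0)
  also have "\<dots> = e ^ Suc m * x + (\<Sum>r\<le>m. c m (Suc r) \<star> ?w r)"
    by (subst sum.atMost_Suc_shift) (simp add: c_def)
  finally have 1: "e * skew_comm q t e m x = \<dots>" .
  have 2: "skew_comm q t e m x * e = (\<Sum>r\<le>m. c m r \<star> ?w r)"
    unfolding IH sum_distrib_right
    by (intro sum.cong refl) (simp add: mult.assoc power_commutes)
  have "skew_comm q t e (Suc m) x =
      e ^ Suc m * x + (\<Sum>r\<le>m. c m (Suc r) \<star> ?w r - (t * q ^ (2 * m) * c m r) \<star> ?w r)"
    unfolding skew_comm.simps 1 2 by (simp add: sum_subtractf qscale_sum_right del: power_Suc)
  also have "\<dots> = e ^ Suc m * x + (\<Sum>r\<le>m. c (Suc m) (Suc r) \<star> ?w r)"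
    by (simp only: c_Suc qscale_diff_left)
  also have "\<dots> = (\<Sum>r\<le>Suc m. c (Suc m) r \<star> (e ^ (Suc m - r) * x * e ^ r))"
    by (subst sum.atMost_Suc_shift) (simp add: c_def)
  finally show ?case by (simp only: c_def)
qed simp


section \<open>The quantum adjoint action of a Borel subalgebra\<close>

locale q_borel =
  fixes E K KI :: "'a::qalg"
  assumes K_KI [simp]: "K * KI = 1" and KI_K [simp]: "KI * K = 1"
    and K_E: "K * E = vv ^ 2 \<star> (E * K)"
begin

definition twist :: "'a \<Rightarrow> 'a" where
  "twist x = K * x * KI"

text \<open>The quantum adjoint action of \<open>E\<close>. It is a derivation twisted by conjugation with \<open>K\<close>; its
divided powers are \<open>adp\<close>.\<close>

definition ad :: "'a \<Rightarrow> 'a" where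
  "ad x = E * x - twist x * E"

definition adp :: "nat \<Rightarrow> 'a \<Rightarrow> 'a" where
  "adp n x = inverse (qfact n) \<star> (ad ^^ n) x"

lemma K_KI_nested [simp]: "K * (KI * x) = x" "KI * (K * x) = x"
  by (simp_all flip: mult.assoc)

lemma E_KI: "E * KI = vv ^ 2 \<star> (KI * E)"
  using inverse_q_commute[OF K_KI KI_K K_E] by simp

lemma twist_eigen_iff: "twist x = t \<star> x \<longleftrightarrow> K * x = t \<star> (x * K)"
proof
  assume "twist x = t \<star> x"
  hence "twist x * K = t \<star> (x * K)" by simp
  thus "K * x = t \<star> (x * K)" by (simp add: twist_def mult.assoc)
qed (simp add: twist_def mult.assoc)

lemma twist_mult: "twist (x * y) = twist x * twist y"
  by (simp add: twist_def mult.assoc)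

lemma twist_qscale: "twist (k \<star> x) = k \<star> twist x"
  by (simp add: twist_def)

lemma twist_1 [simp]: "twist 1 = 1"
  by (simp add: twist_def)

lemma ad_add: "ad (x + y) = ad x + ad y"
  by (simp add: ad_def twist_def algebra_simps)

lemma ad_qscale: "ad (k \<star> x) = k \<star> ad x"
  by (simp add: ad_def twist_qscale qscale_diff_right)

lemma ad_0 [simp]: "ad 0 = 0"
  using ad_qscale[of 0 0] by simp

lemma ad_mult: "ad (x * y) = ad x * y + twist x * ad y"
  by (simp add: ad_def twist_mult algebra_simps)

lemma ad_sum: "ad (sum g A) = (\<Sum>x\<in>A. ad (g x))"
  by (induction A rule: infinite_finite_induct) (simp_all add: ad_add)

lemma twist_ad: "twist (ad x) = vv ^ 2 \<star> ad (twist x)"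
proof -
  have "K * (E * z) = vv ^ 2 \<star> (E * (K * z))" for z
    by (simp add: K_E flip: mult.assoc)
  thus ?thesis
    by (simp add: ad_def twist_def qscale_diff_right algebra_simps E_KI)
qed

lemma ad_pow_linear: "(ad ^^ n) (x + y) = (ad ^^ n) x + (ad ^^ n) y" "(ad ^^ n) (k \<star> x) = k \<star> (ad ^^ n) x"
  by (induction n) (simp_all add: ad_add ad_qscale)

lemma adp_add: "adp n (x + y) = adp n x + adp n y"
  by (simp add: adp_def ad_pow_linear qscale_add_right)

lemma adp_qscale: "adp n (k \<star> x) = k \<star> adp n x"
  by (simp add: adp_def ad_pow_linear mult.commute)

lemma adp_0 [simp]: "adp n 0 = 0"
  using adp_qscale[of n 0 0] by simp

lemma adp_sum: "adp n (sum g A) = (\<Sum>x\<in>A. adp n (g x))"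
  by (induction A rule: infinite_finite_induct) (simp_all add: adp_add)

lemma adp_zero [simp]: "adp 0 x = x"
  by (simp add: adp_def)

lemma ad_adp: "ad (adp n x) = qint (int (Suc n)) \<star> adp (Suc n) x"
  using qint_nonzero[of "int (Suc n)"] by (simp add: adp_def ad_qscale qfact_Suc mult.assoc[symmetric] del: of_nat_Suc)

lemma adp_ad: "adp n (ad x) = qint (int (Suc n)) \<star> adp (Suc n) x"
  using qint_nonzero[of "int (Suc n)"]
  by (simp add: adp_def ad_qscale qfact_Suc funpow_swap1 mult.assoc[symmetric] del: of_nat_Suc)

lemma adp_eq_0_mono:
  assumes "adp m x = 0" "m \<le> n" shows "adp n x = 0"
  using assms(2)
proof (induction n rule: dec_induct)
  case (step k)
  hence "qint (int (Suc k)) \<star> adp (Suc k) x = qint (int (Suc k)) \<star> 0"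
    by (simp only: ad_adp[symmetric] ad_0 qscale_0_right)
  thus ?case by (rule qint_cancel)
qed (rule assms(1))

lemma twist_adp:
  assumes "twist x = t \<star> x" shows "twist (adp n x) = (vv ^ (2 * n) * t) \<star> adp n x"
proof (induction n)
  case (Suc n)
  have "qint (int (Suc n)) \<star> twist (adp (Suc n) x) = twist (ad (adp n x))"
    by (simp add: ad_adp twist_qscale)
  also have "\<dots> = (vv ^ (2 * Suc n) * t) \<star> ad (adp n x)"
    by (simp add: twist_ad Suc ad_qscale power2_eq_square mult_ac)
  also have "\<dots> = qint (int (Suc n)) \<star> (vv ^ (2 * Suc n) * t) \<star> adp (Suc n) x"
    unfolding ad_adp by (simp add: mult_ac del: of_nat_Suc)
  finally show ?case by (rule qint_cancel)
qed (simp add: assms)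

lemma adp_rec:
  assumes "twist x = t \<star> x"
  shows "qint (int (Suc n)) \<star> adp (Suc n) x = E * adp n x - (t * vv ^ (2 * n)) \<star> (adp n x * E)"
  by (simp only: ad_adp[symmetric] ad_def twist_adp[OF assms] qscale_mult_left mult.commute[of _ t])

lemma adp_eq_skew_comm:
  assumes "twist x = t \<star> x"
  shows "adp n x = inverse (qfact n) \<star> skew_comm vv t E n x"
proof (induction n)
  case (Suc n)
  have "qint (int (Suc n)) \<star> adp (Suc n) x = inverse (qfact n) \<star> skew_comm vv t E (Suc n) x"
    unfolding adp_rec[OF assms] Suc by (simp add: qscale_diff_right mult_ac)
  moreover have "qint (int (Suc n)) \<noteq> 0" by (rule qint_nonzero) simp
  ultimately show ?case by (simp add: qscale_eq_iff qfact_Suc del: of_nat_Suc)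
qed simp

text \<open>Leibniz's rule for divided powers of a skew derivation. The coefficient is that of
  \<open>A\<^sup>p B\<^bsup>n - p\<^esup>\<close> in the divided power of \<open>A + B\<close> when \<open>B A = v\<^sup>2 A B\<close>, with \<open>B\<close> acting
  as the twist on the left factor.\<close>

lemma adp_mult:
  assumes "twist x = t \<star> x"
  shows "adp n (x * y) =
    (\<Sum>p\<le>n. (vv ^ (p * (n - p)) * t ^ (n - p)) \<star> (adp p x * adp (n - p) y))"
proof (induction n)
  case (Suc n)
  define c where "c n p = vv ^ (p * (n - p)) * t ^ (n - p)" for n p :: nat
  define w where "w p = adp p x * adp (Suc n - p) y" for p
  have IH: "adp n (x * y) = (\<Sum>p\<le>n. c n p \<star> (adp p x * adp (n - p) y))"
    using Suc by (simp add: c_def)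
  have ad_w: "ad (adp p x * adp (n - p) y) =
      qint (int (Suc p)) \<star> w (Suc p) + (vv ^ (2 * p) * t * qint (int (Suc n - p))) \<star> w p" if "p \<le> n" for p
    using that by (simp add: ad_mult ad_adp twist_adp[OF assms] w_def Suc_diff_le mult_ac)
  have "qint (int (Suc n)) \<star> adp (Suc n) (x * y) = ad (\<Sum>p\<le>n. c n p \<star> (adp p x * adp (n - p) y))"
    by (simp only: IH ad_adp[symmetric])
  also have "\<dots> = (\<Sum>p\<le>n. c n p \<star> ad (adp p x * adp (n - p) y))"
    by (simp only: ad_sum ad_qscale)
  also have "\<dots> = (\<Sum>p\<le>n. (c n p * qint (int (Suc p))) \<star> w (Suc p))
      + (\<Sum>p\<le>n. (c n p * (vv ^ (2 * p) * t * qint (int (Suc n - p)))) \<star> w p)"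
    unfolding sum.distrib[symmetric]
    by (intro sum.cong refl) (simp add: ad_w qscale_add_right)
  also have "(\<Sum>p\<le>n. (c n p * qint (int (Suc p))) \<star> w (Suc p)) =
      (\<Sum>p\<le>Suc n. (c n (p - 1) * qint (int p)) \<star> w p)"
    by (subst sum.atMost_Suc_shift) simp
  also have "(\<Sum>p\<le>n. (c n p * (vv ^ (2 * p) * t * qint (int (Suc n - p)))) \<star> w p) =
      (\<Sum>p\<le>Suc n. (c n p * (vv ^ (2 * p) * t * qint (int (Suc n - p)))) \<star> w p)"
    by simp
  also have "(\<Sum>p\<le>Suc n. (c n (p - 1) * qint (int p)) \<star> w p) + \<dots> =
      (\<Sum>p\<le>Suc n. (qint (int (Suc n)) * c (Suc n) p) \<star> w p)"
    unfolding sum.distrib[symmetric] qscale_add_left[symmetric]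
  proof (intro sum.cong refl arg_cong2[where f = qscale])
    fix p assume "p \<in> {..Suc n}"
    then obtain k where k: "Suc n = p + k" by (metis atMost_iff le_Suc_ex)
    have q: "qint (int (Suc n)) = vv powi (- int k) * qint (int p) + vv ^ p * qint (int k)"
      using qint_add[of "int p" "int k"] by (simp add: k)
    show "c n (p - 1) * qint (int p) + c n p * (vv ^ (2 * p) * t * qint (int (Suc n - p))) =
        qint (int (Suc n)) * c (Suc n) p"
    proof (cases "p = 0 \<or> k = 0")
      case True
      thus ?thesis using k by (auto simp: c_def)
    next
      case False
      then obtain p' k' where p': "p = Suc p'" "k = Suc k'" by (metis not0_implies_Suc)
      hence n: "n = Suc (p' + k')" using k by simp
      have pk: "p - 1 = p'" "Suc n - p = k" using k p' by simp_all
      have e: "c n p' = vv ^ (p' * k) * t ^ k" "c n p = vv ^ (p * k') * t ^ k'" "c (Suc n) p = vv ^ (p * k) * t ^ k"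
        by (simp_all add: c_def n p')
      have 1: "vv powi (- int k) * vv ^ (p * k) = vv ^ (p' * k)"
        unfolding p'(1) by (simp add: power_add vv_powi_minus)
      have 2: "vv ^ (p * k) * vv ^ p = vv ^ (p * k') * vv ^ (2 * p)"
        unfolding power_add[symmetric] by (rule arg_cong[where f = "power vv"]) (simp add: p')
      have "c n (p - 1) * qint (int p) + c n p * (vv ^ (2 * p) * t * qint (int (Suc n - p)))
          = vv ^ (p' * k) * t ^ k * qint (int p) + (vv ^ (p * k') * vv ^ (2 * p)) * t ^ k * qint (int k)"
        unfolding pk e by (simp only: p'(2) power_Suc mult_ac)
      also have "\<dots> = qint (int (Suc n)) * c (Suc n) p"
        unfolding q e 1[symmetric] 2[symmetric] by (simp only: ring_distribs mult_ac)
      finally show ?thesis .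
    qed
  qed
  also have "\<dots> = qint (int (Suc n)) \<star> (\<Sum>p\<le>Suc n. c (Suc n) p \<star> w p)"
    by (simp only: qscale_sum_right qscale_qscale)
  finally show ?case unfolding c_def w_def by (rule qint_cancel)
qed simp

end


text \<open>Turns a rewrite rule for a product into one for right-nested products, the form in which
associativity leaves monomials.\<close>

lemma nested_mult:
  fixes a :: "'a::semigroup_mult"
  shows "a * b = c \<Longrightarrow> a * (b * z) = c * z"
  by (simp flip: mult.assoc)

lemma qint_mult:
  "qint m * qint n = (vv powi (m + n) + vv powi (- (m + n)) - vv powi (m - n) - vv powi (n - m))
     / (vv - inverse vv) ^ 2"
  unfolding qint_def times_divide_times_eq power2_eq_square
  by (simp add: algebra_simps flip: vv_powi_add)

lemma qint_mult_shift: "qint (m + 1) * qint (a - m) = qint m * qint (a - m + 1) + qint (a - 2 * m)"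
proof -
  have "qint (a - 2 * m) = qint 1 * qint (a - 2 * m)" by simp
  note e = this[unfolded qint_mult]
  show ?thesis unfolding qint_mult e add_divide_distrib[symmetric]
    by (rule arg_cong2[where f = divide]) (simp_all add: algebra_simps)
qed

section \<open>Quantum Serre polynomials\<close>

definition qserre :: "nat \<Rightarrow> 'a::qalg \<Rightarrow> 'a \<Rightarrow> 'a" where
  "qserre n x y = (\<Sum>r\<le>n. ((- 1) ^ r * qbinom (int n) r) \<star> (x ^ r * y * x ^ (n - r)))"

lemma qserre_qscale: "qserre n (k \<star> x) (l \<star> y) = (k ^ n * l) \<star> qserre n x y"
  unfolding qserre_def qscale_sum_right
proof (intro sum.cong refl)
  fix r assume "r \<in> {..n}"
  hence "k ^ n = k ^ (n - r) * k ^ r" by (simp flip: power_add)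
  thus "((- 1) ^ r * qbinom (int n) r) \<star> ((k \<star> x) ^ r * (l \<star> y) * (k \<star> x) ^ (n - r)) =
      (k ^ n * l) \<star> ((- 1) ^ r * qbinom (int n) r) \<star> (x ^ r * y * x ^ (n - r))"
    by (simp add: qscale_power mult_ac)
qed

lemma qbinom_sym: "r \<le> n \<Longrightarrow> qbinom (int n) (n - r) = qbinom (int n) r"
  by (simp add: qbinom_qfact mult.commute)

text \<open>The Serre polynomial factors into commuting first-order skew commutators, whose
  parameters \<open>q\<^sup>-\<^sup>a, q\<^bsup>2 - a\<^esup>, \<dots>, q\<^sup>a\<close> are invariant under inversion.\<close>

lemma qserre_eq_skew_comm:
  assumes "q = vv \<or> q = inverse vv"
  shows "qserre (Suc a) x y = (- 1) ^ Suc a \<star> skew_comm q (q powi (- int a)) x (Suc a) y"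
proof -
  have q0: "q \<noteq> 0" using assms by auto
  have "q powi (- int a) * q powi (int (Suc a) - 1) = 1"
    using q0 by (simp add: power_int_minus)
  hence "skew_comm q (q powi (- int a)) x (Suc a) y =
      (\<Sum>r\<le>Suc a. ((- 1) ^ r * qbinom (int (Suc a)) r) \<star> (x ^ (Suc a - r) * y * x ^ r))"
    unfolding skew_comm_expand[OF assms] by (simp only: power_one mult_1_right)
  also have "\<dots> = (\<Sum>r\<le>Suc a. ((- 1) ^ (Suc a - r) * qbinom (int (Suc a)) (Suc a - r))
      \<star> (x ^ (Suc a - (Suc a - r)) * y * x ^ (Suc a - r)))"
    by (rule sum.nat_diff_reindex[symmetric, of _ "Suc (Suc a)", unfolded lessThan_Suc_atMost diff_Suc_Suc])
  also have "\<dots> = (\<Sum>r\<le>Suc a. (- 1) ^ Suc a \<star> ((- 1) ^ r * qbinom (int (Suc a)) r)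
      \<star> (x ^ r * y * x ^ (Suc a - r)))"
  proof (intro sum.cong refl)
    fix r assume "r \<in> {..Suc a}"
    hence r: "r \<le> Suc a" by simp
    have "(- 1 :: Qv) ^ (Suc a - r) = (- 1) ^ (Suc a - r) * ((- 1) ^ r * (- 1) ^ r)"
      by (simp flip: power_mult_distrib)
    also have "\<dots> = (- 1) ^ Suc a * (- 1) ^ r"
      unfolding power_add[symmetric] using r by (intro arg_cong[where f = "power (- 1)"]) simp
    finally have "(- 1 :: Qv) ^ (Suc a - r) = (- 1) ^ Suc a * (- 1) ^ r" .
    thus "((- 1) ^ (Suc a - r) * qbinom (int (Suc a)) (Suc a - r))
        \<star> (x ^ (Suc a - (Suc a - r)) * y * x ^ (Suc a - r)) =
      (- 1) ^ Suc a \<star> ((- 1) ^ r * qbinom (int (Suc a)) r) \<star> (x ^ r * y * x ^ (Suc a - r))"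
      using r by (simp only: qbinom_sym diff_diff_cancel qscale_qscale mult.assoc)
  qed
  also have "\<dots> = (- 1) ^ Suc a \<star> qserre (Suc a) x y"
    by (simp only: qserre_def qscale_sum_right)
  finally show ?thesis by (simp flip: power_add)
qed


section \<open>Reflection of a string in rank one\<close>

locale qsl2 =
  fixes E F K KI K' KI' :: "'a::qalg"
  assumes K_KI: "K * KI = 1" and KI_K: "KI * K = 1"
    and K'_KI' [simp]: "K' * KI' = 1" and KI'_K' [simp]: "KI' * K' = 1"
    and K_K': "K * K' = K' * K"
    and E_F: "E * F = F * E + inverse (vv - inverse vv) \<star> (K - K')"
    and K_E: "K * E = vv powi 2 \<star> (E * K)"
    and K_F: "K * F = vv powi (- 2) \<star> (F * K)"
    and K'_E: "K' * E = vv powi (- 2) \<star> (E * K')"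
    and K'_F: "K' * F = vv powi 2 \<star> (F * K')"

sublocale qsl2 \<subseteq> q_borel E K KI
  by standard (simp_all add: K_KI KI_K K_E)

lemma (in qsl2) swapped: "qsl2 F E K' KI' K KI"
proof
  show "F * E = E * F + inverse (vv - inverse vv) \<star> (K' - K)"
    by (simp add: E_F qscale_diff_right)
qed (simp_all add: K_KI KI_K K_K' K_E K_F K'_E K'_F)

context qsl2
begin

text \<open>The reflection sends \<open>E\<close> to minus this element, and twisted commutators with it lower a string.\<close>

definition lower :: 'a where
  "lower = F * KI'"

text \<open>The divided power one step earlier, with the convention that a string is zero below its bottom.\<close>

definition adpred :: "nat \<Rightarrow> 'a \<Rightarrow> 'a" where
  "adpred n x = (case n of 0 \<Rightarrow> 0 | Suc m \<Rightarrow> adp m x)"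

lemma adpred_simps [simp]: "adpred 0 x = 0" "adpred (Suc n) x = adp n x"
  by (simp_all add: adpred_def)

text \<open>A vector of weight \<open>-a\<close> commuting with \<open>F\<close>: the bottom of the string of its divided powers
\<open>adp m x\<close>. If this string is finite, it stops at \<open>adp a x\<close>.\<close>

definition lowest :: "int \<Rightarrow> 'a \<Rightarrow> bool" where
  "lowest a x \<longleftrightarrow> K * x = vv powi (- a) \<star> (x * K) \<and> K' * x = vv powi a \<star> (x * K') \<and> F * x = x * F"

lemma lowest_twist: "lowest a x \<Longrightarrow> twist x = vv powi (- a) \<star> x"
  by (simp add: lowest_def twist_eigen_iff)

lemma lowest_K:
  assumes "lowest a x"
  shows "K * adp m x = vv powi (2 * int m - a) \<star> (adp m x * K)"
proof -
  have "vv ^ (2 * m) * vv powi (- a) = vv powi (2 * int m - a)"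
    by (simp add: vv_powi_add flip: power_int_of_nat) (simp add: power_int_diff vv_powi_minus field_simps)
  thus ?thesis
    using twist_adp[OF lowest_twist[OF assms], of m] by (simp add: twist_eigen_iff)
qed

lemma lowest_rec:
  assumes "lowest a x"
  shows "E * adp m x = qint (int (Suc m)) \<star> adp (Suc m) x + vv powi (2 * int m - a) \<star> (adp m x * E)"
proof -
  have "vv powi (- a) * vv ^ (2 * m) = vv powi (2 * int m - a)"
    by (simp add: vv_powi_add flip: power_int_of_nat) (simp add: power_int_diff vv_powi_minus field_simps)
  thus ?thesis using adp_rec[OF lowest_twist[OF assms], of m] by simp
qed

lemma lowest_K':
  assumes "lowest a x"
  shows "K' * adp m x = vv powi (a - 2 * int m) \<star> (adp m x * K')"
proof (induction m)
  case (Suc m)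
  have s: "vv powi (a - 2 * int (Suc m)) = vv powi (- 2) * vv powi (a - 2 * int m)"
    by (simp add: algebra_simps flip: vv_powi_add)
  have "qint (int (Suc m)) \<star> (K' * adp (Suc m) x) =
      K' * (E * adp m x) - vv powi (2 * int m - a) \<star> (K' * (adp m x * E))"
    by (simp add: lowest_rec[OF assms] algebra_simps qscale_add_right)
  also have "\<dots> = qint (int (Suc m)) \<star> vv powi (a - 2 * int (Suc m)) \<star> (adp (Suc m) x * K')"
    unfolding s
    by (simp add: nested_mult[OF K'_E] nested_mult[OF lowest_rec[OF assms]] nested_mult[OF Suc] Suc
          K'_E mult.assoc algebra_simps qscale_add_right)
  finally show ?case by (rule qint_cancel)
qed (use assms in \<open>simp add: lowest_def\<close>)

text \<open>The commutator with \<open>F\<close> moves one step down a string, with the coefficient known from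
representations of the quantum group of rank one. By induction along the string, the commutator of
\<open>E\<close> and \<open>F\<close> contributes \<open>[a - 2m]\<close>, which \<open>qint_mult_shift\<close> combines with the
coefficient of the preceding step.\<close>

lemma lowest_F:
  assumes "lowest a x"
  shows "adp m x * F = F * adp m x - qint (a - int m + 1) \<star> (adpred m x * K')"
proof (induction m)
  case (Suc m)
  define z where "z = adp m x"
  define zp where "zp = adpred m x"
  define s where "s = vv powi (2 * int m - a)"
  define s' where "s' = vv powi (2 * int m - 2 - a)"
  define h where "h = inverse (vv - inverse vv)"
  have s': "s * vv powi (- 2) = s'"
    by (simp add: s_def s'_def algebra_simps flip: vv_powi_add)
  have zF: "z * F = F * z - qint (a - int m + 1) \<star> (zp * K')"
    using Suc by (simp add: z_def zp_def)
  have Ez: "E * z = qint (int (Suc m)) \<star> adp (Suc m) x + s \<star> (z * E)"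
    unfolding z_def s_def by (rule lowest_rec[OF assms])
  have Ezp: "E * zp = qint (int m) \<star> z + s' \<star> (zp * E)"
  proof (cases m)
    case (Suc k)
    have "2 * int k - a = 2 * int m - 2 - a" using Suc by simp
    thus ?thesis using lowest_rec[OF assms, of k] unfolding z_def zp_def s'_def Suc by simp
  qed (simp add: zp_def)
  have Kz: "K * z = s \<star> (z * K)" "K' * z = inverse s \<star> (z * K')"
    using lowest_K[OF assms, of m] lowest_K'[OF assms, of m] vv_powi_minus[of "2 * int m - a"]
    by (simp_all add: z_def s_def)
  have EF: "E * F = F * E + h \<star> (K - K')" using E_F by (simp add: h_def)
  have K'E: "zp * (K' * E) = vv powi (- 2) \<star> (zp * (E * K'))" by (simp add: K'_E)
  have q: "h * (s - inverse s) = - qint (a - 2 * int m)"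
  proof -
    have "a - 2 * int m = - (2 * int m - a)" by simp
    hence "- qint (a - 2 * int m) = qint (2 * int m - a)" by (simp only: qint_minus minus_minus)
    moreover have "inverse s = vv powi (- (2 * int m - a))"
      unfolding s_def vv_powi_minus ..
    ultimately show ?thesis by (simp only: qint_def h_def s_def divide_inverse mult.commute)
  qed
  have "qint (int (Suc m)) \<star> (adp (Suc m) x * F) = (E * z - s \<star> (z * E)) * F"
    by (simp add: Ez)
  also have "\<dots> = E * (z * F) - s \<star> (z * (E * F))"
    by (simp add: algebra_simps)
  also have "z * (E * F) = F * z * E - qint (a - int m + 1) \<star> (zp * (K' * E)) + h \<star> (z * K - z * K')"
    by (simp add: EF nested_mult[OF zF] algebra_simps)
  also have "E * (z * F) = F * E * z + h \<star> (s \<star> (z * K) - inverse s \<star> (z * K'))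
      - qint (a - int m + 1) \<star> ((qint (int m) \<star> z + s' \<star> (zp * E)) * K')"
    by (simp add: zF nested_mult[OF EF] algebra_simps Kz nested_mult[OF Ezp])
  also have "F * E * z = F * (qint (int (Suc m)) \<star> adp (Suc m) x + s \<star> (z * E))"
    by (simp only: mult.assoc Ez)
  also have "\<dots> + h \<star> (s \<star> (z * K) - inverse s \<star> (z * K'))
      - qint (a - int m + 1) \<star> ((qint (int m) \<star> z + s' \<star> (zp * E)) * K')
      - s \<star> (F * z * E - qint (a - int m + 1) \<star> (zp * (K' * E)) + h \<star> (z * K - z * K')) =
      qint (int (Suc m)) \<star> (F * adp (Suc m) x)
        + (h * (s - inverse s) - qint (a - int m + 1) * qint (int m)) \<star> (z * K')"
    unfolding K'E s'[symmetric]
    by (simp add: algebra_simps qscale_distribs)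
  also have "h * (s - inverse s) - qint (a - int m + 1) * qint (int m) =
      - (qint (int (Suc m)) * qint (a - int (Suc m) + 1))"
    using qint_mult_shift[of "int m" a] unfolding q by (simp add: algebra_simps)
  finally have "qint (int (Suc m)) \<star> (adp (Suc m) x * F) = qint (int (Suc m)) \<star>
      (F * adp (Suc m) x - qint (a - int (Suc m) + 1) \<star> (adpred (Suc m) x * K'))"
    by (simp add: z_def qscale_distribs)
  thus ?case by (rule qint_cancel)
qed (use assms in \<open>simp add: lowest_def\<close>)

lemma lowest_lower:
  assumes "lowest a x"
  shows "adp m x * lower = vv powi (a - 2 * int m) \<star> (lower * adp m x) - qint (a - int m + 1) \<star> adpred m x"
proof -
  have "KI' * adp m x = vv powi (2 * int m - a) \<star> (adp m x * KI')"
    using inverse_q_commute[OF K'_KI' KI'_K' lowest_K'[OF assms, of m]]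
    by (simp flip: vv_powi_minus)
  hence "vv powi (a - 2 * int m) \<star> (lower * adp m x) = F * adp m x * KI'"
    by (simp add: lower_def mult.assoc flip: vv_powi_add)
  moreover have "adp m x * lower = F * adp m x * KI' - qint (a - int m + 1) \<star> (adpred m x * (K' * KI'))"
    by (simp only: lower_def mult.assoc[symmetric] lowest_F[OF assms] left_diff_distrib qscale_mult_left)
  ultimately show ?thesis by simp
qed

text \<open>Lowering the top of a string by \<^const>\<open>lower\<close> retraces the string.\<close>

lemma skew_comm_lower:
  assumes "lowest (int a) x" "k \<le> a"
  shows "skew_comm (inverse vv) (vv powi int a) lower k (adp a x) =
    (qfact k * vv powi (int k * (int a - int k + 1))) \<star> adp (a - k) x"
  using assms(2)
proof (induction k)
  case (Suc k)
  define m where "m = a - Suc k"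
  hence a: "a = Suc (m + k)" "a - k = Suc m" using Suc.prems by simp_all
  define s where "s = vv powi (int a - 2 * int k)"
  have s: "vv powi int a * inverse vv ^ (2 * k) = s"
    by (simp add: s_def power_int_diff power_int_inverse divide_inverse flip: power_int_of_nat)
  have "int a - 2 * int (Suc m) = - (int a - 2 * int k)" using a by simp
  hence s': "vv powi (int a - 2 * int (Suc m)) = inverse s"
    unfolding s_def by (simp only: vv_powi_minus)
  have "adp (Suc m) x * lower = inverse s \<star> (lower * adp (Suc m) x) - qint (int (Suc k)) \<star> adp m x"
    using lowest_lower[OF assms(1), of "Suc m"] unfolding s' by (simp add: a add.commute)
  hence "s \<star> (adp (Suc m) x * lower) = lower * adp (Suc m) x - (s * qint (int (Suc k))) \<star> adp m x"
    by (simp add: qscale_diff_right s_def)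
  hence low: "lower * adp (Suc m) x - s \<star> (adp (Suc m) x * lower) = (s * qint (int (Suc k))) \<star> adp m x"
    by simp
  define c where "c = qfact k * vv powi (int k * (int a - int k + 1))"
  have "s * vv powi (int k * (int a - int k + 1)) = vv powi (int (Suc k) * (int a - int (Suc k) + 1))"
    unfolding s_def by (simp add: algebra_simps flip: vv_powi_add)
  hence c: "c * (s * qint (int (Suc k))) = qfact (Suc k) * vv powi (int (Suc k) * (int a - int (Suc k) + 1))"
    by (simp add: c_def qfact_Suc mult_ac del: of_nat_Suc)
  have IH: "skew_comm (inverse vv) (vv powi int a) lower k (adp a x) = c \<star> adp (Suc m) x"
    using Suc.IH Suc.prems a by (simp add: c_def)
  have "skew_comm (inverse vv) (vv powi int a) lower (Suc k) (adp a x) =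
      c \<star> (lower * adp (Suc m) x - s \<star> (adp (Suc m) x * lower))"
    unfolding skew_comm.simps s IH by (simp add: qscale_diff_right mult.commute)
  thus ?case by (simp only: low qscale_qscale m_def[symmetric] c)
qed simp

end


context qsl2
begin

text \<open>Applying the formula for the top of a string to the lowering element instead of \<open>E\<close> leads back
to the bottom. This is what makes the reflection invertible.\<close>

lemma skew_comm_lower_restore:
  assumes "lowest (int a) x"
  shows "(\<Sum>r\<le>a. ((- 1) ^ r * vv powi (- int r) / (qfact r * qfact (a - r))) \<star>
    (lower ^ r * adp a x * lower ^ (a - r))) = (- 1) ^ a \<star> x"
proof -
  define w where "w r = lower ^ (a - r) * adp a x * lower ^ r" for r
  have v: "vv powi int a * inverse vv powi (int a - 1) = vv"
    by (simp add: power_int_inverse power_int_diff)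
  have "(qfact a * vv ^ a) \<star> x = skew_comm (inverse vv) (vv powi int a) lower a (adp a x)"
    using skew_comm_lower[OF assms, of a] by simp
  also have "\<dots> = (\<Sum>r\<le>a. ((- 1) ^ r * qbinom (int a) r * vv ^ r) \<star> w r)"
    unfolding skew_comm_expand[OF disjI2[OF refl]] v w_def ..
  also have "\<dots> = (\<Sum>r\<le>a. ((- 1) ^ (a - r) * qbinom (int a) (a - r) * vv ^ (a - r)) \<star> w (a - r))"
    by (rule sum.nat_diff_reindex[symmetric, of _ "Suc a", unfolded lessThan_Suc_atMost diff_Suc_Suc])
  also have "\<dots> = (\<Sum>r\<le>a. (qfact a * vv ^ a) \<star> (- 1) ^ a \<star>
      ((- 1) ^ r * vv powi (- int r) / (qfact r * qfact (a - r))) \<star> w (a - r))"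
  proof (intro sum.cong refl)
    fix r assume "r \<in> {..a}"
    then obtain k where a: "a = r + k" by (metis atMost_iff le_Suc_ex)
    have qb: "qbinom (int a) (a - r) = qfact a / (qfact r * qfact (a - r))"
      using a by (subst qbinom_sym) (simp_all only: qbinom_qfact le_add1)
    have "(- 1) ^ (a - r) * qbinom (int a) (a - r) * vv ^ (a - r) = (qfact a * vv ^ a) * ((- 1) ^ a *
      ((- 1) ^ r * vv powi (- int r) / (qfact r * qfact (a - r))))"
      unfolding qb by (simp add: a power_add vv_powi_minus mult_ac)
    thus "((- 1) ^ (a - r) * qbinom (int a) (a - r) * vv ^ (a - r)) \<star> w (a - r) = (qfact a * vv ^ a) \<star> (- 1) ^ a \<star>
      ((- 1) ^ r * vv powi (- int r) / (qfact r * qfact (a - r))) \<star> w (a - r)"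
      by (simp only: qscale_qscale)
  qed
  also have "\<dots> = (qfact a * vv ^ a) \<star> (- 1) ^ a \<star>
      (\<Sum>r\<le>a. ((- 1) ^ r * vv powi (- int r) / (qfact r * qfact (a - r))) \<star> w (a - r))"
    by (simp only: qscale_sum_right)
  finally have "x = (- 1) ^ a \<star> (\<Sum>r\<le>a. ((- 1) ^ r * vv powi (- int r) / (qfact r * qfact (a - r))) \<star> w (a - r))"
    by (subst (asm) qscale_cancel) simp_all
  hence "(- 1) ^ a \<star> x = (\<Sum>r\<le>a. ((- 1) ^ r * vv powi (- int r) / (qfact r * qfact (a - r))) \<star> w (a - r))"
    by (simp flip: power_mult_distrib)
  also have "\<dots> = (\<Sum>r\<le>a. ((- 1) ^ r * vv powi (- int r) / (qfact r * qfact (a - r))) \<star>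
    (lower ^ r * adp a x * lower ^ (a - r)))"
    by (intro sum.cong refl) (simp add: w_def)
  finally show ?thesis ..
qed

lemma qserre_lower_top:
  assumes "lowest (int a) x"
  shows "qserre (Suc a) lower (adp a x) = 0"
proof -
  have "skew_comm (inverse vv) (vv powi int a) lower a (adp a x) = (qfact a * vv powi int a) \<star> x"
    using skew_comm_lower[OF assms, of a] by simp
  moreover have "lower * x = vv powi (- int a) \<star> (x * lower)"
    using lowest_lower[OF assms, of 0] by (simp add: vv_powi_minus)
  moreover have "vv powi int a * inverse vv ^ (2 * a) = vv powi (- int a)"
    by (simp add: power_mult power2_eq_square vv_powi_minus power_mult_distrib field_simps)
  ultimately have "skew_comm (inverse vv) (vv powi int a) lower (Suc a) (adp a x) = 0"
    by (simp add: mult_ac)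
  thus ?thesis
    using qserre_eq_skew_comm[of "inverse vv" a lower] by (simp add: power_int_inverse vv_powi_minus)
qed

text \<open>The Leibniz coefficient of the term whose left factor, of weight \<open>-(p + 1)\<close>, is one step below
its top.\<close>

lemma vv_shift: "vv ^ (p * k) * (vv powi (- int (Suc p))) ^ k = vv powi (- int k)"
  unfolding vv_powi_mult
  unfolding power_int_of_nat[symmetric] vv_powi_add[symmetric]
  by (rule arg_cong[where f = "power_int vv"]) (simp add: algebra_simps)

text \<open>\<open>x\<close> is the bottom of a string of length \<open>A\<close> with top \<open>X\<close>. The last conjunct records the
vector just below the top, as a twisted commutator of \<open>X\<close> with the lowering element; unlike a
statement about the whole string, it passes to products.\<close>

definition extremal :: "nat \<Rightarrow> 'a \<Rightarrow> 'a \<Rightarrow> bool" where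
  "extremal A x X \<longleftrightarrow> twist x = vv powi (- int A) \<star> x \<and> (\<forall>p>A. adp p x = 0) \<and> adp A x = X \<and>
     adpred A x = vv powi (- int A) \<star> (lower * X) - X * lower"

lemma lowest_extremal:
  assumes "lowest (int a) x" "adp (Suc a) x = 0"
  shows "extremal a x (adp a x)"
  using lowest_twist[OF assms(1)] adp_eq_0_mono[OF assms(2)] lowest_lower[OF assms(1), of a]
  by (auto simp: extremal_def Suc_le_eq)

lemma extremal_1: "extremal 0 1 1"
proof -
  have "adp (Suc 0) 1 = 0" using ad_adp[of 0 1] by (simp add: ad_def)
  hence "adp p 1 = 0" if "p > 0" for p using adp_eq_0_mono[of 1 1 p] that by simp
  thus ?thesis by (simp add: extremal_def)
qed

text \<open>In the Leibniz expansion at the total degree \<open>A + B\<close> only the product of the two tops survives,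
and the weight of \<open>x\<close> makes its coefficient equal to 1. One degree below, exactly the two
terms with one factor below its top survive. Hence passing from bottoms to tops is multiplicative.\<close>

lemma extremal_mult:
  assumes x: "extremal A x X" and y: "extremal B y Y"
  shows "extremal (A + B) (x * y) (X * Y)"
proof -
  note x' = x[unfolded extremal_def] and y' = y[unfolded extremal_def]
  define c where "c n p = vv ^ (p * (n - p)) * (vv powi (- int A)) ^ (n - p)" for n p
  have twist: "twist (x * y) = vv powi (- int (A + B)) \<star> (x * y)"
    using x' y' by (simp add: twist_mult vv_powi_add[symmetric] add.commute)
  have adp: "adp n (x * y) = (\<Sum>p\<le>n. c n p \<star> (adp p x * adp (n - p) y))" for n
    unfolding c_def by (rule adp_mult) (use x' in blast)
  have cA: "c n A = 1" for n
    by (simp add: c_def vv_powi_minus power_mult flip: power_mult_distrib)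
  have zero: "adp p x * adp (n - p) y = 0" if "p > A \<or> n - p > B" for n p
    using that x' y' by auto
  have "adp n (x * y) = 0" if "n > A + B" for n
    unfolding adp
  proof (intro sum.neutral ballI)
    fix p assume "p \<in> {..n}"
    hence "p > A \<or> n - p > B" using that by auto
    thus "c n p \<star> (adp p x * adp (n - p) y) = 0" by (simp only: zero qscale_0_right)
  qed
  moreover have "adp (A + B) (x * y) = X * Y"
  proof -
    have "adp (A + B) (x * y) = (\<Sum>p\<in>{A}. c (A + B) p \<star> (adp p x * adp (A + B - p) y))"
      unfolding adp
    proof (intro sum.mono_neutral_right ballI)
      fix p assume "p \<in> {..A + B} - {A}"
      hence "p > A \<or> A + B - p > B" by auto
      thus "c (A + B) p \<star> (adp p x * adp (A + B - p) y) = 0" by (simp only: zero qscale_0_right)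
    qed auto
    thus ?thesis using x' y' by (simp add: cA)
  qed
  moreover have "adpred (A + B) (x * y) = X * adpred B y + vv powi (- int B) \<star> (adpred A x * Y)"
  proof (cases "A + B")
    case (Suc n)
    have sub: "adp n (x * y) = (\<Sum>p\<in>{p. p \<le> n \<and> (p = A \<or> Suc p = A)}. c n p \<star> (adp p x * adp (n - p) y))"
      unfolding adp
    proof (intro sum.mono_neutral_right ballI)
      fix p assume "p \<in> {..n} - {p. p \<le> n \<and> (p = A \<or> Suc p = A)}"
      hence "p > A \<or> n - p > B" using Suc by auto
      thus "c n p \<star> (adp p x * adp (n - p) y) = 0" by (simp only: zero qscale_0_right)
    qed auto
    have top: "c n A \<star> (adp A x * adp (n - A) y) = X * adpred B y" if "A \<le> n"
    proof -
      have "B = Suc (n - A)" using that Suc by simp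
      hence "adpred B y = adp (n - A) y" by (simp only: adpred_simps)
      thus ?thesis using x' by (simp add: cA)
    qed
    have low: "c n p \<star> (adp p x * adp (n - p) y) = vv powi (- int B) \<star> (adpred A x * Y)" if "A = Suc p" for p
    proof -
      have "n - p = B" using Suc that by simp
      moreover have "c n p = vv powi (- int B)"
        unfolding c_def that \<open>n - p = B\<close> by (rule vv_shift)
      ultimately show ?thesis using y' that by simp
    qed
    show ?thesis
    proof (cases A)
      case 0
      hence "{p. p \<le> n \<and> (p = A \<or> Suc p = A)} = {A}" by auto
      thus ?thesis using Suc 0 sub top by simp
    next
      case A: (Suc p)
      show ?thesis
      proof (cases "B = 0")
        case True
        hence "{q. q \<le> n \<and> (q = A \<or> Suc q = A)} = {p}" using A Suc by auto
        thus ?thesis using Suc sub low[OF A] True by simp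
      next
        case False
        hence n: "A \<le> n" using Suc A by simp
        hence "{q. q \<le> n \<and> (q = A \<or> Suc q = A)} = {A, p}" "A \<noteq> p" using A by auto
        thus ?thesis using Suc sub low[OF A] top[OF n] by simp
      qed
    qed
  qed simp
  moreover have "X * adpred B y + vv powi (- int B) \<star> (adpred A x * Y) =
      vv powi (- int (A + B)) \<star> (lower * (X * Y)) - X * Y * lower"
  proof -
    have "vv powi (- int (A + B)) = vv powi (- int B) * vv powi (- int A)"
      by (simp add: algebra_simps flip: vv_powi_add)
    moreover have "adpred A x = vv powi (- int A) \<star> (lower * X) - X * lower"
      "adpred B y = vv powi (- int B) \<star> (lower * Y) - Y * lower" using x' y' by blast+
    ultimately show ?thesis by (simp only:) (simp add: algebra_simps qscale_diff_right)
  qed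
  ultimately show ?thesis using twist unfolding extremal_def by simp
qed

lemma extremal_power:
  assumes "extremal A x X" shows "extremal (n * A) (x ^ n) (X ^ n)"
  by (induction n) (simp_all add: extremal_1 extremal_mult[OF assms])

text \<open>All monomials of the Serre polynomial have the same total degree, so one divided power of the
adjoint action maps the polynomial in the bottoms to the polynomial in the tops.\<close>

lemma extremal_qserre:
  assumes x: "extremal A x X" and y: "extremal B y Y" and "qserre n x y = 0"
  shows "qserre n X Y = 0"
proof -
  have "adp (n * A + B) (x ^ r * y * x ^ (n - r)) = X ^ r * Y * X ^ (n - r)" if "r \<le> n" for r
  proof -
    have "extremal (r * A + B + (n - r) * A) (x ^ r * y * x ^ (n - r)) (X ^ r * Y * X ^ (n - r))"
      by (intro extremal_mult extremal_power x y)
    moreover have "r * A + B + (n - r) * A = n * A + B"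
      using that by (metis add.assoc add.commute add_mult_distrib le_add_diff_inverse)
    ultimately show ?thesis by (simp add: extremal_def)
  qed
  hence "qserre n X Y = adp (n * A + B) (qserre n x y)"
    unfolding qserre_def adp_sum adp_qscale by (intro sum.cong refl) simp
  thus ?thesis by (simp add: assms(3))
qed

text \<open>Two degrees below the total one, where \<open>ad y\<close> has already used up one step of the string of
\<open>y\<close>.\<close>

lemma extremal_ad:
  assumes x: "extremal A x X" and y: "extremal B y Y" and M: "A + B = M + 2"
  shows "adp M (x * ad y) =
    qint (int B - 1) \<star> (X * (vv powi (- int B) \<star> (lower * Y) - Y * lower))
    + (vv powi (1 - int B) * qint (int B)) \<star> ((vv powi (- int A) \<star> (lower * X) - X * lower) * Y)"
proof -
  note x' = x[unfolded extremal_def] and y' = y[unfolded extremal_def]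
  define c where "c p = vv ^ (p * (M - p)) * (vv powi (- int A)) ^ (M - p) * qint (int (Suc (M - p)))" for p
  have "adp M (x * ad y) = (\<Sum>p\<le>M. (vv ^ (p * (M - p)) * (vv powi (- int A)) ^ (M - p)) \<star> (adp p x * adp (M - p) (ad y)))"
    by (rule adp_mult) (use x' in blast)
  also have "\<dots> = (\<Sum>p\<le>M. c p \<star> (adp p x * adp (Suc (M - p)) y))"
    by (simp add: adp_ad c_def mult.assoc del: of_nat_Suc)
  also have "\<dots> = (\<Sum>p\<in>{p. p \<le> M \<and> (p = A \<or> Suc p = A)}. c p \<star> (adp p x * adp (Suc (M - p)) y))"
  proof (intro sum.mono_neutral_right ballI)
    fix p assume p: "p \<in> {..M} - {p. p \<le> M \<and> (p = A \<or> Suc p = A)}"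
    hence "p > A \<or> Suc (M - p) > B" using M by auto
    thus "c p \<star> (adp p x * adp (Suc (M - p)) y) = 0" using x' y' by auto
  qed auto
  finally have sub: "adp M (x * ad y) = \<dots>" .
  have top: "c A \<star> (adp A x * adp (Suc (M - A)) y) = qint (int B - 1) \<star> (X * adpred B y)" if "A \<le> M"
  proof -
    have B: "B = Suc (Suc (M - A))" using that M by simp
    hence "adpred B y = adp (Suc (M - A)) y" by (simp only: adpred_simps)
    moreover have "c A = qint (int B - 1)"
      unfolding c_def using B by (simp add: vv_powi_minus power_mult flip: power_mult_distrib)
    ultimately show ?thesis using x' by simp
  qed
  have low: "c p \<star> (adp p x * adp (Suc (M - p)) y) = (vv powi (1 - int B) * qint (int B)) \<star> (adpred A x * Y)"
    if "A = Suc p" "p \<le> M" for p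
  proof -
    have B: "Suc (M - p) = B" using M that by simp
    hence "1 - int B = - int (M - p)" by simp
    hence "vv ^ (p * (M - p)) * (vv powi (- int A)) ^ (M - p) = vv powi (1 - int B)"
      unfolding that(1) by (simp only: vv_shift)
    hence "c p = vv powi (1 - int B) * qint (int B)"
      unfolding c_def B by simp
    thus ?thesis using y' that B by simp
  qed
  have "adp M (x * ad y) = qint (int B - 1) \<star> (X * adpred B y)
      + (vv powi (1 - int B) * qint (int B)) \<star> (adpred A x * Y)"
  proof (cases A)
    case 0
    hence "{p. p \<le> M \<and> (p = A \<or> Suc p = A)} = {A}" by auto
    thus ?thesis using 0 sub top by simp
  next
    case A: (Suc p)
    consider "B = 0" | "B = 1" | "A \<le> M" using M by linarith
    thus ?thesis
    proof cases
      case 1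
      hence none: "{q. q \<le> M \<and> (q = A \<or> Suc q = A)} = {}" using A M by auto
      show ?thesis unfolding sub none using 1 by simp
    next
      case 2
      hence "{q. q \<le> M \<and> (q = A \<or> Suc q = A)} = {p}" "p \<le> M" using A M by auto
      thus ?thesis using 2 sub low[OF A] by simp
    next
      case 3
      hence "{q. q \<le> M \<and> (q = A \<or> Suc q = A)} = {A, p}" "A \<noteq> p" "p \<le> M" using A by auto
      thus ?thesis using sub low[OF A] top[OF 3] by simp
    qed
  qed
  thus ?thesis using x' y' by simp
qed

text \<open>\<open>E\<close> is in general not the bottom of a finite string, so the Serre relation with one factor
\<open>E\<close> needs another argument. As \<open>ad (x\<^sup>n)\<close> is a twisted commutator of \<open>E\<close> and \<open>x\<^sup>n\<close>, the relation
rewrites as \<open>\<Sum> (-1)\<^sup>r [N choose r] x\<^sup>r ad (x\<^bsup>N - r\<^esup>) = 0\<close>, the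
remaining terms forming an alternating sum that vanishes. Applying the divided power two degrees
below the total one gives, by \<open>extremal_ad\<close>, minus the Serre polynomial in \<open>X\<close> and the lowering
element, again up to vanishing alternating sums.\<close>

lemma qserre_top_lower_pos:
  assumes x: "extremal a x X" and "a > 0" and serre: "qserre (Suc a) x E = 0"
  shows "qserre (Suc a) X lower = 0"
proof -
  define N where "N = Suc a"
  define b where "b r = (- 1) ^ r * qbinom (int N) r" for r
  define M where "M = N * a - 2"
  have M: "N * a = M + 2" using \<open>a > 0\<close> by (cases a) (simp_all add: M_def N_def)
  have N: "int N - 1 = int a" by (simp add: N_def)
  have alt: "(\<Sum>r\<le>N. b r * (vv ^ a) ^ r) = 0" "(\<Sum>r\<le>N. b r * (inverse vv ^ a) ^ r) = 0"
    using qbinom_alternating_sum[of N vv] qbinom_alternating_sum[of N "inverse vv"]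
    unfolding b_def N by (simp_all add: N_def)
  have ad_pow: "ad (x ^ n) = E * x ^ n - vv powi (- int (n * a)) \<star> (x ^ n * E)" for n
    using extremal_power[OF x, of n] by (simp add: ad_def extremal_def)
  have "(\<Sum>r\<le>N. b r \<star> (x ^ r * ad (x ^ (N - r)))) =
      qserre N x E - (\<Sum>r\<le>N. b r * vv powi (- int ((N - r) * a))) \<star> (x ^ N * E)"
    unfolding qserre_def qscale_sum_left sum_subtractf[symmetric] b_def[symmetric]
  proof (intro sum.cong refl)
    fix r assume "r \<in> {..N}"
    hence "x ^ r * x ^ (N - r) = x ^ N" by (simp flip: power_add)
    hence "x ^ r * (x ^ (N - r) * E) = x ^ N * E" by (simp flip: mult.assoc)
    thus "b r \<star> (x ^ r * ad (x ^ (N - r))) = b r \<star> (x ^ r * E * x ^ (N - r))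
        - (b r * vv powi (- int ((N - r) * a))) \<star> (x ^ N * E)"
      unfolding ad_pow by (simp add: right_diff_distrib qscale_diff_right mult.assoc)
  qed
  also have "(\<Sum>r\<le>N. b r * vv powi (- int ((N - r) * a))) = vv powi (- int (N * a)) * (\<Sum>r\<le>N. b r * (vv ^ a) ^ r)"
    unfolding sum_distrib_left
  proof (intro sum.cong refl)
    fix r assume "r \<in> {..N}"
    hence "- int ((N - r) * a) = - int (N * a) + int (a * r)"
      by (simp add: of_nat_diff algebra_simps)
    hence "vv powi (- int ((N - r) * a)) = vv powi (- int (N * a)) * (vv ^ a) ^ r"
      by (simp only: vv_powi_add power_int_of_nat power_mult)
    thus "b r * vv powi (- int ((N - r) * a)) = vv powi (- int (N * a)) * (b r * (vv ^ a) ^ r)"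
      by simp
  qed
  finally have rel: "(\<Sum>r\<le>N. b r \<star> (x ^ r * ad (x ^ (N - r)))) = 0"
    using serre unfolding alt N_def[symmetric] by simp
  define g where "g r = vv powi (1 - int ((N - r) * a)) * qint (int ((N - r) * a)) * vv powi (- int (r * a))" for r
  define h where "h r = qint (int ((N - r) * a) - 1)" for r
  have "adp M (x ^ r * ad (x ^ (N - r))) = g r \<star> (lower * X ^ N) - h r \<star> (X ^ N * lower) - X ^ r * lower * X ^ (N - r)"
    if r: "r \<le> N" for r
  proof -
    define B where "B = (N - r) * a"
    have rB: "r * a + B = M + 2"
      using r M unfolding B_def by (simp flip: add_mult_distrib)
    have pw: "X ^ r * X ^ (N - r) = X ^ N" "X ^ r * (X ^ (N - r) * z) = X ^ N * z" for z
      using r by (simp_all flip: power_add mult.assoc)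
    \<comment> \<open>The two occurrences of \<open>X\<^sup>r lower X\<^bsup>N - r\<^esup>\<close> combine to coefficient \<open>-1\<close>.\<close>
    have "vv * qint (int B) = qint (int B - 1) + vv powi int B"
      using qint_add[of "int B - 1" 1] by (simp add: vv_powi_minus power_int_diff field_simps)
    moreover have "vv powi (1 - int B) = vv powi (- int B) * vv"
      using vv_powi_add[of "- int B" 1] by simp
    ultimately have "vv powi (1 - int B) * qint (int B) = vv powi (- int B) * qint (int B - 1) + 1"
      by (simp add: mult.assoc distrib_left vv_powi_minus)
    hence "(vv powi (1 - int B) * qint (int B)) \<star> (X ^ r * (lower * X ^ (N - r))) =
        (vv powi (- int B) * qint (int B - 1)) \<star> (X ^ r * (lower * X ^ (N - r))) + X ^ r * (lower * X ^ (N - r))"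
      by (simp add: qscale_add_left)
    thus ?thesis
      using extremal_ad[OF extremal_power[OF x, of r] extremal_power[OF x, of "N - r"], folded B_def, OF rB]
      unfolding g_def h_def B_def[symmetric]
      by (simp add: algebra_simps qscale_diff_right pw del: of_nat_mult)
  qed
  hence "adp M (\<Sum>r\<le>N. b r \<star> (x ^ r * ad (x ^ (N - r)))) =
      (\<Sum>r\<le>N. b r \<star> (g r \<star> (lower * X ^ N) - h r \<star> (X ^ N * lower) - X ^ r * lower * X ^ (N - r)))"
    unfolding adp_sum adp_qscale by (intro sum.cong refl) simp
  also have "\<dots> = (\<Sum>r\<le>N. b r * g r) \<star> (lower * X ^ N) - (\<Sum>r\<le>N. b r * h r) \<star> (X ^ N * lower) - qserre N X lower"
    unfolding qserre_def b_def[symmetric] by (simp add: qscale_diff_right sum_subtractf qscale_sum_left)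
  finally have res: "qserre N X lower = (\<Sum>r\<le>N. b r * g r) \<star> (lower * X ^ N) - (\<Sum>r\<le>N. b r * h r) \<star> (X ^ N * lower)"
    by (simp add: rel)
  have vanish: "(\<Sum>r\<le>N. b r * u r) = 0"
    if u: "\<And>r. r \<le> N \<Longrightarrow> u r = k * (vv ^ a) ^ r - l * (inverse vv ^ a) ^ r" for u k l
  proof -
    have "(\<Sum>r\<le>N. b r * u r) = (\<Sum>r\<le>N. k * (b r * (vv ^ a) ^ r) - l * (b r * (inverse vv ^ a) ^ r))"
      by (intro sum.cong refl) (simp add: u algebra_simps)
    thus ?thesis by (simp add: sum_subtractf alt flip: sum_distrib_left)
  qed
  have g: "g r = (- (vv powi (1 - 2 * int (N * a))) / (vv - inverse vv)) * (vv ^ a) ^ r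
      - (- vv / (vv - inverse vv)) * (inverse vv ^ a) ^ r" if "r \<le> N" for r
  proof -
    have "g r = (vv powi 1 * vv powi (- int (a * r)) - vv powi (1 - 2 * int (N * a)) * vv powi (int (a * r))) / (vv - inverse vv)"
      unfolding g_def qint_def using that
      by (simp add: algebra_simps of_nat_diff flip: vv_powi_add)
    thus ?thesis
      by (simp add: vv_powi_minus power_mult power_inverse diff_divide_distrib flip: of_nat_mult)
  qed
  have h: "h r = (- (vv powi (1 - int (N * a))) / (vv - inverse vv)) * (vv ^ a) ^ r
      - (- (vv powi (int (N * a) - 1)) / (vv - inverse vv)) * (inverse vv ^ a) ^ r" if "r \<le> N" for r
  proof -
    have "h r = (vv powi (int (N * a) - 1) * vv powi (- int (a * r)) - vv powi (1 - int (N * a)) * vv powi (int (a * r))) / (vv - inverse vv)"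
      unfolding h_def qint_def using that
      by (simp add: algebra_simps of_nat_diff flip: vv_powi_add)
    thus ?thesis
      by (simp add: vv_powi_minus power_mult power_inverse diff_divide_distrib flip: of_nat_mult)
  qed
  have sums: "(\<Sum>r\<le>N. b r * g r) = 0" "(\<Sum>r\<le>N. b r * h r) = 0"
    by (rule vanish, rule g, assumption) (rule vanish, rule h, assumption)
  show ?thesis
    using res sums unfolding N_def[symmetric] by (simp only: qscale_0_left diff_self)
qed

lemma qserre_top_lower:
  assumes x: "extremal a x X" and serre: "qserre (Suc a) x E = 0"
  shows "qserre (Suc a) X lower = 0"
proof (cases "a = 0")
  case True
  have "lower * X = X * lower" using x True by (simp add: extremal_def)
  moreover have "qbinom 1 (Suc 0) = 1" using qbinom_Suc[of 1 0] by simp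
  ultimately show ?thesis by (simp add: True qserre_def)
qed (use qserre_top_lower_pos[OF assms(1) _ assms(2)] in simp)

end


section \<open>Commutators of opposite strings\<close>

text \<open>\<open>x\<close> is a weight vector of multiplicative weight \<open>s\<close> for the torus element \<open>g\<close>.\<close>

definition q_commutes :: "Qv \<Rightarrow> 'a::qalg \<Rightarrow> 'a \<Rightarrow> bool" where
  "q_commutes s g x \<longleftrightarrow> g * x = s \<star> (x * g)"

lemma q_commutes_mult_left: "q_commutes s g x \<Longrightarrow> q_commutes t h x \<Longrightarrow> q_commutes (s * t) (g * h) x"
  unfolding q_commutes_def using nested_mult[of g x "s \<star> (x * g)" h]
  by (simp add: mult.assoc mult.commute)

lemma q_commutes_mult_right: "q_commutes s g x \<Longrightarrow> q_commutes t g y \<Longrightarrow> q_commutes (s * t) g (x * y)"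
  unfolding q_commutes_def using nested_mult[of g x "s \<star> (x * g)" y]
  by (simp add: mult.assoc)

lemma q_commutes_qscale: "q_commutes s g x \<Longrightarrow> q_commutes s g (k \<star> x)"
  by (simp add: q_commutes_def mult.commute)

lemma q_commutes_minus: "q_commutes s g x \<Longrightarrow> q_commutes s g (- x)"
  by (simp add: q_commutes_def)

lemma q_commutes_power_left: "q_commutes s g x \<Longrightarrow> q_commutes (s ^ n) (g ^ n) x"
proof (induction n)
  case (Suc n)
  thus ?case using q_commutes_mult_left[of s g x "s ^ n" "g ^ n"] by simp
qed (simp add: q_commutes_def)

lemma q_commutes_power_right: "q_commutes s g x \<Longrightarrow> q_commutes (s ^ n) g (x ^ n)"
proof (induction n)
  case (Suc n)
  thus ?case using q_commutes_mult_right[of s g x "s ^ n" "x ^ n"] by simp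
qed (simp add: q_commutes_def)

lemma q_commutes_skew_comm:
  assumes "q_commutes s g e" "q_commutes t g x"
  shows "q_commutes (s ^ m * t) g (skew_comm q u e m x)"
proof (induction m)
  case (Suc m)
  have "q_commutes (s ^ Suc m * t) g (e * skew_comm q u e m x)"
    using q_commutes_mult_right[OF assms(1) Suc] by (simp add: mult.assoc)
  moreover have "q_commutes (s ^ Suc m * t) g (skew_comm q u e m x * e)"
    using q_commutes_mult_right[OF Suc assms(1)] by (simp add: mult_ac)
  ultimately show ?case
    unfolding skew_comm.simps q_commutes_def by (simp add: algebra_simps qscale_diff_right)
qed (use assms in simp)

lemma prod_vv_powi: "(\<Prod>l\<in>A. vv powi g l) = vv powi (\<Sum>l\<in>A. g l)"
  by (induction A rule: infinite_finite_induct) (simp_all add: vv_powi_add)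

lemma qfact_prod: "qfact n = (\<Prod>l<n. qint (int (Suc l)))"
  by (induction n) (simp_all add: qfact_Suc mult.commute del: of_nat_Suc)

lemma qfact_prod_rev: "qfact n = (\<Prod>l<n. qint (int n - int l))"
proof -
  have "qfact n = (\<Prod>l<n. qint (int (Suc (n - Suc l))))"
    unfolding qfact_prod by (rule prod.nat_diff_reindex[symmetric])
  also have "\<dots> = (\<Prod>l<n. qint (int n - int l))"
    by (intro prod.cong refl arg_cong[where f = qint]) simp
  finally show ?thesis .
qed

context qsl2
begin

interpretation sw: qsl2 F E K' KI' K KI
  by (rule swapped)

text \<open>At the top of a finite string the vanishing of the next vector says that \<open>E\<close> commutes with the
top up to a power of \<open>v\<close>, which \<open>KI\<close> cancels.\<close>

lemma top_commutes:
  assumes "lowest (int a) x" "adp (Suc a) x = 0"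
  shows "E * KI * adp a x = adp a x * (E * KI)"
proof -
  have "E * adp a x = vv powi int a \<star> (adp a x * E)"
    using lowest_rec[OF assms(1), of a] assms(2) by simp
  moreover have "KI * adp a x = vv powi (- int a) \<star> (adp a x * KI)"
    using inverse_q_commute[OF K_KI KI_K lowest_K[OF assms(1), of a]] by (simp add: vv_powi_minus)
  ultimately show ?thesis
    using nested_mult[of E "adp a x"] by (simp add: mult.assoc vv_powi_minus)
qed

text \<open>Commuting a member of one string with \<open>F\<close> only moves it one step down, so the
  commutators of two opposite strings satisfy a recursion in the second index.\<close>

lemma comm_strings_rec:
  assumes x: "lowest a x" and y: "sw.lowest b y"
  defines "C \<equiv> \<lambda>z n. z * sw.adp n y - sw.adp n y * z"
  shows "qint (int (Suc n)) \<star> C (adp m x) (Suc n) =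
    F * C (adp m x) n - vv powi (2 * int n - b) \<star> (C (adp m x) n * F)
    - (qint (a - int m + 1) * vv powi (2 * int n - b)) \<star> (C (adpred m x) n * K')"
proof -
  define z where "z = adp m x"
  define zp where "zp = adpred m x"
  define w where "w = sw.adp n y"
  define s where "s = vv powi (2 * int n - b)"
  have wS: "qint (int (Suc n)) \<star> sw.adp (Suc n) y = F * w - s \<star> (w * F)"
    unfolding w_def s_def using sw.lowest_rec[OF y, of n] by simp
  have zF: "z * F = F * z - qint (a - int m + 1) \<star> (zp * K')"
    unfolding z_def zp_def by (rule lowest_F[OF x])
  have Kw: "K' * w = s \<star> (w * K')"
    unfolding w_def s_def by (rule sw.lowest_K[OF y])
  have "qint (int (Suc n)) \<star> C z (Suc n) =
      z * (qint (int (Suc n)) \<star> sw.adp (Suc n) y) - (qint (int (Suc n)) \<star> sw.adp (Suc n) y) * z"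
    by (simp add: C_def qscale_diff_right)
  also have "\<dots> = z * F * w - s \<star> (z * w * F) - F * w * z + s \<star> (w * (F * z))"
    unfolding wS by (simp add: algebra_simps)
  also have "F * z = z * F + qint (a - int m + 1) \<star> (zp * K')"
    using zF by simp
  also have "z * F * w = F * z * w - (qint (a - int m + 1) * s) \<star> (zp * w * K')"
    unfolding zF by (simp add: algebra_simps Kw)
  finally show ?thesis
    unfolding C_def z_def[symmetric] zp_def[symmetric] s_def[symmetric] w_def[symmetric]
    by (simp add: algebra_simps qscale_diff_right qscale_add_right)
qed

lemma commuting_strings:
  assumes x: "lowest a x" and y: "sw.lowest b y" and xy: "x * y = y * x"
  shows "adp m x * sw.adp n y = sw.adp n y * adp m x"
proof (induction n arbitrary: m)
  case 0
  have Ey: "E * y = y * E" using y by (simp add: sw.lowest_def)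
  show ?case
  proof (induction m)
    case (Suc m)
    have Ex: "qint (int (Suc m)) \<star> adp (Suc m) x = E * adp m x - vv powi (2 * int m - a) \<star> (adp m x * E)"
      using lowest_rec[OF x, of m] by simp
    have "qint (int (Suc m)) \<star> (adp (Suc m) x * y) = (qint (int (Suc m)) \<star> adp (Suc m) x) * y"
      by simp
    also have "\<dots> = y * (qint (int (Suc m)) \<star> adp (Suc m) x)"
      unfolding Ex using Suc by (simp add: algebra_simps Ey nested_mult[OF Ey] nested_mult[OF Suc[simplified]])
    finally show ?case by (simp add: qint_cancel del: of_nat_Suc)
  qed (simp add: xy)
next
  case (Suc n)
  have "adpred m x * sw.adp n y = sw.adp n y * adpred m x"
    using Suc by (cases m) simp_all
  then have "qint (int (Suc n)) \<star> (adp m x * sw.adp (Suc n) y - sw.adp (Suc n) y * adp m x) = qint (int (Suc n)) \<star> 0"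
    unfolding comm_strings_rec[OF x y] using Suc[of m] by simp
  hence "adp m x * sw.adp (Suc n) y - sw.adp (Suc n) y * adp m x = 0"
    by (rule qint_cancel)
  thus ?case by simp
qed

lemma E_power_F:
  "E ^ p * F = F * E ^ p + (inverse (vv - inverse vv) * qint (int p)) \<star>
     (E ^ (p - 1) * (vv powi (int p - 1) \<star> K - vv powi (1 - int p) \<star> K'))"
proof (induction p)
  case (Suc p)
  define h where "h = inverse (vv - inverse vv)"
  have EF: "E * F = F * E + h \<star> (K - K')" using E_F by (simp add: h_def)
  have K: "K * E ^ p = vv powi (2 * int p) \<star> (E ^ p * K)" "K' * E ^ p = vv powi (- 2 * int p) \<star> (E ^ p * K')"
    using q_commutes_power_right[of "vv powi 2" K E p] q_commutes_power_right[of "vv powi (- 2)" K' E p]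
    unfolding q_commutes_def vv_powi_mult by (simp_all only: K_E K'_E simp_thms mult.commute)
  have q: "qint (int (Suc p)) * vv powi int p = vv powi (2 * int p) + qint (int p) * vv powi (int p - 1)"
    "qint (int (Suc p)) * vv powi (- int p) = vv powi (- 2 * int p) + qint (int p) * vv powi (1 - int p)"
  proof -
    have "qint (int (Suc p)) = vv powi (- 1) * qint (int p) + vv powi int p"
      using qint_add[of "int p" 1] by (simp add: add.commute)
    hence "qint (int (Suc p)) * vv powi int p =
        qint (int p) * (vv powi int p * vv powi (- 1)) + vv powi int p * vv powi int p"
      by (simp only: ring_distribs mult_ac)
    thus "qint (int (Suc p)) * vv powi int p = vv powi (2 * int p) + qint (int p) * vv powi (int p - 1)"
      unfolding vv_powi_add[symmetric] by (simp add: algebra_simps)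
    have "qint (int (Suc p)) = vv powi 1 * qint (int p) + vv powi (- int p)"
      using qint_add'[of "int p" 1] by (simp add: add.commute)
    hence "qint (int (Suc p)) * vv powi (- int p) =
        qint (int p) * (vv powi 1 * vv powi (- int p)) + vv powi (- int p) * vv powi (- int p)"
      by (simp only: ring_distribs mult_ac)
    thus "qint (int (Suc p)) * vv powi (- int p) = vv powi (- 2 * int p) + qint (int p) * vv powi (1 - int p)"
      unfolding vv_powi_add[symmetric] by (simp add: algebra_simps)
  qed
  have "E ^ Suc p * F = E * (E ^ p * F)" by (simp add: mult.assoc)
  also have "\<dots> = E * F * E ^ p + (h * qint (int p)) \<star>
     (E * E ^ (p - 1) * (vv powi (int p - 1) \<star> K - vv powi (1 - int p) \<star> K'))"
    unfolding Suc h_def[symmetric] by (simp add: algebra_simps)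
  also have "\<dots> = E * F * E ^ p + (h * qint (int p)) \<star>
     (E ^ p * (vv powi (int p - 1) \<star> K - vv powi (1 - int p) \<star> K'))"
    by (cases p) simp_all
  also have "E * F * E ^ p = F * E ^ Suc p + h \<star> (K * E ^ p - K' * E ^ p)"
    unfolding EF by (simp add: algebra_simps qscale_diff_right)
  also have "\<dots> + (h * qint (int p)) \<star> (E ^ p * (vv powi (int p - 1) \<star> K - vv powi (1 - int p) \<star> K')) =
      F * E ^ Suc p + (h * (vv powi (2 * int p) + qint (int p) * vv powi (int p - 1))) \<star> (E ^ p * K)
      - (h * (vv powi (- 2 * int p) + qint (int p) * vv powi (1 - int p))) \<star> (E ^ p * K')"
    unfolding K by (simp add: algebra_simps qscale_distribs)
  also have "\<dots> = F * E ^ Suc p + (h * qint (int (Suc p))) \<star>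
      (E ^ (Suc p - 1) * (vv powi (int (Suc p) - 1) \<star> K - vv powi (1 - int (Suc p)) \<star> K'))"
    unfolding q[symmetric] by (simp add: algebra_simps qscale_diff_right)
  finally show ?case by (simp only: h_def)
qed simp

text \<open>Applied with \<open>x = E\<^sub>j\<close>, \<open>y = F\<^sub>j\<close>, \<open>L = K\<^sub>j\<close> and \<open>L' = K'\<^sub>j\<close>. The commutators with
\<open>n \<le> m\<close> form a closed system: in the recursion the term containing both \<open>K'\<close> and \<open>L\<close> cancels, so above the
diagonal a single monomial is left, and on the diagonal the term with \<open>L'\<close> propagates by itself.\<close>

lemma dual_strings:
  fixes a :: nat
  defines "h \<equiv> inverse (vv - inverse vv)"
  defines "kl \<equiv> \<lambda>m n. h * (\<Prod>k<m. 1 - vv powi (2 * int k - 2 * int a)) *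
      (\<Prod>l<n. - (h * vv powi (int m - int l - 1) / qint (int (Suc l))))"
  defines "kr \<equiv> \<lambda>n. - h * (\<Prod>l<n. - (qint (int a - int l) * vv powi (2 * int l - int a) / qint (int (Suc l))))"
  assumes x: "lowest (int a) x" and y: "sw.lowest (int a) y"
    and xy: "x * y = y * x + h \<star> (L - L')"
    and L: "q_commutes (vv powi (- int a)) L E" "q_commutes (vv powi int a) L F" "L * K' = K' * L"
    and L': "q_commutes (vv powi int a) L' E" "L' * K' = K' * L'"
  shows "n \<le> m \<Longrightarrow> m \<le> a \<Longrightarrow> adp m x * sw.adp n y - sw.adp n y * adp m x =
      (kl m n / qfact (m - n)) \<star> (E ^ (m - n) * (K ^ n * L))
      + (if m = n then kr n \<star> (K' ^ n * L') else 0)"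
proof (induction n arbitrary: m)
  case 0
  have Ey: "E * y = y * E" using y by (simp add: sw.lowest_def)
  have LE: "L * E = vv powi (- int a) \<star> (E * L)" "L' * E = vv powi int a \<star> (E * L')"
    using L L' by (simp_all only: q_commutes_def)
  have "adp m x * y - y * adp m x =
      (kl m 0 / qfact m) \<star> (E ^ m * L) + (if m = 0 then kr 0 \<star> L' else 0)"
  proof (induction m)
    case (Suc m)
    define s where "s = vv powi (2 * int m - int a)"
    have s: "s * vv powi (- int a) = vv powi (2 * int m - 2 * int a)"
      unfolding s_def vv_powi_add[symmetric] by (rule arg_cong[where f = "power_int vv"]) simp
    have Ex: "qint (int (Suc m)) \<star> adp (Suc m) x = E * adp m x - s \<star> (adp m x * E)"
      using lowest_rec[OF x, of m] by (simp add: s_def)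
    have "qint (int (Suc m)) \<star> (adp (Suc m) x * y - y * adp (Suc m) x) =
      (qint (int (Suc m)) \<star> adp (Suc m) x) * y - y * (qint (int (Suc m)) \<star> adp (Suc m) x)"
      by (simp add: qscale_diff_right)
    also have "\<dots> = E * (adp m x * y - y * adp m x) - s \<star> ((adp m x * y - y * adp m x) * E)"
      unfolding Ex by (simp add: algebra_simps qscale_diff_right Ey nested_mult[OF Ey])
    also have "\<dots> = (kl m 0 / qfact m * (1 - s * vv powi (- int a))) \<star> (E ^ Suc m * L)"
    proof (cases "m = 0")
      case True
      have "s * vv powi int a = 1" using True by (simp add: s_def vv_powi_minus)
      thus ?thesis unfolding Suc
        by (simp add: True algebra_simps LE qscale_distribs kl_def kr_def)
    next
      case False
      have "E ^ m * L * E = vv powi (- int a) \<star> (E ^ Suc m * L)"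
        by (simp add: mult.assoc LE nested_mult[OF power_commutes[symmetric]])
      thus ?thesis unfolding Suc using False
        by (simp add: algebra_simps qscale_distribs)
    qed
    also have "kl m 0 / qfact m * (1 - s * vv powi (- int a)) = qint (int (Suc m)) * (kl (Suc m) 0 / qfact (Suc m))"
      using qint_nonzero[of "int (Suc m)"] unfolding s
      by (simp add: kl_def qfact_Suc del: of_nat_Suc)
    finally have "adp (Suc m) x * y - y * adp (Suc m) x = (kl (Suc m) 0 / qfact (Suc m)) \<star> (E ^ Suc m * L)"
      unfolding qscale_qscale[symmetric] by (rule qint_cancel)
    thus ?case by (simp only: nat.simps if_False add_0_right)
  qed (simp add: xy kl_def kr_def qscale_diff_right)
  thus ?case by simp
next
  case (Suc n)
  then obtain k where m: "m = Suc k" and k: "n \<le> k" "Suc k \<le> a" by (cases m) auto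
  define p where "p = k - n"
  define s where "s = vv powi (2 * int n - int a)"
  define T where "T = E ^ p * (K ^ n * L)"
  have p: "Suc k - n = Suc p" "Suc k - Suc n = p" "k - n = p" using k by (simp_all add: p_def)
  have LF: "K ^ n * L * F = vv powi (int a - 2 * int n) \<star> (F * (K ^ n * L))"
    using q_commutes_mult_left[OF q_commutes_power_left[of "vv powi (- 2)" K F n] L(2)] K_F
    unfolding q_commutes_def vv_powi_mult vv_powi_add[symmetric] by (simp add: add.commute mult.commute)
  have LK': "K ^ n * L * K' = K' * (K ^ n * L)"
    using nested_mult[OF power_commuting_commutes[OF K_K', of n]] by (simp add: mult.assoc L(3))
  have KK: "K * (K ^ n * L) = K ^ Suc n * L" by (simp add: mult.assoc)
  have C1: "adp (Suc k) x * sw.adp n y - sw.adp n y * adp (Suc k) x =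
      (kl (Suc k) n / qfact (Suc p)) \<star> (E ^ Suc p * (K ^ n * L))"
    using Suc.IH[of "Suc k"] k p by simp
  have C2: "adp k x * sw.adp n y - sw.adp n y * adp k x =
      (kl k n / qfact p) \<star> T + (if k = n then kr n \<star> (K' ^ n * L') else 0)"
    using Suc.IH[of k] k p by (simp add: T_def)
  have s: "s * vv powi (int a - 2 * int n) = 1"
    by (simp add: s_def flip: vv_powi_add)
  have "F * (E ^ Suc p * (K ^ n * L)) - s \<star> (E ^ Suc p * (K ^ n * L) * F) =
      (F * E ^ Suc p - E ^ Suc p * F) * (K ^ n * L)"
    using s by (simp add: mult.assoc LF[unfolded mult.assoc] left_diff_distrib)
  also have "\<dots> = - (h * qint (int (Suc p))) \<star> (E ^ p * ((vv powi int p \<star> K - vv powi (- int p) \<star> K') * (K ^ n * L)))"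
    unfolding E_power_F h_def[symmetric] by (simp add: mult.assoc)
  also have "\<dots> = - (h * qint (int (Suc p))) \<star> (vv powi int p \<star> (E ^ p * (K ^ Suc n * L)) - vv powi (- int p) \<star> (T * K'))"
    by (simp only: left_diff_distrib qscale_mult_left qscale_mult_right KK LK'[symmetric] T_def right_diff_distrib mult.assoc)
  finally have comm: "F * (E ^ Suc p * (K ^ n * L)) - s \<star> (E ^ Suc p * (K ^ n * L) * F) = \<dots>" .
  \<comment> \<open>\<open>R1\<close> and \<open>R3\<close> step the two coefficients in \<open>n\<close>; \<open>R2\<close> cancels the monomials containing
    both \<open>K'\<close> and \<open>L\<close>.\<close>
  have R1: "qint (int (Suc n)) * kl (Suc k) (Suc n) = - (kl (Suc k) n * h * vv powi int p)"
  proof -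
    have "int (Suc k) - int n - 1 = int p" using p k by simp
    thus ?thesis using qint_nonzero[of "int (Suc n)"] by (simp add: kl_def del: of_nat_Suc)
  qed
  have R2: "kl (Suc k) n * h * vv powi (- int p) = qint (int a - int k) * s * kl k n"
  proof -
    have "- (h * vv powi (int (Suc k) - int l - 1) / qint (int (Suc l))) =
        vv * - (h * vv powi (int k - int l - 1) / qint (int (Suc l)))" for l
    proof -
      have "vv powi (int (Suc k) - int l - 1) = vv * vv powi (int k - int l - 1)"
        using vv_powi_add[of 1 "int k - int l - 1"] by simp
      thus ?thesis by (simp only: mult_ac times_divide_eq_right mult_minus_right)
    qed
    hence "(\<Prod>l<n. - (h * vv powi (int (Suc k) - int l - 1) / qint (int (Suc l)))) =
        vv ^ n * (\<Prod>l<n. - (h * vv powi (int k - int l - 1) / qint (int (Suc l))))"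
      by (simp only: prod.distrib prod_constant card_lessThan)
    hence "kl (Suc k) n = kl k n * (1 - vv powi (2 * int k - 2 * int a)) * vv ^ n"
      by (simp add: kl_def mult_ac del: of_nat_Suc)
    moreover have "(1 - vv powi (2 * int k - 2 * int a)) * vv powi int n * h * vv powi (int n - int k) =
        qint (int a - int k) * s"
    proof -
      let ?A = "vv powi (2 * int k - 2 * int a)" and ?B = "vv powi int n" and ?C = "vv powi (int n - int k)"
      have "?B * ?C = vv powi (int a - int k) * s" "?A * (?B * ?C) = vv powi (- (int a - int k)) * s"
        unfolding s_def vv_powi_add[symmetric] by (rule arg_cong[where f = "power_int vv"], simp)+
      hence "(?B * ?C - ?A * (?B * ?C)) * h = (vv powi (int a - int k) - vv powi (- (int a - int k))) * s * h"
        by (simp only: left_diff_distrib)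
      thus ?thesis by (simp add: qint_def h_def divide_inverse algebra_simps)
    qed
    moreover have "- int p = int n - int k" using k by (simp add: p_def)
    ultimately show ?thesis by (simp add: mult_ac)
  qed
  have R3: "qint (int (Suc n)) * kr (Suc n) = - (qint (int a - int n) * s * kr n)"
    using qint_nonzero[of "int (Suc n)"] by (simp add: kr_def s_def del: of_nat_Suc)
  have "kl (Suc k) n / qfact (Suc p) * (h * qint (int (Suc p))) = kl (Suc k) n * h / qfact p"
    using qint_nonzero[of "int (Suc p)"] by (simp add: qfact_Suc del: of_nat_Suc)
  then have "qint (int (Suc n)) \<star> (adp m x * sw.adp (Suc n) y - sw.adp (Suc n) y * adp m x) =
      - (kl (Suc k) n * h / qfact p) \<star> (vv powi int p \<star> (E ^ p * (K ^ Suc n * L)) - vv powi (- int p) \<star> (T * K'))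
      - (qint (int a - int k) * s) \<star> ((kl k n / qfact p) \<star> (T * K')
        + (if k = n then kr n \<star> (K' ^ n * L' * K') else 0))"
  proof -
    define W where "W = E ^ Suc p * (K ^ n * L)"
    define e where "e = kl (Suc k) n / qfact (Suc p)"
    assume e': "kl (Suc k) n / qfact (Suc p) * (h * qint (int (Suc p))) = kl (Suc k) n * h / qfact p"
    have pred: "int a - int (Suc k) + 1 = int a - int k" "adpred (Suc k) x = adp k x" by simp_all
    have "F * (e \<star> W) - s \<star> (e \<star> W * F) = e \<star> (F * W - s \<star> (W * F))"
      by (simp add: qscale_diff_right mult.commute)
    also have "\<dots> = - (e * (h * qint (int (Suc p)))) \<star>
        (vv powi int p \<star> (E ^ p * (K ^ Suc n * L)) - vv powi (- int p) \<star> (T * K'))"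
      unfolding W_def comm by (simp only: qscale_qscale mult_minus_right)
    finally have FW: "F * (e \<star> W) - s \<star> (e \<star> W * F) = \<dots>" .
    have if_K': "(if k = n then kr n \<star> (K' ^ n * L') else 0) * K' = (if k = n then kr n \<star> (K' ^ n * L' * K') else 0)"
      by simp
    show ?thesis
      unfolding m comm_strings_rec[OF x y, of n "Suc k"] pred C1 C2 s_def[symmetric]
        W_def[symmetric] e_def[symmetric] FW
      unfolding e_def e' distrib_right if_K' qscale_mult_left ..
  qed
  also have "\<dots> = qint (int (Suc n)) \<star> ((kl (Suc k) (Suc n) / qfact p) \<star> (E ^ p * (K ^ Suc n * L))
      + (if k = n then kr (Suc n) \<star> (K' ^ n * L' * K') else 0))"
  proof -
    have 1: "qint (int (Suc n)) * (kl (Suc k) (Suc n) / qfact p) = - (kl (Suc k) n * h / qfact p) * vv powi int p"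
      using R1 by simp
    have 2: "qint (int a - int k) * s * (kl k n / qfact p) = kl (Suc k) n * h / qfact p * vv powi (- int p)"
      using R2 by simp
    have 3: "- (qint (int a - int k) * s) \<star> (if k = n then kr n \<star> (K' ^ n * L' * K') else 0) =
        qint (int (Suc n)) \<star> (if k = n then kr (Suc n) \<star> (K' ^ n * L' * K') else 0)"
      using R3 by (simp del: of_nat_Suc)
    show ?thesis
      unfolding qscale_add_right qscale_diff_right qscale_qscale 1 2 3[symmetric]
      by (simp del: of_nat_Suc)
  qed
  also have "K' ^ n * L' * K' = K' ^ Suc n * L'"
    by (simp only: mult.assoc L'(2) power_Suc2)
  finally have "adp m x * sw.adp (Suc n) y - sw.adp (Suc n) y * adp m x =
     (kl (Suc k) (Suc n) / qfact p) \<star> (E ^ p * (K ^ Suc n * L)) + (if k = n then kr (Suc n) \<star> (K' ^ Suc n * L') else 0)"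
    by (rule qint_cancel)
  thus ?case unfolding m p by simp
qed

text \<open>At \<open>m = n = a\<close> both products of the preceding lemma collapse to \<open>(-v)\<^bsup>-a\<^esup>\<close>, whose inverse
normalizes the image of \<open>F\<^sub>j\<close>.\<close>

lemma dual_strings_top:
  assumes x: "lowest (int a) x" and y: "sw.lowest (int a) y"
    and xy: "x * y = y * x + inverse (vv - inverse vv) \<star> (L - L')"
    and L: "q_commutes (vv powi (- int a)) L E" "q_commutes (vv powi int a) L F" "L * K' = K' * L"
    and L': "q_commutes (vv powi int a) L' E" "L' * K' = K' * L'"
  shows "adp a x * ((- vv) ^ a \<star> sw.adp a y) - (- vv) ^ a \<star> sw.adp a y * adp a x =
    inverse (vv - inverse vv) \<star> (K ^ a * L - K' ^ a * L')"
proof -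
  define h where "h = inverse (vv - inverse vv)"
  have h: "h \<noteq> 0" by (simp add: h_def)
  define g where "g l = int a - 2 * int l - 2" for l
  have "(\<Sum>l<n. int m - 2 * int l - 2) = int n * (int m - int n - 1)" for m n
    by (induction n) (simp_all add: algebra_simps)
  hence sum_g: "(\<Sum>l<a. g l) = - int a"
    by (simp add: g_def)
  have "(\<Prod>k<a. 1 - vv powi (2 * int k - 2 * int a)) * (\<Prod>l<a. - (h * vv powi (int a - int l - 1) / qint (int (Suc l)))) =
      (\<Prod>l<a. 1 - vv powi (2 * int (a - Suc l) - 2 * int a)) * (\<Prod>l<a. - (h * vv powi (int a - int l - 1) / qint (int (Suc l))))"
    by (rule arg_cong[where f = "\<lambda>z. z * _"],
      rule prod.nat_diff_reindex[of "\<lambda>k. 1 - vv powi (2 * int k - 2 * int a)", symmetric])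
  also have "\<dots> = (\<Prod>l<a. - (vv powi g l))"
    unfolding prod.distrib[symmetric]
  proof (intro prod.cong refl)
    fix l assume "l \<in> {..<a}"
    hence "2 * int (a - Suc l) - 2 * int a = - int (Suc l) + - int (Suc l)" by auto
    hence "1 - vv powi (2 * int (a - Suc l) - 2 * int a) = vv powi (- int (Suc l)) * (vv powi int (Suc l) - vv powi (- int (Suc l)))"
      by (simp add: right_diff_distrib vv_powi_add[symmetric])
    also have "\<dots> = vv powi (- int (Suc l)) * qint (int (Suc l)) * (vv - inverse vv)"
      by (simp add: qint_def)
    finally have "(1 - vv powi (2 * int (a - Suc l) - 2 * int a)) * - (h * vv powi (int a - int l - 1) / qint (int (Suc l))) =
        - (vv powi (- int (Suc l)) * vv powi (int a - int l - 1))"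
      using qint_nonzero[of "int (Suc l)"] h by (simp add: h_def mult_ac del: of_nat_Suc)
    thus "(1 - vv powi (2 * int (a - Suc l) - 2 * int a)) * - (h * vv powi (int a - int l - 1) / qint (int (Suc l))) = - (vv powi g l)"
      by (simp add: vv_powi_add[symmetric] g_def algebra_simps)
  qed
  also have "\<dots> = (- 1) ^ a * (\<Prod>l<a. vv powi g l)"
    by (simp add: prod_uminus)
  also have "\<dots> = (- 1) ^ a * vv powi (- int a)"
    by (simp only: prod_vv_powi sum_g)
  finally have kl: "(\<Prod>k<a. 1 - vv powi (2 * int k - 2 * int a)) *
      (\<Prod>l<a. - (h * vv powi (int a - int l - 1) / qint (int (Suc l)))) = (- 1) ^ a * vv powi (- int a)" .
  have "(\<Sum>l<n. 2 * int l - int m) = int n * (int n - int m - 1)" for m n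
    by (induction n) (simp_all add: algebra_simps)
  hence sum_r: "(\<Sum>l<a. 2 * int l - int a) = - int a"
    by simp
  have "(\<Prod>l<a. - (qint (int a - int l) * vv powi (2 * int l - int a) / qint (int (Suc l)))) =
      (- 1) ^ a * (\<Prod>l<a. vv powi (2 * int l - int a)) * (\<Prod>l<a. qint (int a - int l)) / (\<Prod>l<a. qint (int (Suc l)))"
    by (simp add: prod_uminus prod.distrib prod_dividef mult_ac)
  also have "\<dots> = (- 1) ^ a * vv powi (- int a)"
    unfolding prod_vv_powi sum_r qfact_prod[symmetric] qfact_prod_rev[symmetric] by simp
  finally have kr: "(\<Prod>l<a. - (qint (int a - int l) * vv powi (2 * int l - int a) / qint (int (Suc l)))) = (- 1) ^ a * vv powi (- int a)" .
  have s: "(- vv) ^ a * ((- 1) ^ a * vv powi (- int a)) = 1"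
    by (simp add: vv_powi_minus flip: power_mult_distrib mult.assoc)
  have c: "adp a x * sw.adp a y - sw.adp a y * adp a x =
      (h * ((- 1) ^ a * vv powi (- int a))) \<star> (K ^ a * L) + (- h * ((- 1) ^ a * vv powi (- int a))) \<star> (K' ^ a * L')"
    using dual_strings[OF x y xy L L', of a a]
    unfolding h_def[symmetric] mult.assoc kl kr by simp
  have "adp a x * ((- vv) ^ a \<star> sw.adp a y) - (- vv) ^ a \<star> sw.adp a y * adp a x =
      (- vv) ^ a \<star> (adp a x * sw.adp a y - sw.adp a y * adp a x)"
    by (simp add: qscale_diff_right)
  also have "\<dots> = (h * ((- vv) ^ a * ((- 1) ^ a * vv powi (- int a)))) \<star> (K ^ a * L)
      + (- h * ((- vv) ^ a * ((- 1) ^ a * vv powi (- int a)))) \<star> (K' ^ a * L')"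
    unfolding c qscale_add_right qscale_qscale by (simp only: mult_ac)
  also have "\<dots> = h \<star> (K ^ a * L - K' ^ a * L')"
    unfolding s by (simp add: qscale_diff_right)
  finally show ?thesis by (simp only: h_def)
qed

end


section \<open>The braid operator on realizations of the relations\<close>

text \<open>Families of elements of an algebra that satisfy the defining relations of the quantum double.
The braid operator is studied as an operation that turns one such family into another.\<close>

locale drinfeld_double =
  fixes c :: "'i \<Rightarrow> 'i \<Rightarrow> int" and E F K KI K' KI' :: "'i \<Rightarrow> 'a::qalg"
  assumes gcm: "symmetric_gcm c"
    and K_KI: "K i * KI i = 1" "KI i * K i = 1"
    and K'_KI': "K' i * KI' i = 1" "KI' i * K' i = 1"
    and K_K: "K i * K j = K j * K i"
    and K_K': "K i * K' j = K' j * K i"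
    and K'_K': "K' i * K' j = K' j * K' i"
    and E_F: "E i * F j = F j * E i + (if i = j then inverse (vv - inverse vv) \<star> (K i - K' i) else 0)"
    and K_E: "q_commutes (vv powi c i j) (K i) (E j)"
    and K_F: "q_commutes (vv powi (- c i j)) (K i) (F j)"
    and K'_E: "q_commutes (vv powi (- c i j)) (K' i) (E j)"
    and K'_F: "q_commutes (vv powi c i j) (K' i) (F j)"
    and serre_E: "i \<noteq> j \<Longrightarrow> qserre (nat (1 - c i j)) (E i) (E j) = 0"
    and serre_F: "i \<noteq> j \<Longrightarrow> qserre (nat (1 - c i j)) (F i) (F j) = 0"
begin

lemma c_diag [simp]: "c i i = 2"
  and c_sym: "c i j = c j i"
  and c_nonpos: "i \<noteq> j \<Longrightarrow> c i j \<le> 0"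
  using gcm by (simp_all add: symmetric_gcm_def)

text \<open>The Chevalley involution. It transports every statement about the \<open>E\<close>-half to the \<open>F\<close>-half.\<close>

lemma swapped: "drinfeld_double c F E K' KI' K KI"
proof
  fix i j
  show "F i * E j = E j * F i + (if i = j then inverse (vv - inverse vv) \<star> (K' i - K i) else 0)"
    using E_F[of j i] by (auto simp: qscale_diff_right)
qed (simp_all add: gcm K_KI K'_KI' K_K K_K' K'_K' K_E K_F K'_E K'_F serre_E serre_F)

sublocale rank1: qsl2 "E i" "F i" "K i" "KI i" "K' i" "KI' i" for i
  using K_E[of i i] K_F[of i i] K'_E[of i i] K'_F[of i i] E_F[of i i]
  by unfold_locales (simp_all add: q_commutes_def K_KI K'_KI' K_K')

sublocale sw: qsl2 "F i" "E i" "K' i" "KI' i" "K i" "KI i" for i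
  by (rule rank1.swapped)

definition string_length :: "'i \<Rightarrow> 'i \<Rightarrow> nat" where
  "string_length i j = nat (- c i j)"

lemma int_string_length: "j \<noteq> i \<Longrightarrow> int (string_length i j) = - c i j"
  using c_nonpos[of i j] by (auto simp: string_length_def)

text \<open>The images of the generators under the braid operator at \<open>i\<close>. For \<open>j \<noteq> i\<close> the image of a root
vector is the top of its string; \<open>TE_sum\<close> and \<open>TF_sum\<close> give the explicit sums.\<close>

definition TE :: "'i \<Rightarrow> 'i \<Rightarrow> 'a" where
  "TE i j = (if j = i then - (F i * KI' i) else rank1.adp i (string_length i j) (E j))"

definition TF :: "'i \<Rightarrow> 'i \<Rightarrow> 'a" where
  "TF i j = (if j = i then - (KI i * E i) else (- vv) ^ string_length i j \<star> sw.adp i (string_length i j) (F j))"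

definition TK :: "'i \<Rightarrow> 'i \<Rightarrow> 'a" where
  "TK i j = (if j = i then KI i else K i ^ string_length i j * K j)"

definition TKI :: "'i \<Rightarrow> 'i \<Rightarrow> 'a" where
  "TKI i j = (if j = i then K i else KI i ^ string_length i j * KI j)"

definition TK' :: "'i \<Rightarrow> 'i \<Rightarrow> 'a" where
  "TK' i j = (if j = i then KI' i else K' i ^ string_length i j * K' j)"

definition TKI' :: "'i \<Rightarrow> 'i \<Rightarrow> 'a" where
  "TKI' i j = (if j = i then K' i else KI' i ^ string_length i j * KI' j)"

lemma lowest_E: "j \<noteq> i \<Longrightarrow> rank1.lowest i (int (string_length i j)) (E j)"
  using K_E[of i j] K'_E[of i j] E_F[of j i]
  by (simp add: rank1.lowest_def int_string_length q_commutes_def)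

text \<open>The Serre relation is the end of the string of \<open>E\<^sub>j\<close>: its polynomial is the skew commutator
defining the divided power of exponent \<open>1 - c i j\<close>.\<close>

lemma adp_E_0:
  assumes "j \<noteq> i" shows "rank1.adp i (Suc (string_length i j)) (E j) = 0"
proof -
  have "nat (1 - c i j) = Suc (string_length i j)" using c_nonpos[of i j] assms by (auto simp: string_length_def)
  hence "qserre (Suc (string_length i j)) (E i) (E j) = 0" using serre_E[of i j] assms by auto
  hence "skew_comm vv (vv powi (- int (string_length i j))) (E i) (Suc (string_length i j)) (E j) = 0"
    using qserre_eq_skew_comm[of vv "string_length i j" "E i" "E j"]
      qscale_cancel[of "(- 1) ^ Suc (string_length i j)" "skew_comm vv (vv powi (- int (string_length i j))) (E i) (Suc (string_length i j)) (E j)" 0]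
    by simp
  thus ?thesis
    using rank1.adp_eq_skew_comm[OF rank1.lowest_twist[OF lowest_E[OF assms]], of "Suc (string_length i j)"] by simp
qed

lemma extremal_E: "j \<noteq> i \<Longrightarrow> rank1.extremal i (string_length i j) (E j) (TE i j)"
  using rank1.lowest_extremal[OF lowest_E adp_E_0] by (simp add: TE_def)

end

text \<open>The Chevalley involution exchanges the two families of images up to scalars
\<open>(-v)\<^bsup>-c i j\<^esup>\<close>. The relations are homogeneous, so these scalars are harmless.\<close>

lemma (in drinfeld_double) TF_swapped:
  "TF i j = (if j = i then vv powi (- 2) else (- vv) ^ string_length i j) \<star> drinfeld_double.TE c F E K' KI' KI i j"
proof -
  interpret sw': drinfeld_double c F E K' KI' K KI by (rule swapped)
  have "KI i * E i = vv powi (- 2) \<star> (E i * KI i)"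
    using inverse_q_commute[OF K_KI[of i] rank1.K_E[of i]] by (simp add: power_int_minus)
  thus ?thesis by (simp add: TF_def sw'.TE_def)
qed

context drinfeld_double
begin

interpretation sw': drinfeld_double c F E K' KI' K KI
  by (rule swapped)

lemma TK_swapped: "sw'.TK i j = TK' i j" "sw'.TK' i j = TK i j" "sw'.TKI i j = TKI' i j" "sw'.TKI' i j = TKI i j"
  by (simp_all add: sw'.TK_def TK_def sw'.TK'_def TK'_def sw'.TKI_def TKI_def sw'.TKI'_def TKI'_def)

lemma KI_commute: "KI i * K j = K j * KI i" "KI i * KI j = KI j * KI i" "KI i * K' j = K' j * KI i"
   "KI i * KI' j = KI' j * KI i" "K i * KI' j = KI' j * K i"
proof -
  have inv: "x * y = y * x \<Longrightarrow> x * x' = 1 \<Longrightarrow> x' * x = 1 \<Longrightarrow> x' * y = y * x'" for x y x' :: 'a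
  proof -
    assume a: "x * y = y * x" "x * x' = 1" "x' * x = 1"
    have "x' * y = x' * (y * x) * x'" by (simp add: mult.assoc a(2))
    also have "\<dots> = (x' * x) * y * x'" by (simp only: a(1)[symmetric] mult.assoc)
    finally show ?thesis by (simp add: a(3))
  qed
  show KK: "KI i * K j = K j * KI i" for i j using inv[OF K_K K_KI] .
  show KK': "KI i * K' j = K' j * KI i" for i j using inv[OF K_K' K_KI] .
  show "KI i * KI j = KI j * KI i" using inv[OF KK[of j i, symmetric] K_KI] .
  show "KI i * KI' j = KI' j * KI i" using inv[OF KK'[of i j, symmetric] K'_KI', symmetric] .
  show "K i * KI' j = KI' j * K i" using inv[OF K_K'[of i j, symmetric] K'_KI', symmetric] .
qed

text \<open>A torus element transforms the new root vector by the simple reflection of its weight.\<close>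

lemma TE_weight:
  assumes E: "\<And>k. q_commutes (vv powi n k) g (E k)" and F: "q_commutes (vv powi (- n i)) g (F i)"
    and g: "g * KI' i = KI' i * g"
  shows "q_commutes (vv powi (n k - c i k * n i)) g (TE i k)"
proof (cases "k = i")
  case True
  have "q_commutes (vv powi (- n i) * 1) g (F i * KI' i)"
    by (rule q_commutes_mult_right[OF F]) (simp add: q_commutes_def g)
  thus ?thesis by (simp add: True TE_def q_commutes_minus)
next
  case False
  have "q_commutes ((vv powi n i) ^ string_length i k * vv powi n k) g (TE i k)"
    using rank1.adp_eq_skew_comm[OF rank1.lowest_twist[OF lowest_E[OF False]], of "string_length i k"] False
    by (simp add: TE_def q_commutes_qscale q_commutes_skew_comm E)
  thus ?thesis
    unfolding vv_powi_mult vv_powi_add[symmetric] int_string_length[OF False] by (simp add: algebra_simps)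
qed

lemma TK_weight:
  "q_commutes (vv powi (c j k - c i j * c i k)) (TK i j) (E k)"
  "q_commutes (vv powi (- (c j k - c i j * c i k))) (TK i j) (F k)"
proof -
  have I: "q_commutes (vv powi (- c i k)) (KI i) (E k)" "q_commutes (vv powi c i k) (KI i) (F k)"
    using inverse_q_commute[OF K_KI K_E[of i k, unfolded q_commutes_def]]
      inverse_q_commute[OF K_KI K_F[of i k, unfolded q_commutes_def]]
    by (simp_all add: q_commutes_def flip: vv_powi_minus)
  show "q_commutes (vv powi (c j k - c i j * c i k)) (TK i j) (E k)"
    using I q_commutes_mult_left[OF q_commutes_power_left[OF K_E[of i k], of "string_length i j"] K_E[of j k]]
      vv_powi_mult[of "c i k" "string_length i j"]
    by (cases "j = i") (simp_all add: TK_def int_string_length algebra_simps vv_powi_add[symmetric])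
  show "q_commutes (vv powi (- (c j k - c i j * c i k))) (TK i j) (F k)"
    using I q_commutes_mult_left[OF q_commutes_power_left[OF K_F[of i k], of "string_length i j"] K_F[of j k]]
      vv_powi_mult[of "- c i k" "string_length i j"]
    by (cases "j = i") (simp_all add: TK_def int_string_length algebra_simps vv_powi_add[symmetric])
qed

lemma power_comm:
  fixes x y :: 'a shows "x * y = y * x \<Longrightarrow> x ^ n * y = y * x ^ n"
  by (rule power_commuting_commutes)

lemma mult_comm:
  fixes x y z :: 'a
  assumes "x * z = z * x" "y * z = z * y" shows "(x * y) * z = z * (x * y)"
proof -
  have "x * y * z = x * z * y" by (simp only: mult.assoc assms(2))
  also have "\<dots> = z * (x * y)" by (simp only: assms(1) mult.assoc)
  finally show ?thesis .
qed

lemma TK_commutes: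
  assumes "\<And>j. K j * z = z * K j" "\<And>j. KI j * z = z * KI j" shows "TK i j * z = z * TK i j"
  by (simp add: TK_def assms mult_comm[OF power_comm[OF assms(1)] assms(1)])

lemma TK'_commutes:
  assumes "\<And>j. K' j * z = z * K' j" "\<And>j. KI' j * z = z * KI' j" shows "TK' i j * z = z * TK' i j"
  by (simp add: TK'_def assms mult_comm[OF power_comm[OF assms(1)] assms(1)])

lemma KI'_commute: "KI' i * K' j = K' j * KI' i" "KI' i * KI' j = KI' j * KI' i"
  by (rule drinfeld_double.KI_commute(1)[OF swapped], rule drinfeld_double.KI_commute(2)[OF swapped])

lemma TK_TK:
  "TK i j * TK i k = TK i k * TK i j" "TK i j * TK' i k = TK' i k * TK i j" "TK' i j * TK' i k = TK' i k * TK' i j"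
proof -
  have 1: "TK i k * K j = K j * TK i k" "TK i k * KI j = KI j * TK i k" for k j
    by (rule TK_commutes; simp add: K_K KI_commute)+
  have 2: "TK' i k * K j = K j * TK' i k" "TK' i k * KI j = KI j * TK' i k" for k j
    by (rule TK'_commutes; simp add: K_K' KI_commute)+
  have 3: "TK' i k * K' j = K' j * TK' i k" "TK' i k * KI' j = KI' j * TK' i k" for k j
    by (rule TK'_commutes; simp add: K'_K' KI'_commute)+
  show "TK i j * TK i k = TK i k * TK i j" by (rule TK_commutes) (simp_all add: 1)
  show "TK i j * TK' i k = TK' i k * TK i j" by (rule TK_commutes) (simp_all add: 2)
  show "TK' i j * TK' i k = TK' i k * TK' i j" by (rule TK'_commutes) (simp_all add: 3)
qed

lemma TK_TKI: "TK i j * TKI i j = 1" "TKI i j * TK i j = 1"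
proof -
  have "(K i ^ n * K j) * (KI i ^ n * KI j) = 1" "(KI i ^ n * KI j) * (K i ^ n * K j) = 1" for n
  proof -
    have c: "K j * KI i ^ n = KI i ^ n * K j" "KI j * K i ^ n = K i ^ n * KI j"
      using power_comm[OF KI_commute(1)[of i j], of n] power_comm[OF KI_commute(1)[of j i, symmetric], of n] by simp_all
    have u: "K i ^ n * KI i ^ n = 1" "KI i ^ n * K i ^ n = 1"
      by (simp_all add: K_KI left_right_inverse_power)
    show "(K i ^ n * K j) * (KI i ^ n * KI j) = 1" "(KI i ^ n * KI j) * (K i ^ n * K j) = 1"
      by (simp_all add: mult.assoc nested_mult[OF c(1)] nested_mult[OF c(2)] nested_mult[OF u(1)]
          nested_mult[OF u(2)] u K_KI)
  qed
  thus "TK i j * TKI i j = 1" "TKI i j * TK i j = 1"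
    by (simp_all add: TK_def TKI_def K_KI)
qed

lemma TK_TE: "q_commutes (vv powi c j k) (TK i j) (TE i k)" "q_commutes (vv powi (- c j k)) (TK' i j) (TE i k)"
proof -
  have comm: "TK i j * KI' i = KI' i * TK i j"  "TK' i j * KI' i = KI' i * TK' i j"
    by (rule TK_commutes TK'_commutes; simp add: KI_commute KI'_commute)+
  have "q_commutes (vv powi (c j k - c i j * c i k - c i k * (c j i - c i j * c i i))) (TK i j) (TE i k)"
    by (rule TE_weight[where n = "\<lambda>k. c j k - c i j * c i k"]) (simp_all only: TK_weight comm)
  thus "q_commutes (vv powi c j k) (TK i j) (TE i k)"
    by (simp add: c_sym[of j i] algebra_simps)
  have "q_commutes (vv powi (- (c j k - c i j * c i k) - c i k * - (c j i - c i j * c i i))) (TK' i j) (TE i k)"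
    by (rule TE_weight[where n = "\<lambda>k. - (c j k - c i j * c i k)"])
      (simp_all only: drinfeld_double.TK_weight[OF swapped, unfolded TK_swapped] minus_minus comm)
  thus "q_commutes (vv powi (- c j k)) (TK' i j) (TE i k)"
    by (simp add: c_sym[of j i] algebra_simps)
qed

lemma TK_TF: "q_commutes (vv powi (- c j k)) (TK i j) (TF i k)" "q_commutes (vv powi c j k) (TK' i j) (TF i k)"
  unfolding TF_swapped using drinfeld_double.TK_TE[OF swapped, of j k i] unfolding TK_swapped by (simp_all add: q_commutes_qscale)

lemma TE_TF:
  "TE i j * TF i k = TF i k * TE i j + (if j = k then inverse (vv - inverse vv) \<star> (TK i j - TK' i j) else 0)"
proof -
  define h where "h = inverse (vv - inverse vv)"
  consider "j = i" "k = i" | "j = i" "k \<noteq> i" | "j \<noteq> i" "k = i" | "j \<noteq> i" "k \<noteq> i" by blast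
  thus ?thesis
  proof cases
    case 1
    have EF: "E i * F i = F i * E i + h \<star> (K i - K' i)" using E_F[of i i] by (simp add: h_def)
    have KF: "KI i * F i = vv powi 2 \<star> (F i * KI i)"
      using inverse_q_commute[OF K_KI, of i "F i" "vv powi (- 2)"] rank1.K_F[of i] by (simp add: vv_powi_minus)
    have KE: "KI' i * E i = vv powi 2 \<star> (E i * KI' i)"
      using inverse_q_commute[OF K'_KI', of i "E i" "vv powi (- 2)"] rank1.K'_E[of i] by (simp add: vv_powi_minus)
    have "KI i * E i * (F i * KI' i) = KI i * (E i * F i) * KI' i"
      by (simp only: mult.assoc)
    also have "\<dots> = KI i * F i * E i * KI' i + h \<star> (KI i * K i * KI' i - KI i * (K' i * KI' i))"
      unfolding EF by (simp add: algebra_simps)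
    also have "KI i * K i * KI' i - KI i * (K' i * KI' i) = KI' i - KI i"
      by (simp add: K_KI)
    also have "KI i * F i * E i * KI' i = F i * KI i * (vv powi 2 \<star> (E i * KI' i))"
      unfolding KF by (simp add: mult.assoc)
    also have "\<dots> = F i * KI' i * (KI i * E i)"
      unfolding KE[symmetric] by (simp add: mult.assoc nested_mult[OF KI_commute(4)])
    finally have "F i * KI' i * (KI i * E i) = KI i * E i * (F i * KI' i) + h \<star> (KI i - KI' i)"
      by (simp add: qscale_diff_right)
    thus ?thesis using 1 by (simp add: TE_def TF_def TK_def TK'_def h_def)
  next
    case 2
    have "F i * KI' i * sw.adp i (string_length i k) (F k) = sw.adp i (string_length i k) (F k) * (F i * KI' i)"
      using sw.top_commutes[OF sw'.lowest_E[of k i] sw'.adp_E_0[of k i]] 2 by blast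
    thus ?thesis using 2 by (simp add: TE_def TF_def)
  next
    case 3
    have "E i * KI i * TE i j = TE i j * (E i * KI i)"
      using rank1.top_commutes[OF lowest_E[of j i] adp_E_0[of j i]] 3 by (simp add: TE_def)
    moreover have "KI i * E i = vv powi (- 2) \<star> (E i * KI i)"
      using inverse_q_commute[OF K_KI, of i "E i" "vv powi 2"] rank1.K_E[of i] by (simp add: vv_powi_minus)
    ultimately show ?thesis using 3 by (simp add: TF_def)
  next
    case 4
    show ?thesis
    proof (cases "j = k")
      case False
      have "TE i j * sw.adp i (string_length i k) (F k) = sw.adp i (string_length i k) (F k) * TE i j"
        using rank1.commuting_strings[OF lowest_E[of j i] sw'.lowest_E[of k i]] E_F[of j k] 4 False
        by (simp add: TE_def)
      thus ?thesis using 4 False by (simp add: TF_def)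
    next
      case True
      define a where "a = string_length i j"
      have c: "c j i = - int a" using int_string_length[of j i] 4 c_sym[of j i] by (simp add: a_def)
      have "rank1.adp i a (E j) * ((- vv) ^ a \<star> sw.adp i a (F j)) - (- vv) ^ a \<star> sw.adp i a (F j) * rank1.adp i a (E j) =
        inverse (vv - inverse vv) \<star> (K i ^ a * K j - K' i ^ a * K' j)"
      proof (rule rank1.dual_strings_top)
        show "rank1.lowest i (int a) (E j)" "sw.lowest i (int a) (F j)"
          using lowest_E[of j i] sw'.lowest_E[of j i] 4 by (simp_all add: a_def)
        show "E j * F j = F j * E j + inverse (vv - inverse vv) \<star> (K j - K' j)"
          using E_F[of j j] by simp
      qed (use K_E[of j i] K_F[of j i] K'_E[of j i] in \<open>simp_all add: c K_K' K'_K'\<close>)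
      thus ?thesis using 4 True
        by (simp add: TE_def TF_def TK_def TK'_def a_def algebra_simps)
    qed
  qed
qed

lemma serre_TE:
  assumes "j \<noteq> k" shows "qserre (nat (1 - c j k)) (TE i j) (TE i k) = 0"
proof -
  consider "j = i" | "k = i" "j \<noteq> i" | "j \<noteq> i" "k \<noteq> i" by blast
  thus ?thesis
  proof cases
    case 1
    have n: "nat (1 - c j k) = Suc (string_length i k)" using c_nonpos[OF assms] 1 by (auto simp: string_length_def)
    have "TE i j = (- 1) \<star> rank1.lower i" "TE i k = 1 \<star> rank1.adp i (string_length i k) (E k)"
      using 1 assms by (simp_all add: TE_def rank1.lower_def)
    thus ?thesis unfolding n
      using rank1.qserre_lower_top[OF lowest_E[of k i]] 1 assms by (simp only: qserre_qscale) simp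
  next
    case 2
    have n: "nat (1 - c j k) = Suc (string_length i j)" using c_nonpos[OF assms] 2 c_sym[of j i] by (auto simp: string_length_def)
    have e: "TE i k = (- 1) \<star> rank1.lower i" "TE i j = 1 \<star> TE i j"
      using 2 by (simp_all add: TE_def rank1.lower_def)
    have "qserre (Suc (string_length i j)) (TE i j) (rank1.lower i) = 0"
      using rank1.qserre_top_lower[OF extremal_E[of j i]] serre_E[OF assms] 2 n by simp
    thus ?thesis unfolding n by (subst e(1), subst e(2)) (simp only: qserre_qscale qscale_0_right)
  next
    case 3
    thus ?thesis using rank1.extremal_qserre[OF extremal_E extremal_E serre_E] assms by blast
  qed
qed

lemma serre_TF:
  assumes "j \<noteq> k" shows "qserre (nat (1 - c j k)) (TF i j) (TF i k) = 0"
  using drinfeld_double.serre_TE[OF swapped assms, of i] unfolding TF_swapped qserre_qscale by simp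

lemma drinfeld_double_T: "drinfeld_double c (TE i) (TF i) (TK i) (TKI i) (TK' i) (TKI' i)"
  by unfold_locales
    (simp_all add: gcm TK_TKI drinfeld_double.TK_TKI[OF swapped, unfolded TK_swapped] TK_TK TE_TF TK_TE TK_TF serre_TE serre_TF)

lemma TE_sum:
  assumes "j \<noteq> i"
  shows "TE i j = (\<Sum>r\<le>string_length i j. ((- 1) ^ r * vv powi (- int r) / (qfact r * qfact (string_length i j - r))) \<star>
    (E i ^ (string_length i j - r) * E j * E i ^ r))"
proof -
  define a where "a = string_length i j"
  have v: "vv powi (- int a) * vv powi (int a - 1) = vv powi (- 1)"
    by (simp add: vv_powi_add[symmetric])
  have "TE i j = inverse (qfact a) \<star> skew_comm vv (vv powi (- int a)) (E i) a (E j)"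
    using rank1.adp_eq_skew_comm[OF rank1.lowest_twist[OF lowest_E[OF assms]]] assms
    by (simp add: TE_def a_def)
  also have "\<dots> = (\<Sum>r\<le>a. ((- 1) ^ r * vv powi (- int r) / (qfact r * qfact (a - r))) \<star>
    (E i ^ (a - r) * E j * E i ^ r))"
    unfolding skew_comm_expand[OF disjI1[OF refl]] v qscale_sum_right qscale_qscale vv_powi_mult
    by (intro sum.cong refl arg_cong2[where f = qscale]) (simp add: qbinom_qfact field_simps)
  finally show ?thesis by (simp only: a_def)
qed

text \<open>Together with \<open>TF_restore\<close> this identifies the inverse of the braid operator: the reversed
formula, applied to the images, returns the original root vector.\<close>

lemma TE_restore:
  assumes "j \<noteq> i"
  shows "(\<Sum>r\<le>string_length i j. ((- 1) ^ r * vv powi (- int r) / (qfact r * qfact (string_length i j - r))) \<star>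
    (TE i i ^ r * TE i j * TE i i ^ (string_length i j - r))) = E j"
proof -
  define a where "a = string_length i j"
  define s where "s r = (- 1) ^ r * vv powi (- int r) / (qfact r * qfact (a - r))" for r
  have f: "TE i i = (- 1) \<star> rank1.lower i" by (simp add: TE_def rank1.lower_def)
  have "(\<Sum>r\<le>a. s r \<star> (TE i i ^ r * TE i j * TE i i ^ (a - r))) =
      (\<Sum>r\<le>a. (- 1) ^ a \<star> s r \<star> (rank1.lower i ^ r * TE i j * rank1.lower i ^ (a - r)))"
  proof (intro sum.cong refl)
    fix r assume "r \<in> {..a}"
    hence "(- 1 :: Qv) ^ a = (- 1) ^ (a - r) * (- 1) ^ r" by (simp flip: power_add)
    thus "s r \<star> (TE i i ^ r * TE i j * TE i i ^ (a - r)) =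
        (- 1) ^ a \<star> s r \<star> (rank1.lower i ^ r * TE i j * rank1.lower i ^ (a - r))"
      unfolding f qscale_power by (simp add: mult_ac)
  qed
  also have "\<dots> = (- 1) ^ a \<star> (- 1) ^ a \<star> E j"
    unfolding qscale_sum_right[symmetric] s_def
    using rank1.skew_comm_lower_restore[OF lowest_E[OF assms]] assms by (simp add: TE_def a_def)
  finally show ?thesis by (simp add: a_def s_def flip: power_mult_distrib)
qed

lemma reverse_sum:
  fixes g :: "nat \<Rightarrow> 'a"
  shows "(\<Sum>r\<le>a. ((- 1) ^ r * vv powi (- int r) / (qfact r * qfact (a - r))) \<star> g (a - r)) =
    inverse ((- vv) ^ a) \<star> (\<Sum>r\<le>a. ((- 1) ^ r * vv ^ r / (qfact r * qfact (a - r))) \<star> g r)"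
proof -
  have "(\<Sum>r\<le>a. ((- 1) ^ r * vv powi (- int r) / (qfact r * qfact (a - r))) \<star> g (a - r)) =
    (\<Sum>r\<le>a. ((- 1) ^ (a - r) * vv powi (- int (a - r)) / (qfact (a - r) * qfact (a - (a - r)))) \<star> g (a - (a - r)))"
    by (rule sum.nat_diff_reindex[symmetric, of _ "Suc a", unfolded lessThan_Suc_atMost diff_Suc_Suc])
  also have "\<dots> = inverse ((- vv) ^ a) \<star> (\<Sum>r\<le>a. ((- 1) ^ r * vv ^ r / (qfact r * qfact (a - r))) \<star> g r)"
    unfolding qscale_sum_right
  proof (intro sum.cong refl)
    fix r assume "r \<in> {..a}"
    then obtain k where a: "a = r + k" by (metis atMost_iff le_Suc_ex)
    have "(- 1) ^ k * vv powi (- int k) = inverse ((- vv) ^ a) * ((- 1) ^ r * vv ^ r)"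
      unfolding a power_minus[of vv] power_add
      by (simp add: vv_powi_minus field_simps)
    thus "((- 1) ^ (a - r) * vv powi (- int (a - r)) / (qfact (a - r) * qfact (a - (a - r)))) \<star> g (a - (a - r)) =
        inverse ((- vv) ^ a) \<star> ((- 1) ^ r * vv ^ r / (qfact r * qfact (a - r))) \<star> g r"
      by (simp add: a mult.commute)
  qed
  finally show ?thesis .
qed

lemma TF_sum:
  assumes "j \<noteq> i"
  shows "TF i j = (\<Sum>r\<le>string_length i j. ((- 1) ^ r * vv ^ r / (qfact r * qfact (string_length i j - r))) \<star>
    (F i ^ r * F j * F i ^ (string_length i j - r)))"
proof -
  define a where "a = string_length i j"
  have "TF i j = (- vv) ^ a \<star> (\<Sum>r\<le>a. ((- 1) ^ r * vv powi (- int r) / (qfact r * qfact (a - r))) \<star>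
    (F i ^ (a - r) * F j * F i ^ (a - (a - r))))"
    unfolding TF_swapped drinfeld_double.TE_sum[OF swapped assms] a_def[symmetric] using assms
    by (simp add: a_def)
  also have "\<dots> = (\<Sum>r\<le>a. ((- 1) ^ r * vv ^ r / (qfact r * qfact (a - r))) \<star> (F i ^ r * F j * F i ^ (a - r)))"
    unfolding reverse_sum[of a "\<lambda>r. F i ^ r * F j * F i ^ (a - r)"] by simp
  finally show ?thesis by (simp only: a_def)
qed

lemma TF_restore:
  assumes "j \<noteq> i"
  shows "(\<Sum>r\<le>string_length i j. ((- 1) ^ r * vv ^ r / (qfact r * qfact (string_length i j - r))) \<star>
    (TF i i ^ (string_length i j - r) * TF i j * TF i i ^ r)) = F j"
proof -
  define a where "a = string_length i j"
  define u where "u = sw'.TE i i"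
  define w where "w = sw'.TE i j"
  have T: "TF i i = vv powi (- 2) \<star> u" "TF i j = (- vv) ^ a \<star> w"
    unfolding TF_swapped u_def w_def a_def using assms by simp_all
  have F: "F j = (\<Sum>r\<le>a. ((- 1) ^ r * vv powi (- int r) / (qfact r * qfact (a - r))) \<star> (u ^ (a - (a - r)) * w * u ^ (a - r)))"
    unfolding u_def w_def a_def drinfeld_double.TE_restore[OF swapped assms, symmetric]
    by (intro sum.cong refl) simp
  have G: "F j = inverse ((- vv) ^ a) \<star> (\<Sum>r\<le>a. ((- 1) ^ r * vv ^ r / (qfact r * qfact (a - r))) \<star> (u ^ (a - r) * w * u ^ r))"
    by (rule trans[OF F reverse_sum[of a "\<lambda>r. u ^ (a - r) * w * u ^ r"]])
  have "(\<Sum>r\<le>a. ((- 1) ^ r * vv ^ r / (qfact r * qfact (a - r))) \<star> (TF i i ^ (a - r) * TF i j * TF i i ^ r)) =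
     (\<Sum>r\<le>a. inverse ((- vv) ^ a) \<star> ((- 1) ^ r * vv ^ r / (qfact r * qfact (a - r))) \<star> (u ^ (a - r) * w * u ^ r))"
  proof (intro sum.cong refl)
    fix r assume "r \<in> {..a}"
    hence split: "(vv powi (- 2)) ^ (a - r) * (vv powi (- 2)) ^ r = (vv powi (- 2)) ^ a" by (simp flip: power_add)
    have "vv powi (- 2) = inverse (- vv) * inverse (- vv)"
      by (simp add: power_int_minus power2_eq_square)
    hence v2: "(vv powi (- 2)) ^ a = inverse ((- vv) ^ a) * inverse ((- vv) ^ a)"
      by (simp only: power_mult_distrib power_inverse)
    have "(vv powi (- 2)) ^ (a - r) * ((vv powi (- 2)) ^ r * (- vv) ^ a) = inverse ((- vv) ^ a)"
      unfolding mult.assoc[symmetric] split v2 by simp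
    moreover have "TF i i ^ (a - r) * TF i j * TF i i ^ r =
        ((vv powi (- 2)) ^ (a - r) * ((vv powi (- 2)) ^ r * (- vv) ^ a)) \<star> (u ^ (a - r) * w * u ^ r)"
      unfolding T qscale_power by (simp add: mult_ac)
    ultimately show "((- 1) ^ r * vv ^ r / (qfact r * qfact (a - r))) \<star> (TF i i ^ (a - r) * TF i j * TF i i ^ r) =
      inverse ((- vv) ^ a) \<star> ((- 1) ^ r * vv ^ r / (qfact r * qfact (a - r))) \<star> (u ^ (a - r) * w * u ^ r)"
      by (simp only: qscale_qscale mult.commute)
  qed
  also have "\<dots> = F j" unfolding G qscale_sum_right ..
  finally show ?thesis by (simp only: a_def)
qed

end


section \<open>Substitutions in the free algebra\<close>

lemma scal_0 [simp]: "scal 0 = 0"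
  by (simp add: scal_def)

lemma scal_1 [simp]: "scal 1 = 1"
  by (simp add: scal_def)

lemma scal_add: "scal (k + l) = scal k + scal l"
  by (simp add: scal_def single_add)

lemma scal_mult: "scal (k * l) = scal k * scal l"
  by (simp add: scal_def mult_single)

lemma scal_left_commute: "x * (scal k * y) = scal k * (x * (y :: 'g free_alg))"
  by (metis mult.assoc scal_commute)

text \<open>Every element of the free algebra is a combination of products of generators, which gives the
induction principle below.\<close>

lemma single_eq_prod_gen: "Poly_Mapping.single (FM gs) k = scal k * prod_list (map gen gs)"
proof -
  have "Poly_Mapping.single (FM gs) 1 = prod_list (map gen gs)"
  proof (induction gs)
    case (Cons g gs)
    have "Poly_Mapping.single (FM (g # gs)) 1 = gen g * Poly_Mapping.single (FM gs) (1 :: Qv)"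
      by (simp add: gen_def mult_single plus_fmonoid_def)
    thus ?case by (simp add: Cons)
  qed (simp flip: zero_fmonoid_def)
  thus ?thesis by (simp add: scal_def mult_single flip: \<open>_ = prod_list _\<close>)
qed

lemma free_alg_induct [case_names scal gen add mult]:
  assumes "\<And>k. P (scal k)" "\<And>g. P (gen g)"
    and "\<And>p q. P p \<Longrightarrow> P q \<Longrightarrow> P (p + q)" "\<And>p q. P p \<Longrightarrow> P q \<Longrightarrow> P (p * q)"
  shows "P (p :: 'g free_alg)"
proof -
  have gens: "P (prod_list (map gen gs))" for gs
    using assms(1)[of 1] by (induction gs) (simp_all add: assms)
  have single: "P (Poly_Mapping.single w k)" for w k
    by (cases w) (simp add: single_eq_prod_gen assms gens)
  have "P (\<Sum>w\<in>A. Poly_Mapping.single w (g w))" for A g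
    using assms(1)[of 0] by (induction A rule: infinite_finite_induct) (simp_all add: assms single)
  thus ?thesis by (subst free_alg_expand)
qed

definition lin :: "('g fmonoid \<Rightarrow> 'h free_alg) \<Rightarrow> 'g free_alg \<Rightarrow> 'h free_alg" where
  "lin G p = (\<Sum>w\<in>Poly_Mapping.keys p. scal (Poly_Mapping.lookup p w) * G w)"

lemma lin_superset:
  assumes "finite A" "Poly_Mapping.keys p \<subseteq> A"
  shows "lin G p = (\<Sum>w\<in>A. scal (Poly_Mapping.lookup p w) * G w)"
  unfolding lin_def by (rule sum.mono_neutral_left[OF assms]) (auto simp: in_keys_iff)

lemma lin_add: "lin G (p + q) = lin G p + lin G q"
proof -
  let ?A = "Poly_Mapping.keys p \<union> Poly_Mapping.keys q"
  have "lin G (p + q) = (\<Sum>w\<in>?A. scal (Poly_Mapping.lookup (p + q) w) * G w)"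
    by (rule lin_superset) (auto dest: keys_add[THEN subsetD])
  also have "\<dots> = lin G p + lin G q"
    by (simp add: lin_superset[of ?A] lookup_add scal_add distrib_right sum.distrib)
  finally show ?thesis .
qed

lemma lin_0 [simp]: "lin G 0 = 0"
  by (simp add: lin_def)

lemma lin_sum: "lin G (sum g A) = (\<Sum>x\<in>A. lin G (g x))"
  by (induction A rule: infinite_finite_induct) (simp_all add: lin_add)

lemma lin_single: "lin G (Poly_Mapping.single w k) = scal k * G w"
  by (cases "k = 0") (simp_all add: lin_def)

lemma lin_mult:
  assumes "\<And>u w. G (u + w) = G u * G w"
  shows "lin G (p * q) = lin G p * lin G q"
proof -
  obtain A f where p: "p = (\<Sum>w\<in>A. Poly_Mapping.single w (f w))"
    by (rule that[OF free_alg_expand])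
  obtain B g where q: "q = (\<Sum>u\<in>B. Poly_Mapping.single u (g u))"
    by (rule that[OF free_alg_expand])
  have "scal (f w * g u) * (G w * G u) = (scal (f w) * G w) * (scal (g u) * G u)" for w u
    by (simp only: scal_mult mult.assoc scal_left_commute[of "G w"])
  thus ?thesis
    by (simp add: p q sum_product lin_sum lin_single mult_single assms)
qed

lemma lin_mult_rev:
  assumes "\<And>u w. G (u + w) = G w * G u"
  shows "lin G (p * q) = lin G q * lin G p"
proof -
  obtain A f where p: "p = (\<Sum>w\<in>A. Poly_Mapping.single w (f w))"
    by (rule that[OF free_alg_expand])
  obtain B g where q: "q = (\<Sum>u\<in>B. Poly_Mapping.single u (g u))"
    by (rule that[OF free_alg_expand])
  have "scal (f w * g u) * (G u * G w) = (scal (g u) * G u) * (scal (f w) * G w)" for w u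
    by (simp only: mult.commute[of "f w"] scal_mult mult.assoc scal_left_commute[of "G u"])
  moreover have "lin G q * lin G p = (\<Sum>w\<in>A. \<Sum>u\<in>B. (scal (g u) * G u) * (scal (f w) * G w))"
    unfolding p q lin_sum lin_single sum_product by (rule sum.swap)
  ultimately show ?thesis
    by (simp add: p q sum_product lin_sum lin_single mult_single assms)
qed

definition subst :: "('g \<Rightarrow> 'h free_alg) \<Rightarrow> 'g free_alg \<Rightarrow> 'h free_alg" where
  "subst s = lin (\<lambda>w. prod_list (map s (letters w)))"

lemma subst_mult: "subst s (p * q) = subst s p * subst s q"
  unfolding subst_def by (rule lin_mult) (simp add: plus_fmonoid_def)

lemma subst_add: "subst s (p + q) = subst s p + subst s q"
  by (simp add: subst_def lin_add)

lemma subst_gen [simp]: "subst s (gen g) = s g"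
  by (simp add: subst_def gen_def lin_single)

lemma subst_scal [simp]: "subst s (scal k) = scal k"
  by (simp add: subst_def lin_single zero_fmonoid_def scal_def[of k])

lemma subst_1 [simp]: "subst s 1 = 1"
  using subst_scal[of s 1] by simp

lemma subst_0 [simp]: "subst s 0 = 0"
  by (simp add: subst_def)

lemma subst_uminus: "subst s (- p) = - subst s p"
  using subst_add[of s p "- p"] by (simp add: eq_neg_iff_add_eq_0 add.commute)

lemma subst_diff: "subst s (p - q) = subst s p - subst s q"
  using subst_add[of s p "- q"] by (simp add: subst_uminus)

lemma subst_sum: "subst s (sum g A) = (\<Sum>x\<in>A. subst s (g x))"
  by (simp add: subst_def lin_sum)

lemma subst_power: "subst s (p ^ n) = subst s p ^ n"
  by (induction n) (simp_all add: subst_mult)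

text \<open>Reversing products forces the exchange of the two kinds of torus generators, since it changes the
sign of the commutator of \<open>E\<^sub>i\<close> and \<open>F\<^sub>i\<close>.\<close>

definition anti :: "'i ugen free_alg \<Rightarrow> 'i ugen free_alg" where
  "anti = lin (\<lambda>w. prod_list (rev (map (gen \<circ> bar_gen) (letters w))))"

lemma anti_mult: "anti (p * q) = anti q * anti p"
  unfolding anti_def by (rule lin_mult_rev) (simp add: plus_fmonoid_def)

lemma anti_add: "anti (p + q) = anti p + anti q"
  by (simp add: anti_def lin_add)

lemma anti_gen [simp]: "anti (gen g) = gen (bar_gen g)"
  by (simp add: anti_def gen_def lin_single)

lemma anti_scal [simp]: "anti (scal k) = scal k"
  by (simp add: anti_def lin_single zero_fmonoid_def scal_def[of k])

lemma anti_1 [simp]: "anti 1 = 1"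
  using anti_scal[of 1] by simp

lemma anti_0 [simp]: "anti 0 = 0"
  by (simp add: anti_def)

lemma anti_uminus: "anti (- p) = - anti p"
  using anti_add[of p "- p"] by (simp add: eq_neg_iff_add_eq_0 add.commute)

lemma anti_diff: "anti (p - q) = anti p - anti q"
  using anti_add[of p "- q"] by (simp add: anti_uminus)

lemma anti_sum: "anti (sum g A) = (\<Sum>x\<in>A. anti (g x))"
  by (simp add: anti_def lin_sum)

lemma anti_power: "anti (p ^ n) = anti p ^ n"
  by (induction n) (simp_all add: anti_mult power_commutes)

lemma anti_anti [simp]: "anti (anti p) = p"
  by (induction p rule: free_alg_induct) (simp_all add: anti_add anti_mult)

text \<open>The relations generate the ideal, so it is contained in every two-sided ideal containing them.\<close>

lemma uideal_subset:
  assumes "urel c \<subseteq> Z" "0 \<in> Z" "\<And>x y. x \<in> Z \<Longrightarrow> y \<in> Z \<Longrightarrow> x + y \<in> Z"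
    and "\<And>x y. x \<in> Z \<Longrightarrow> y * x \<in> Z" "\<And>x y. x \<in> Z \<Longrightarrow> x * y \<in> Z"
  shows "uideal c \<subseteq> Z"
proof -
  have "- x \<in> Z" if "x \<in> Z" for x using assms(4)[OF that, of "- 1"] by simp
  hence uminus: "a_inv free_ring x \<in> Z" if "x \<in> Z" for x
    using that by (simp only: a_inv_free_ring)
  have "ideal Z free_ring"
  proof (rule idealI[OF ring_free_ring])
    show "subgroup Z (add_monoid free_ring)"
    proof
      show "inv\<^bsub>add_monoid free_ring\<^esub> x \<in> Z" if "x \<in> Z" for x
        using uminus[OF that] by (simp only: a_inv_def)
    qed (use assms in auto)
  qed (use assms in auto)
  thus ?thesis
    using ring.genideal_minimal[OF ring_free_ring] assms(1) unfolding uideal_def by blast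
qed

lemma anti_serre:
  assumes "symmetric_gcm c" "i \<noteq> j" "\<And>i. bar_gen (X i) = X i"
  shows "anti (serre c X i j) = scal ((- 1) ^ nat (1 - c i j)) * serre c X i j"
proof -
  define n where "n = nat (1 - c i j)"
  have "c i j \<le> 0" using assms(1,2) by (simp add: symmetric_gcm_def)
  hence n: "1 - c i j = int n" by (simp add: n_def)
  let ?s = "\<lambda>r. scal ((- 1) ^ r * qbinom (int n) r) * (gen (X i) ^ r * gen (X j) * gen (X i) ^ (n - r))"
  have "anti (serre c X i j) = (\<Sum>r\<le>n. scal ((- 1) ^ r * qbinom (int n) r)
      * (gen (X i) ^ (n - r) * gen (X j) * gen (X i) ^ r))"
    unfolding serre_def n nat_int anti_sum
    by (intro sum.cong refl) (simp add: anti_mult anti_power assms(3) mult.assoc flip: scal_commute)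
  also have "\<dots> = (\<Sum>r\<le>n. scal ((- 1) ^ (n - r) * qbinom (int n) (n - r))
      * (gen (X i) ^ (n - (n - r)) * gen (X j) * gen (X i) ^ (n - r)))"
    by (rule sum.nat_diff_reindex[symmetric, of _ "Suc n", unfolded lessThan_Suc_atMost diff_Suc_Suc])
  also have "\<dots> = (\<Sum>r\<le>n. scal ((- 1) ^ n) * ?s r)"
  proof (intro sum.cong refl)
    fix r assume "r \<in> {..n}"
    hence r: "r \<le> n" by simp
    hence "(- 1 :: Qv) ^ n = (- 1) ^ (n - r) * (- 1) ^ r" by (simp flip: power_add)
    hence "(- 1 :: Qv) ^ (n - r) = (- 1) ^ n * (- 1) ^ r" by (simp add: mult.assoc flip: power_mult_distrib)
    thus "scal ((- 1) ^ (n - r) * qbinom (int n) (n - r))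
      * (gen (X i) ^ (n - (n - r)) * gen (X j) * gen (X i) ^ (n - r)) = scal ((- 1) ^ n) * ?s r"
      using r by (simp add: qbinom_sym scal_mult mult.assoc)
  qed
  finally show ?thesis by (simp only: serre_def n nat_int sum_distrib_left)
qed

lemma anti_commutation:
  assumes "k \<noteq> 0"
  shows "anti (gen g * gen h - scal k * (gen h * gen g)) =
    - scal k * (gen (bar_gen g) * gen (bar_gen h) - scal (inverse k) * (gen (bar_gen h) * gen (bar_gen g)))"
proof -
  have "scal k * (scal (inverse k) * z) = z" for z :: "'a ugen free_alg"
    using assms by (simp flip: mult.assoc scal_mult)
  moreover have "gen (bar_gen g) * gen (bar_gen h) * scal k = scal k * (gen (bar_gen g) * gen (bar_gen h))"
    by (rule scal_commute[symmetric])
  ultimately show ?thesis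
    by (simp add: anti_diff anti_mult right_diff_distrib)
qed

lemma anti_urel:
  assumes "symmetric_gcm c" "x \<in> urel c" shows "anti x \<in> uideal c"
  using assms(2)
proof cases
  case (E_F i j)
  let ?k = "1 / (vv - inverse vv)"
  have "anti (scal ?k * (gen (Kt i) - gen (Kp i))) = - (scal ?k * (gen (Kt i) - gen (Kp i)))"
    unfolding anti_mult anti_diff anti_scal anti_gen bar_gen.simps scal_commute[of ?k]
    by (simp only: left_diff_distrib minus_diff_eq)
  hence "anti (if i = j then scal ?k * (gen (Kt i) - gen (Kp i)) else 0) =
      - (if i = j then scal ?k * (gen (Kt i) - gen (Kp i)) else 0)" by (simp only: split: if_splits) simp
  moreover have "anti (gen (Eg i) * gen (Fg j) - gen (Fg j) * gen (Eg i)) =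
      - (gen (Eg i) * gen (Fg j) - gen (Fg j) * gen (Eg i))"
    by (simp add: anti_diff anti_mult)
  ultimately have "anti x = - x"
    unfolding E_F anti_diff[of _ "if i = j then _ else _"] by (simp only: minus_diff_minus)
  thus ?thesis using assms(2) urel_subset_uideal uideal_closed(3) by auto
next
  case (Kt_E i j)
  have inv: "inverse (vv powi c i j) = vv powi (- c i j)" by (simp add: vv_powi_minus)
  show ?thesis
    unfolding Kt_E anti_commutation[OF vv_powi_nonzero] bar_gen.simps inv
    by (rule uideal_closed(4)[OF subsetD[OF urel_subset_uideal urel.Kp_E]])
next
  case (Kt_F i j)
  have inv: "inverse (vv powi (- c i j)) = vv powi c i j" by (simp add: vv_powi_minus)
  show ?thesis
    unfolding Kt_F anti_commutation[OF vv_powi_nonzero] bar_gen.simps inv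
    by (rule uideal_closed(4)[OF subsetD[OF urel_subset_uideal urel.Kp_F]])
next
  case (Kp_E i j)
  have inv: "inverse (vv powi (- c i j)) = vv powi c i j" by (simp add: vv_powi_minus)
  show ?thesis
    unfolding Kp_E anti_commutation[OF vv_powi_nonzero] bar_gen.simps inv
    by (rule uideal_closed(4)[OF subsetD[OF urel_subset_uideal urel.Kt_E]])
next
  case (Kp_F i j)
  have inv: "inverse (vv powi c i j) = vv powi (- c i j)" by (simp add: vv_powi_minus)
  show ?thesis
    unfolding Kp_F anti_commutation[OF vv_powi_nonzero] bar_gen.simps inv
    by (rule uideal_closed(4)[OF subsetD[OF urel_subset_uideal urel.Kt_F]])
next
  case (Serre_E i j)
  have "anti x = scal ((- 1) ^ nat (1 - c i j)) * serre c Eg i j"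
    unfolding Serre_E(1) by (rule anti_serre[OF assms(1) Serre_E(2)]) simp
  thus ?thesis
    using uideal_closed(4)[OF subsetD[OF urel_subset_uideal urel.Serre_E[OF Serre_E(2), of c]]]
    by (simp only:)
next
  case (Serre_F i j)
  have "anti x = scal ((- 1) ^ nat (1 - c i j)) * serre c Fg i j"
    unfolding Serre_F(1) by (rule anti_serre[OF assms(1) Serre_F(2)]) simp
  thus ?thesis
    using uideal_closed(4)[OF subsetD[OF urel_subset_uideal urel.Serre_F[OF Serre_F(2), of c]]]
    by (simp only:)
next
  case (Kt_inv_r i)
  show ?thesis unfolding Kt_inv_r using urel.Kp_inv_l[of i c] urel_subset_uideal[of c]
    by (simp add: anti_diff anti_mult subset_iff)
next
  case (Kt_inv_l i)
  show ?thesis unfolding Kt_inv_l using urel.Kp_inv_r[of i c] urel_subset_uideal[of c]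
    by (simp add: anti_diff anti_mult subset_iff)
next
  case (Kp_inv_r i)
  show ?thesis unfolding Kp_inv_r using urel.Kt_inv_l[of i c] urel_subset_uideal[of c]
    by (simp add: anti_diff anti_mult subset_iff)
next
  case (Kp_inv_l i)
  show ?thesis unfolding Kp_inv_l using urel.Kt_inv_r[of i c] urel_subset_uideal[of c]
    by (simp add: anti_diff anti_mult subset_iff)
next
  case (Kt_Kt i j)
  show ?thesis unfolding Kt_Kt using urel.Kp_Kp[of j i c] urel_subset_uideal[of c]
    by (simp add: anti_diff anti_mult subset_iff)
next
  case (Kt_Kp i j)
  show ?thesis unfolding Kt_Kp using urel.Kt_Kp[of j i c] urel_subset_uideal[of c]
    by (simp add: anti_diff anti_mult subset_iff)
next
  case (Kp_Kp i j)
  show ?thesis unfolding Kp_Kp using urel.Kt_Kt[of j i c] urel_subset_uideal[of c]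
    by (simp add: anti_diff anti_mult subset_iff)
qed

lemma anti_uideal:
  assumes "symmetric_gcm c" "x \<in> uideal c" shows "anti x \<in> uideal c"
proof -
  have "uideal c \<subseteq> {x. anti x \<in> uideal c}"
    by (rule uideal_subset) (auto simp: anti_urel[OF assms(1)] anti_add anti_mult uideal_closed)
  thus ?thesis using assms(2) by auto
qed


section \<open>An algebra containing all the quantum doubles\<close>

text \<open>A character of the free algebra that kills the relations for every Cartan matrix.\<close>

definition counit :: "'i ugen free_alg \<Rightarrow> 'i ugen free_alg" where
  "counit = subst (\<lambda>g. case g of Eg i \<Rightarrow> 0 | Fg i \<Rightarrow> 0 | _ \<Rightarrow> 1)"

lemma counit_simps:
  "counit (p + q) = counit p + counit q" "counit (p - q) = counit p - counit q"
  "counit (p * q) = counit p * counit q" "counit (scal k) = scal k" "counit 0 = 0" "counit 1 = 1"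
  "counit (- p) = - counit p"
  by (simp_all add: counit_def subst_add subst_diff subst_mult subst_uminus)

lemma counit_uideal:
  assumes "x \<in> uideal c" shows "counit x = 0"
proof -
  have "counit x = 0" if "x \<in> urel c" for x
    using that
  proof cases
    case (E_F i j)
    thus ?thesis by (cases "i = j") (simp_all add: counit_def subst_diff subst_mult)
  qed (simp_all add: counit_def subst_diff subst_mult serre_def subst_sum subst_power)
  hence "uideal c \<subseteq> {x. counit x = 0}"
    by (intro uideal_subset) (auto simp: counit_simps)
  thus ?thesis using assms by auto
qed

text \<open>A type cannot depend on the matrix \<open>c\<close>, but the product of the quantum doubles over all
integer matrices is a single type. The double of a given \<open>c\<close> embeds into it as a unital
algebra: its own component is the identity, and the others are the character above.\<close>

definition univ_rel :: "(('i \<Rightarrow> 'i \<Rightarrow> int) \<Rightarrow> 'i ugen free_alg) \<Rightarrow> (('i \<Rightarrow> 'i \<Rightarrow> int) \<Rightarrow> 'i ugen free_alg) \<Rightarrow> bool" where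
  "univ_rel f g \<longleftrightarrow> (\<forall>c. f c - g c \<in> uideal c)"

lemma equivp_univ_rel: "equivp (univ_rel :: (('i \<Rightarrow> 'i \<Rightarrow> int) \<Rightarrow> 'i ugen free_alg) \<Rightarrow> _)"
proof (rule equivpI)
  show "reflp (univ_rel :: (('i \<Rightarrow> 'i \<Rightarrow> int) \<Rightarrow> 'i ugen free_alg) \<Rightarrow> _)" by (simp add: reflp_def univ_rel_def uideal_closed)
  show "symp (univ_rel :: (('i \<Rightarrow> 'i \<Rightarrow> int) \<Rightarrow> 'i ugen free_alg) \<Rightarrow> _)"
    unfolding symp_def univ_rel_def using uideal_closed(3) by (metis minus_diff_eq)
  show "transp (univ_rel :: (('i \<Rightarrow> 'i \<Rightarrow> int) \<Rightarrow> 'i ugen free_alg) \<Rightarrow> _)"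
  proof (unfold transp_def univ_rel_def, intro allI impI)
    fix f g h :: "('i \<Rightarrow> 'i \<Rightarrow> int) \<Rightarrow> 'i ugen free_alg" and c
    assume "\<forall>c. f c - g c \<in> uideal c" "\<forall>c. g c - h c \<in> uideal c"
    hence "(f c - g c) + (g c - h c) \<in> uideal c" by (blast intro: uideal_closed(2))
    thus "f c - h c \<in> uideal c" by simp
  qed
qed

quotient_type 'i univ_alg = "('i \<Rightarrow> 'i \<Rightarrow> int) \<Rightarrow> 'i ugen free_alg" / univ_rel
  by (rule equivp_univ_rel)

lemma univ_rel_eqI: "(\<And>c. f c = g c) \<Longrightarrow> univ_rel f g"
  by (simp add: univ_rel_def uideal_closed)

instantiation univ_alg :: (type) qalg
begin

lift_definition zero_univ_alg :: "'a univ_alg" is "\<lambda>_. 0" .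

lift_definition one_univ_alg :: "'a univ_alg" is "\<lambda>_. 1" .

lift_definition plus_univ_alg :: "'a univ_alg \<Rightarrow> 'a univ_alg \<Rightarrow> 'a univ_alg" is "\<lambda>f g c. f c + g c"
proof -
  fix f f' g g' :: "('a \<Rightarrow> 'a \<Rightarrow> int) \<Rightarrow> 'a ugen free_alg"
  assume rel: "univ_rel f f'" "univ_rel g g'"
  have eq: "f c + g c - (f' c + g' c) = (f c - f' c) + (g c - g' c)" for c
    by simp
  show "univ_rel (\<lambda>c. f c + g c) (\<lambda>c. f' c + g' c)"
    using rel unfolding univ_rel_def eq by (simp add: uideal_closed)
qed

lift_definition minus_univ_alg :: "'a univ_alg \<Rightarrow> 'a univ_alg \<Rightarrow> 'a univ_alg" is "\<lambda>f g c. f c - g c"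
proof -
  fix f f' g g' :: "('a \<Rightarrow> 'a \<Rightarrow> int) \<Rightarrow> 'a ugen free_alg"
  assume rel: "univ_rel f f'" "univ_rel g g'"
  have eq: "f c - g c - (f' c - g' c) = (f c - f' c) + - (g c - g' c)" for c
    by simp
  show "univ_rel (\<lambda>c. f c - g c) (\<lambda>c. f' c - g' c)"
    using rel unfolding univ_rel_def eq by (intro allI uideal_closed(2,3)) simp_all
qed

lift_definition uminus_univ_alg :: "'a univ_alg \<Rightarrow> 'a univ_alg" is "\<lambda>f c. - f c"
proof -
  fix f f' :: "('a \<Rightarrow> 'a \<Rightarrow> int) \<Rightarrow> 'a ugen free_alg"
  assume rel: "univ_rel f f'"
  have eq: "- f c - - f' c = - (f c - f' c)" for c
    by simp
  show "univ_rel (\<lambda>c. - f c) (\<lambda>c. - f' c)"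
    using rel unfolding univ_rel_def eq by (intro allI uideal_closed(3)) simp
qed

lift_definition times_univ_alg :: "'a univ_alg \<Rightarrow> 'a univ_alg \<Rightarrow> 'a univ_alg" is "\<lambda>f g c. f c * g c"
proof -
  fix f f' g g' :: "('a \<Rightarrow> 'a \<Rightarrow> int) \<Rightarrow> 'a ugen free_alg"
  assume rel: "univ_rel f f'" "univ_rel g g'"
  have eq: "f c * g c - f' c * g' c = f c * (g c - g' c) + (f c - f' c) * g' c" for c
    by (simp add: algebra_simps)
  show "univ_rel (\<lambda>c. f c * g c) (\<lambda>c. f' c * g' c)"
    using rel unfolding univ_rel_def eq by (simp add: uideal_closed)
qed

lift_definition qscale_univ_alg :: "Qv \<Rightarrow> 'a univ_alg \<Rightarrow> 'a univ_alg" is "\<lambda>k f c. scal k * f c"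
proof -
  fix f f' :: "('a \<Rightarrow> 'a \<Rightarrow> int) \<Rightarrow> 'a ugen free_alg" and k
  assume rel: "univ_rel f f'"
  have eq: "scal k * f c - scal k * f' c = scal k * (f c - f' c)" for c
    by (simp add: right_diff_distrib)
  show "univ_rel (\<lambda>c. scal k * f c) (\<lambda>c. scal k * f' c)"
    using rel unfolding univ_rel_def eq by (simp add: uideal_closed)
qed

instance
proof
  fix x y z :: "'a univ_alg" and k l :: Qv
  show "x + y + z = x + (y + z)" by transfer (rule univ_rel_eqI, simp add: algebra_simps)
  show "x + y = y + x" by transfer (rule univ_rel_eqI, simp add: algebra_simps)
  show "0 + x = x" by transfer (rule univ_rel_eqI, simp)
  show "- x + x = 0" by transfer (rule univ_rel_eqI, simp)
  show "x - y = x + - y" by transfer (rule univ_rel_eqI, simp)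
  show "x * y * z = x * (y * z)" by transfer (rule univ_rel_eqI, simp add: algebra_simps)
  show "1 * x = x" by transfer (rule univ_rel_eqI, simp)
  show "x * 1 = x" by transfer (rule univ_rel_eqI, simp)
  show "(x + y) * z = x * z + y * z" by transfer (rule univ_rel_eqI, simp add: algebra_simps)
  show "x * (y + z) = x * y + x * z" by transfer (rule univ_rel_eqI, simp add: algebra_simps)
  show "(0 :: 'a univ_alg) \<noteq> 1"
  proof (transfer, rule notI)
    assume "univ_rel (\<lambda>_. 0) (\<lambda>_. 1 :: 'a ugen free_alg)"
    hence "counit (0 - 1 :: 'a ugen free_alg) = 0" unfolding univ_rel_def using counit_uideal by blast
    thus False by (simp add: counit_simps)
  qed
  show "k \<star> (x + y) = k \<star> x + k \<star> y" by transfer (rule univ_rel_eqI, simp add: algebra_simps)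
  show "(k + l) \<star> x = k \<star> x + l \<star> x" by transfer (rule univ_rel_eqI, simp add: scal_add algebra_simps)
  show "k \<star> l \<star> x = (k * l) \<star> x" by transfer (rule univ_rel_eqI, simp add: scal_mult mult.assoc)
  show "1 \<star> x = x" by transfer (rule univ_rel_eqI, simp)
  show "(k \<star> x) * y = k \<star> (x * y)" by transfer (rule univ_rel_eqI, simp add: mult.assoc)
  show "x * (k \<star> y) = k \<star> (x * y)" by transfer (rule univ_rel_eqI, simp add: scal_left_commute)
qed

end

lift_definition proj :: "('i \<Rightarrow> 'i \<Rightarrow> int) \<Rightarrow> 'i ugen free_alg \<Rightarrow> 'i univ_alg" is
  "\<lambda>c p d. if d = c then p else counit p" .

lemma proj_add: "proj c (p + q) = proj c p + proj c q"
  by transfer (rule univ_rel_eqI, simp add: counit_simps)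

lemma proj_mult: "proj c (p * q) = proj c p * proj c q"
  by transfer (rule univ_rel_eqI, simp add: counit_simps)

lemma proj_scal_mult: "proj c (scal k * p) = k \<star> proj c p"
  by transfer (rule univ_rel_eqI, simp add: counit_simps)

lemma proj_1 [simp]: "proj c 1 = 1"
  by transfer (rule univ_rel_eqI, simp add: counit_simps)

text \<open>The component at \<open>c\<close> detects the ideal; the other components are determined by the character,
which vanishes on it.\<close>

lemma proj_eq_iff: "proj c p = proj c q \<longleftrightarrow> p - q \<in> uideal c"
proof (unfold proj.abs_eq univ_alg.abs_eq_iff univ_rel_def, intro iffI allI)
  fix c d :: "'a \<Rightarrow> 'a \<Rightarrow> int" and p q :: "'a ugen free_alg"
  assume "p - q \<in> uideal c"
  thus "(if d = c then p else counit p) - (if d = c then q else counit q) \<in> uideal d"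
    using counit_uideal[of "p - q" c] by (simp add: counit_simps uideal_closed)
next
  fix c :: "'a \<Rightarrow> 'a \<Rightarrow> int" and p q :: "'a ugen free_alg"
  assume "\<forall>d. (if d = c then p else counit p) - (if d = c then q else counit q) \<in> uideal d"
  from this[THEN spec, of c] show "p - q \<in> uideal c" by simp
qed


section \<open>The braid operator on the quantum double\<close>

locale alg_hom =
  fixes \<Psi> :: "'g free_alg \<Rightarrow> 'b::qalg"
  assumes hom_add: "\<Psi> (p + q) = \<Psi> p + \<Psi> q"
    and hom_mult: "\<Psi> (p * q) = \<Psi> p * \<Psi> q"
    and hom_scal: "\<Psi> (scal k) = k \<star> 1"
begin

lemma hom_1: "\<Psi> 1 = 1"
  using hom_scal[of 1] by simp

lemma hom_0: "\<Psi> 0 = 0"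
  using hom_scal[of 0] by simp

lemma hom_uminus: "\<Psi> (- p) = - \<Psi> p"
  using hom_add[of p "- p"] by (simp add: hom_0 eq_neg_iff_add_eq_0 add.commute)

lemma hom_diff: "\<Psi> (p - q) = \<Psi> p - \<Psi> q"
  using hom_add[of p "- q"] by (simp add: hom_uminus)

lemma hom_sum: "\<Psi> (sum g A) = (\<Sum>x\<in>A. \<Psi> (g x))"
  by (induction A rule: infinite_finite_induct) (simp_all add: hom_add hom_0)

lemma hom_power: "\<Psi> (p ^ n) = \<Psi> p ^ n"
  by (induction n) (simp_all add: hom_mult hom_1)

lemmas hom_simps = hom_add hom_mult hom_scal hom_1 hom_0 hom_uminus hom_diff hom_sum hom_power

lemma hom_scal_right: "\<Psi> (p * scal k) = k \<star> \<Psi> p"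
  by (simp add: hom_mult hom_scal)

end

lemma (in alg_hom) hom_serre:
  assumes "m \<le> 0"
  shows "\<Psi> (\<Sum>r\<le>nat (1 - m). scal ((- 1) ^ r * qbinom (1 - m) r)
        * (gen x ^ r * gen y * gen x ^ (nat (1 - m) - r))) =
    qserre (nat (1 - m)) (\<Psi> (gen x)) (\<Psi> (gen y))"
proof -
  have "int (nat (1 - m)) = 1 - m" using assms by simp
  thus ?thesis by (simp only: qserre_def hom_simps qscale_mult_left mult_1_left)
qed

text \<open>The universal property of the quotient by the relations.\<close>

lemma alg_hom_kills_urel:
  fixes \<Psi> :: "'i ugen free_alg \<Rightarrow> 'b::qalg"
  assumes "alg_hom \<Psi>"
    and "drinfeld_double c (\<lambda>i. \<Psi> (gen (Eg i))) (\<lambda>i. \<Psi> (gen (Fg i))) (\<lambda>i. \<Psi> (gen (Kt i)))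
      (\<lambda>i. \<Psi> (gen (KtI i))) (\<lambda>i. \<Psi> (gen (Kp i))) (\<lambda>i. \<Psi> (gen (KpI i)))"
    and "x \<in> uideal c"
  shows "\<Psi> x = 0"
proof -
  interpret alg_hom \<Psi> by fact
  interpret D: drinfeld_double c "\<lambda>i. \<Psi> (gen (Eg i))" "\<lambda>i. \<Psi> (gen (Fg i))" "\<lambda>i. \<Psi> (gen (Kt i))"
      "\<lambda>i. \<Psi> (gen (KtI i))" "\<lambda>i. \<Psi> (gen (Kp i))" "\<lambda>i. \<Psi> (gen (KpI i))" by fact
  have "\<Psi> x = 0" if "x \<in> urel c" for x
    using that
  proof cases
    case (E_F i j)
    show ?thesis unfolding E_F
      using D.E_F[of i j] by (cases "i = j") (simp_all add: hom_simps inverse_eq_divide)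
  next
    case (Serre_E i j)
    show ?thesis
      unfolding Serre_E(1) serre_def hom_serre[OF D.c_nonpos[OF Serre_E(2)]] by (rule D.serre_E[OF Serre_E(2)])
  next
    case (Serre_F i j)
    show ?thesis
      unfolding Serre_F(1) serre_def hom_serre[OF D.c_nonpos[OF Serre_F(2)]] by (rule D.serre_F[OF Serre_F(2)])
  next
    case (Kt_Kt i j)
    show ?thesis unfolding Kt_Kt by (simp only: hom_simps D.K_K[of i j] diff_self)
  next
    case (Kt_Kp i j)
    show ?thesis unfolding Kt_Kp by (simp only: hom_simps D.K_K'[of i j] diff_self)
  next
    case (Kp_Kp i j)
    show ?thesis unfolding Kp_Kp by (simp only: hom_simps D.K'_K'[of i j] diff_self)
  next
    case (Kt_E i j)
    show ?thesis unfolding Kt_E by (simp only: hom_simps D.K_E[of i j, unfolded q_commutes_def] qscale_mult_left mult_1_left diff_self)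
  next
    case (Kt_F i j)
    show ?thesis unfolding Kt_F by (simp only: hom_simps D.K_F[of i j, unfolded q_commutes_def] qscale_mult_left mult_1_left diff_self)
  next
    case (Kp_E i j)
    show ?thesis unfolding Kp_E by (simp only: hom_simps D.K'_E[of i j, unfolded q_commutes_def] qscale_mult_left mult_1_left diff_self)
  next
    case (Kp_F i j)
    show ?thesis unfolding Kp_F by (simp only: hom_simps D.K'_F[of i j, unfolded q_commutes_def] qscale_mult_left mult_1_left diff_self)
  qed (simp_all only: hom_simps D.K_KI D.K'_KI' diff_self)
  hence "uideal c \<subseteq> {x. \<Psi> x = 0}"
    by (intro uideal_subset) (auto simp: hom_simps)
  thus ?thesis using assms(3) by auto
qed

interpretation proj: alg_hom "proj c"
  using proj_scal_mult[of c _ 1] by unfold_locales (simp_all add: proj_add proj_mult)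

lemma proj_eq_0_iff: "proj c p = 0 \<longleftrightarrow> p \<in> uideal c"
  using proj_eq_iff[of c p 0] by (simp add: proj.hom_0)

lemma drinfeld_double_proj:
  assumes "symmetric_gcm c"
  shows "drinfeld_double c (\<lambda>i. proj c (gen (Eg i))) (\<lambda>i. proj c (gen (Fg i))) (\<lambda>i. proj c (gen (Kt i)))
    (\<lambda>i. proj c (gen (KtI i))) (\<lambda>i. proj c (gen (Kp i))) (\<lambda>i. proj c (gen (KpI i)))"
proof
  fix i j
  have rel: "proj c p = proj c q" if "p - q \<in> urel c" for p q
    using that urel_subset_uideal by (auto simp: proj_eq_iff)
  have neg: "i \<noteq> j \<Longrightarrow> c i j \<le> 0" using assms by (simp add: symmetric_gcm_def)
  note rels = rel[OF urel.Kt_inv_r[of i c]] rel[OF urel.Kt_inv_l[of i c]] rel[OF urel.Kp_inv_r[of i c]] rel[OF urel.Kp_inv_l[of i c]]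
    rel[OF urel.Kt_Kt[of i j c]] rel[OF urel.Kt_Kp[of i j c]] rel[OF urel.Kp_Kp[of i j c]]
    rel[OF urel.Kt_E[of i j c]] rel[OF urel.Kt_F[of i j c]] rel[OF urel.Kp_E[of i j c]] rel[OF urel.Kp_F[of i j c]]
  show "proj c (gen (Kt i)) * proj c (gen (KtI i)) = 1" "proj c (gen (KtI i)) * proj c (gen (Kt i)) = 1"
    "proj c (gen (Kp i)) * proj c (gen (KpI i)) = 1" "proj c (gen (KpI i)) * proj c (gen (Kp i)) = 1"
    "proj c (gen (Kt i)) * proj c (gen (Kt j)) = proj c (gen (Kt j)) * proj c (gen (Kt i))"
    "proj c (gen (Kt i)) * proj c (gen (Kp j)) = proj c (gen (Kp j)) * proj c (gen (Kt i))"
    "proj c (gen (Kp i)) * proj c (gen (Kp j)) = proj c (gen (Kp j)) * proj c (gen (Kp i))"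
    "q_commutes (vv powi c i j) (proj c (gen (Kt i))) (proj c (gen (Eg j)))"
    "q_commutes (vv powi (- c i j)) (proj c (gen (Kt i))) (proj c (gen (Fg j)))"
    "q_commutes (vv powi (- c i j)) (proj c (gen (Kp i))) (proj c (gen (Eg j)))"
    "q_commutes (vv powi c i j) (proj c (gen (Kp i))) (proj c (gen (Fg j)))"
    using rels unfolding proj.hom_simps q_commutes_def qscale_mult_left mult_1_left by blast+
  have "proj c (gen (Eg i) * gen (Fg j) - gen (Fg j) * gen (Eg i)) =
      proj c (if i = j then scal (1 / (vv - inverse vv)) * (gen (Kt i) - gen (Kp i)) else 0)"
    by (rule rel[OF urel.E_F])
  thus "proj c (gen (Eg i)) * proj c (gen (Fg j)) = proj c (gen (Fg j)) * proj c (gen (Eg i)) +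
      (if i = j then inverse (vv - inverse vv) \<star> (proj c (gen (Kt i)) - proj c (gen (Kp i))) else 0)"
    by (cases "i = j") (simp_all add: proj.hom_simps inverse_eq_divide diff_eq_eq add.commute)
  show "qserre (nat (1 - c i j)) (proj c (gen (Eg i))) (proj c (gen (Eg j))) = 0" if "i \<noteq> j"
    using rel[of "serre c Eg i j" 0] urel.Serre_E[OF that, of c] proj.hom_serre[OF neg[OF that], of c "Eg i" "Eg j"]
    by (simp add: serre_def proj.hom_0)
  show "qserre (nat (1 - c i j)) (proj c (gen (Fg i))) (proj c (gen (Fg j))) = 0" if "i \<noteq> j"
    using rel[of "serre c Fg i j" 0] urel.Serre_F[OF that, of c] proj.hom_serre[OF neg[OF that], of c "Fg i" "Fg j"]
    by (simp add: serre_def proj.hom_0)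
qed (rule assms)

text \<open>Representatives in the free algebra of the images of the generators for the sign \<open>e = 1\<close>.\<close>

fun braid_gen :: "('i \<Rightarrow> 'i \<Rightarrow> int) \<Rightarrow> 'i \<Rightarrow> 'i ugen \<Rightarrow> 'i ugen free_alg" where
  "braid_gen c i (Eg j) = (if j = i then - (gen (Fg i) * gen (KpI i)) else
     (\<Sum>r\<le>nat (- c i j). scal ((- 1) ^ r * vv powi (- int r) / (qfact r * qfact (nat (- c i j) - r)))
        * (gen (Eg i) ^ (nat (- c i j) - r) * gen (Eg j) * gen (Eg i) ^ r)))"
| "braid_gen c i (Fg j) = (if j = i then - (gen (KtI i) * gen (Eg i)) else
     (\<Sum>r\<le>nat (- c i j). scal ((- 1) ^ r * vv ^ r / (qfact r * qfact (nat (- c i j) - r)))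
        * (gen (Fg i) ^ r * gen (Fg j) * gen (Fg i) ^ (nat (- c i j) - r))))"
| "braid_gen c i (Kt j) = (if j = i then gen (KtI i) else gen (Kt i) ^ nat (- c i j) * gen (Kt j))"
| "braid_gen c i (KtI j) = (if j = i then gen (Kt i) else gen (KtI i) ^ nat (- c i j) * gen (KtI j))"
| "braid_gen c i (Kp j) = (if j = i then gen (KpI i) else gen (Kp i) ^ nat (- c i j) * gen (Kp j))"
| "braid_gen c i (KpI j) = (if j = i then gen (Kp i) else gen (KpI i) ^ nat (- c i j) * gen (KpI j))"

definition braid :: "('i \<Rightarrow> 'i \<Rightarrow> int) \<Rightarrow> 'i \<Rightarrow> 'i ugen free_alg \<Rightarrow> 'i ugen free_alg" where
  "braid c i = subst (braid_gen c i)"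

lemma braid_simps:
  "braid c i (p + q) = braid c i p + braid c i q" "braid c i (p - q) = braid c i p - braid c i q"
  "braid c i (- p) = - braid c i p"
  "braid c i (p * q) = braid c i p * braid c i q" "braid c i (p ^ n) = braid c i p ^ n"
  "braid c i (sum f A) = (\<Sum>x\<in>A. braid c i (f x))"
  "braid c i (scal k) = scal k" "braid c i 1 = 1" "braid c i 0 = 0"
  "braid c i (gen g) = braid_gen c i g"
  by (simp_all add: braid_def subst_add subst_diff subst_uminus subst_mult subst_sum subst_power)

context
  fixes c :: "'i \<Rightarrow> 'i \<Rightarrow> int" and i :: 'i
  assumes gcm: "symmetric_gcm c"
begin

interpretation D: drinfeld_double c "\<lambda>i. proj c (gen (Eg i))" "\<lambda>i. proj c (gen (Fg i))" "\<lambda>i. proj c (gen (Kt i))"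
    "\<lambda>i. proj c (gen (KtI i))" "\<lambda>i. proj c (gen (Kp i))" "\<lambda>i. proj c (gen (KpI i))"
  by (rule drinfeld_double_proj[OF gcm])

lemma proj_braid_gen:
  "proj c (braid_gen c i (Eg j)) = D.TE i j" "proj c (braid_gen c i (Fg j)) = D.TF i j"
  "proj c (braid_gen c i (Kt j)) = D.TK i j" "proj c (braid_gen c i (KtI j)) = D.TKI i j"
  "proj c (braid_gen c i (Kp j)) = D.TK' i j" "proj c (braid_gen c i (KpI j)) = D.TKI' i j"
proof -
  show "proj c (braid_gen c i (Eg j)) = D.TE i j"
  proof (cases "j = i")
    case False
    show ?thesis unfolding D.TE_sum[OF False] D.string_length_def using False by (simp add: proj.hom_simps)
  qed (simp add: D.TE_def proj.hom_simps)
  show "proj c (braid_gen c i (Fg j)) = D.TF i j"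
  proof (cases "j = i")
    case False
    show ?thesis unfolding D.TF_sum[OF False] D.string_length_def using False by (simp add: proj.hom_simps)
  qed (simp add: D.TF_def proj.hom_simps)
qed (simp_all add: D.TK_def D.TKI_def D.TK'_def D.TKI'_def D.string_length_def proj.hom_simps)

lemma braid_uideal:
  assumes "x \<in> uideal c" shows "braid c i x \<in> uideal c"
proof -
  have "alg_hom (\<lambda>p. proj c (braid c i p))"
    by standard (simp_all add: braid_simps proj.hom_simps)
  hence "proj c (braid c i x) = 0"
    by (rule alg_hom_kills_urel[OF _ _ assms])
      (simp only: braid_simps proj_braid_gen D.drinfeld_double_T)
  thus ?thesis by (simp only: proj_eq_0_iff)
qed

lemma conj_power_commuting:
  fixes x :: "'a::monoid_mult"
  assumes "x * z = z * x" "x * x' = 1" shows "x ^ n * z * x' ^ n = z"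
  by (simp add: power_commuting_commutes[OF assms(1)] mult.assoc left_right_inverse_power[OF assms(2)])

text \<open>With \<open>\<sigma>\<close> the anti-automorphism and \<open>T\<close> the braid operator this says \<open>T \<sigma> T = \<sigma>\<close>, hence
\<open>\<sigma> T \<sigma>\<close> is inverse to \<open>T\<close>. Both sides are anti-multiplicative, so it suffices to compare
them on generators, and \<open>\<sigma>\<close> reverses the sums for the images of the generators to those of
\<open>TE_restore\<close> and \<open>TF_restore\<close>.\<close>

lemma braid_anti_braid: "proj c (braid c i (anti (braid c i p))) = proj c (anti p)"
proof (induction p rule: free_alg_induct)
  case (gen g)
  have n: "D.string_length i j = nat (- c i j)" for j by (simp add: D.string_length_def)
  show ?case
  proof (cases g)
    case (Eg j)
    show ?thesis
    proof (cases "j = i")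
      case True
      show ?thesis
        by (simp add: Eg True braid_simps anti_uminus anti_mult proj.hom_simps)
    next
      case False
      have "proj c (braid c i (anti (braid c i (gen g)))) =
        (\<Sum>r\<le>nat (- c i j). ((- 1) ^ r * vv powi (- int r) / (qfact r * qfact (nat (- c i j) - r))) \<star>
          (D.TE i i ^ r * D.TE i j * D.TE i i ^ (nat (- c i j) - r)))"
        unfolding Eg braid_simps(10) using False
        by (simp add: braid_simps anti_sum anti_mult anti_power proj.hom_simps proj.hom_scal_right
            proj_braid_gen[symmetric] mult.assoc del: braid_gen.simps(2-6))
      thus ?thesis using D.TE_restore[OF False] by (simp add: n Eg)
    qed
  next
    case (Fg j)
    show ?thesis
    proof (cases "j = i")
      case True
      show ?thesis
        by (simp add: Fg True braid_simps anti_uminus anti_mult proj.hom_simps)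
          (simp add: D.K'_KI' mult.assoc)
    next
      case False
      have "proj c (braid c i (anti (braid c i (gen g)))) =
        (\<Sum>r\<le>nat (- c i j). ((- 1) ^ r * vv ^ r / (qfact r * qfact (nat (- c i j) - r))) \<star>
          (D.TF i i ^ (nat (- c i j) - r) * D.TF i j * D.TF i i ^ r))"
        unfolding Fg braid_simps(10) using False
        by (simp add: braid_simps anti_sum anti_mult anti_power proj.hom_simps proj.hom_scal_right
            proj_braid_gen[symmetric] mult.assoc del: braid_gen.simps(1,3-6))
      thus ?thesis using D.TF_restore[OF False] by (simp add: n Fg)
    qed
  qed (simp_all add: braid_simps anti_mult anti_power proj.hom_simps
      conj_power_commuting[OF D.K_K D.K_KI(1)] conj_power_commuting[OF D.KI_commute(2) D.K_KI(2)]
      conj_power_commuting[OF D.K'_K' D.K'_KI'(1)] conj_power_commuting[OF D.KI'_commute(2) D.K'_KI'(2)])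
qed (simp_all add: braid_simps anti_add anti_mult proj.hom_simps)

end


section \<open>Descent to the quotient\<close>

lemma ucls_eq_iff: "ucls c x = ucls c y \<longleftrightarrow> x - y \<in> uideal c"
proof
  assume "ucls c x = ucls c y"
  moreover have "x \<in> ucls c x" by (simp add: ucls_eq uideal_closed)
  ultimately show "x - y \<in> uideal c" by (simp add: ucls_eq)
next
  assume xy: "x - y \<in> uideal c"
  have "z - x \<in> uideal c \<longleftrightarrow> z - y \<in> uideal c" for z
    using uideal_closed(2)[of "z - x" c "x - y"] uideal_closed(2)[of "z - y" c "- (x - y)"] uideal_closed(3)[OF xy] xy
    by auto
  thus "ucls c x = ucls c y" by (simp add: ucls_eq)
qed

text \<open>The map on cosets induced by a map of the free algebra, through an arbitrary representative.\<close>

definition coset_map :: "('i \<Rightarrow> 'i \<Rightarrow> int) \<Rightarrow> ('i ugen free_alg \<Rightarrow> 'i ugen free_alg) \<Rightarrow>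
    'i ugen free_alg set \<Rightarrow> 'i ugen free_alg set" where
  "coset_map c B X = ucls c (B (SOME x. ucls c x = X))"

lemma coset_map_ucls:
  assumes "\<And>x y. B (x - y) = B x - B y" "\<And>x. x \<in> uideal c \<Longrightarrow> B x \<in> uideal c"
  shows "coset_map c B (ucls c x) = ucls c (B x)"
proof -
  have "ucls c (SOME y. ucls c y = ucls c x) = ucls c x" by (rule someI_ex) blast
  hence "(SOME y. ucls c y = ucls c x) - x \<in> uideal c" by (simp only: ucls_eq_iff)
  thus ?thesis unfolding coset_map_def ucls_eq_iff using assms by metis
qed

lemma coset_map_alg_auto:
  assumes add: "\<And>x y. B (x + y) = B x + B y" and diff: "\<And>x y. B (x - y) = B x - B y"
    and mult: "\<And>x y. B (x * y) = B x * B y" and scal: "\<And>k. B (scal k) = scal k"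
    and ideal: "\<And>x. x \<in> uideal c \<Longrightarrow> B x \<in> uideal c"
    and inj: "\<And>x. B x \<in> uideal c \<Longrightarrow> x \<in> uideal c"
    and surj: "\<And>y. \<exists>x. B x - y \<in> uideal c"
  shows "coset_map c B \<in> alg_auto (Ut c)"
proof -
  note cm = coset_map_ucls[of B, OF diff ideal]
  have "B 1 = 1" using scal[of 1] by simp
  hence "coset_map c B \<in> ring_hom (Ut c) (Ut c)"
    by (intro ring_hom_memI) (auto simp: Ut_simps cm add mult)
  moreover have "bij_betw (coset_map c B) (carrier (Ut c)) (carrier (Ut c))"
  proof (rule bij_betw_imageI)
    show "inj_on (coset_map c B) (carrier (Ut c))"
      using inj by (auto simp: inj_on_def Ut_simps cm ucls_eq_iff simp flip: diff)
    show "coset_map c B ` carrier (Ut c) = carrier (Ut c)"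
    proof (intro subset_antisym subsetI)
      fix Y assume "Y \<in> carrier (Ut c)"
      then obtain y where y: "Y = ucls c y" by (auto simp: Ut_simps)
      obtain x where "B x - y \<in> uideal c" using surj by blast
      hence "ucls c (B x) = ucls c y" by (simp only: ucls_eq_iff)
      hence "Y = coset_map c B (ucls c x)" by (simp add: y cm)
      thus "Y \<in> coset_map c B ` carrier (Ut c)" by (simp add: Ut_simps)
    qed (auto simp: Ut_simps cm)
  qed
  ultimately show ?thesis
    by (auto simp: alg_auto_def ring_iso_def Ut_simps cm mult scal)
qed

lemma Ut_pow: "ucls c x [^]\<^bsub>Ut c\<^esub> (n::nat) = ucls c (x ^ n)"
proof (induction n)
  case (Suc n)
  thus ?case by (simp add: nat_pow_def Ut_simps power_commutes)
qed (simp add: nat_pow_def Ut_simps)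

lemma Ut_a_inv: "\<ominus>\<^bsub>Ut c\<^esub> ucls c x = ucls c (- x)"
proof -
  interpret ring "Ut c" by (rule ring_Ut)
  show ?thesis by (rule minus_equality) (auto simp: Ut_simps)
qed

lemma Ut_m_inv:
  assumes "x * y - 1 \<in> uideal c" "y * x - 1 \<in> uideal c"
  shows "inv\<^bsub>Ut c\<^esub> (ucls c x) = ucls c y"
proof -
  interpret ring "Ut c" by (rule ring_Ut)
  have "ucls c y = inv\<^bsub>Ut c\<^esub> (ucls c x)"
    by (rule inv_unique') (use assms in \<open>auto simp: Ut_simps ucls_eq_iff\<close>)
  thus ?thesis ..
qed

lemma Ut_finsum: "finite A \<Longrightarrow> (\<Oplus>\<^bsub>Ut c\<^esub>r\<in>A. ucls c (g r)) = ucls c (sum g A)"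
proof (induction A rule: finite_induct)
  interpret ring "Ut c" by (rule ring_Ut)
  case empty
  show ?case by (simp add: Ut_simps)
next
  interpret ring "Ut c" by (rule ring_Ut)
  case (insert x A)
  thus ?case by (subst finsum_insert) (auto simp: Ut_simps)
qed

lemma Ut_divpow: "divpow c (ucls c x) n = ucls c (scal (inverse (qfact n)) * x ^ n)"
  by (simp add: divpow_def Ut_pow Ut_simps)

lemma Ut_divpow_sum:
  fixes n :: nat
  shows "(\<Oplus>\<^bsub>Ut c\<^esub>r\<in>{0..n}. k r \<odot>\<^bsub>Ut c\<^esub> (divpow c (ucls c x) (a r) \<otimes>\<^bsub>Ut c\<^esub> ucls c y \<otimes>\<^bsub>Ut c\<^esub> divpow c (ucls c x) (b r))) =
    ucls c (\<Sum>r\<le>n. scal (k r / (qfact (a r) * qfact (b r))) * (x ^ a r * y * x ^ b r))"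
proof -
  have e: "scal k * (scal (inverse (qfact a)) * x ^ a * y * (scal (inverse (qfact b)) * x ^ b)) =
      scal (k / (qfact a * qfact b)) * (x ^ a * y * x ^ b)" for k a b
  proof -
    have "scal k * (scal (inverse (qfact a)) * x ^ a * y * (scal (inverse (qfact b)) * x ^ b)) =
      scal k * (scal (inverse (qfact a)) * (scal (inverse (qfact b)) * (x ^ a * y * x ^ b)))"
      by (simp only: mult.assoc scal_left_commute[of y "inverse (qfact b)"] scal_left_commute[of "x ^ a" "inverse (qfact b)"])
    also have "\<dots> = scal (k * (inverse (qfact a) * inverse (qfact b))) * (x ^ a * y * x ^ b)"
      by (simp only: scal_mult mult.assoc)
    finally show ?thesis by (simp add: divide_inverse)
  qed
  show ?thesis
    unfolding Ut_divpow Ut_simps e by (simp add: Ut_finsum atLeast0AtMost)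
qed

lemma bar_coeff_qfact: "bar_coeff (qfact n) = qfact n"
  by (simp add: qfact_def bar_coeff_prod bar_coeff_qint)

text \<open>The operator for the sign \<open>-1\<close> is the conjugate by the bar involution. This makes the
compatibility of the two signs an identity, and the formulas for \<open>-1\<close> arise from those
for \<open>1\<close> by inverting \<open>v\<close> and exchanging the two kinds of torus generators.\<close>

definition braid_sgn :: "('i \<Rightarrow> 'i \<Rightarrow> int) \<Rightarrow> 'i \<Rightarrow> int \<Rightarrow> 'i ugen free_alg \<Rightarrow> 'i ugen free_alg" where
  "braid_sgn c i e = (if e = 1 then braid c i else bar_free \<circ> braid c i \<circ> bar_free)"

lemma braid_sgn_hom:
  "braid_sgn c i e (x + y) = braid_sgn c i e x + braid_sgn c i e y"
  "braid_sgn c i e (x - y) = braid_sgn c i e x - braid_sgn c i e y"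
  "braid_sgn c i e (x * y) = braid_sgn c i e x * braid_sgn c i e y"
  "braid_sgn c i e (scal k) = scal k"
  by (simp_all add: braid_sgn_def braid_simps bar_free_add bar_free_diff bar_free_mult)

lemma braid_sgn_bar:
  "e \<in> {1, -1} \<Longrightarrow> bar_free (braid_sgn c i e (bar_free x)) = braid_sgn c i (- e) x"
  by (auto simp: braid_sgn_def)

lemma braid_sgn_gen:
  assumes "e \<in> {1, -1}"
  shows "braid_sgn c i e (gen (Kt j)) = (if j = i then gen (KtI i) else gen (Kt i) ^ nat (- c i j) * gen (Kt j))"
    "braid_sgn c i e (gen (Kp j)) = (if j = i then gen (KpI i) else gen (Kp i) ^ nat (- c i j) * gen (Kp j))"
    "braid_sgn c i e (gen (Fg i)) = - (gen ((if e = 1 then KtI else KpI) i) * gen (Eg i))"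
    "braid_sgn c i e (gen (Eg i)) = - (gen (Fg i) * gen ((if e = 1 then KpI else KtI) i))"
    "j \<noteq> i \<Longrightarrow> braid_sgn c i e (gen (Fg j)) =
      (\<Sum>r\<le>nat (- c i j). scal ((- 1) ^ r * vv powi (e * int r) / (qfact r * qfact (nat (- c i j) - r)))
        * (gen (Fg i) ^ r * gen (Fg j) * gen (Fg i) ^ (nat (- c i j) - r)))"
    "j \<noteq> i \<Longrightarrow> braid_sgn c i e (gen (Eg j)) =
      (\<Sum>r\<le>nat (- c i j). scal ((- 1) ^ r * vv powi (- (e * int r)) / (qfact r * qfact (nat (- c i j) - r)))
        * (gen (Eg i) ^ (nat (- c i j) - r) * gen (Eg j) * gen (Eg i) ^ r))"
proof -
  note bar_simps = braid_sgn_def braid_simps bar_free_sum bar_free_mult bar_free_power bar_free_uminus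
      bar_coeff_mult bar_coeff_divide bar_coeff_power bar_coeff_uminus bar_coeff_powi bar_coeff_qfact
  consider "e = 1" | "e = - 1" using assms by blast
  note e_cases = this
  show "braid_sgn c i e (gen (Kt j)) = (if j = i then gen (KtI i) else gen (Kt i) ^ nat (- c i j) * gen (Kt j))"
    "braid_sgn c i e (gen (Kp j)) = (if j = i then gen (KpI i) else gen (Kp i) ^ nat (- c i j) * gen (Kp j))"
    "braid_sgn c i e (gen (Fg i)) = - (gen ((if e = 1 then KtI else KpI) i) * gen (Eg i))"
    "braid_sgn c i e (gen (Eg i)) = - (gen (Fg i) * gen ((if e = 1 then KpI else KtI) i))"
    by (cases rule: e_cases; simp add: bar_simps)+
  show "j \<noteq> i \<Longrightarrow> braid_sgn c i e (gen (Fg j)) =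
      (\<Sum>r\<le>nat (- c i j). scal ((- 1) ^ r * vv powi (e * int r) / (qfact r * qfact (nat (- c i j) - r)))
        * (gen (Fg i) ^ r * gen (Fg j) * gen (Fg i) ^ (nat (- c i j) - r)))"
    by (cases rule: e_cases) (simp_all add: bar_simps vv_powi_minus power_inverse)
  show "j \<noteq> i \<Longrightarrow> braid_sgn c i e (gen (Eg j)) =
      (\<Sum>r\<le>nat (- c i j). scal ((- 1) ^ r * vv powi (- (e * int r)) / (qfact r * qfact (nat (- c i j) - r)))
        * (gen (Eg i) ^ (nat (- c i j) - r) * gen (Eg j) * gen (Eg i) ^ r))"
    by (cases rule: e_cases) (simp_all add: bar_simps)
qed

lemma uideal_bar_iff: "bar_free x \<in> uideal c \<longleftrightarrow> x \<in> uideal c"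
  using bar_free_uideal[of x c] bar_free_uideal[of "bar_free x" c] by auto

lemma braid_bijective_mod:
  assumes gcm: "symmetric_gcm c"
  shows "braid c i x \<in> uideal c \<longleftrightarrow> x \<in> uideal c" "\<exists>x. braid c i x - y \<in> uideal c"
proof -
  have aba: "braid c i (anti (braid c i x)) - anti x \<in> uideal c" for x
    using braid_anti_braid[OF gcm, of i x] by (simp only: proj_eq_iff)
  show "braid c i x \<in> uideal c \<longleftrightarrow> x \<in> uideal c"
  proof
    assume "braid c i x \<in> uideal c"
    hence "braid c i (anti (braid c i x)) \<in> uideal c"
      by (rule braid_uideal[OF gcm anti_uideal[OF gcm]])
    from uideal_closed(2)[OF uideal_closed(3)[OF aba[of x]] this] have "anti x \<in> uideal c" by simp
    hence "anti (anti x) \<in> uideal c" by (rule anti_uideal[OF gcm])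
    thus "x \<in> uideal c" by simp
  qed (rule braid_uideal[OF gcm])
  show "\<exists>x. braid c i x - y \<in> uideal c"
    using aba[of "anti y"] by auto
qed

lemma braid_sgn_uideal_iff:
  assumes "symmetric_gcm c" shows "braid_sgn c i e x \<in> uideal c \<longleftrightarrow> x \<in> uideal c"
  by (simp add: braid_sgn_def uideal_bar_iff braid_bijective_mod(1)[OF assms])

lemma braid_sgn_surj_mod:
  assumes "symmetric_gcm c" shows "\<exists>x. braid_sgn c i e x - y \<in> uideal c"
proof (cases "e = 1")
  case False
  obtain x where "braid c i x - bar_free y \<in> uideal c" using braid_bijective_mod(2)[OF assms] by blast
  hence "bar_free (braid c i x - bar_free y) \<in> uideal c" by (rule bar_free_uideal)
  thus ?thesis using False by (intro exI[of _ "bar_free x"]) (simp add: braid_sgn_def bar_free_diff)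
qed (use braid_bijective_mod(2)[OF assms] in \<open>simp add: braid_sgn_def\<close>)

lemma inv_torus:
  "inv\<^bsub>Ut c\<^esub> (uK c i) = ucls c (gen (KtI i))" "inv\<^bsub>Ut c\<^esub> (uK' c i) = ucls c (gen (KpI i))"
proof -
  show "inv\<^bsub>Ut c\<^esub> (uK c i) = ucls c (gen (KtI i))" unfolding uK_def
    by (rule Ut_m_inv; rule subsetD[OF urel_subset_uideal]) (rule urel.intros)+
  show "inv\<^bsub>Ut c\<^esub> (uK' c i) = ucls c (gen (KpI i))" unfolding uK'_def
    by (rule Ut_m_inv; rule subsetD[OF urel_subset_uideal]) (rule urel.intros)+
qed

text \<open>For \<open>j = i\<close> the exponent is \<open>-2\<close>, so the power is the inverse of a square.\<close>

lemma torus_reflection: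
  fixes x xi :: "'i \<Rightarrow> 'i ugen free_alg"
  assumes gcm: "symmetric_gcm c" and x: "x i * xi i - 1 \<in> uideal c" "xi i * x i - 1 \<in> uideal c"
  shows "ucls c (x i) [^]\<^bsub>Ut c\<^esub> (- c i j) \<otimes>\<^bsub>Ut c\<^esub> ucls c (x j) =
    ucls c (if j = i then xi i else x i ^ nat (- c i j) * x j)"
proof (cases "j = i")
  case True
  have c: "c i i = 2" using gcm by (simp add: symmetric_gcm_def)
  have p: "proj c (x i) * proj c (xi i) = 1" "proj c (xi i) * proj c (x i) = 1"
    using x by (simp_all flip: proj_mult add: proj_eq_iff[of c _ 1, simplified])
  have "inv\<^bsub>Ut c\<^esub> (ucls c (x i ^ 2)) = ucls c (xi i ^ 2)"
  proof (rule Ut_m_inv)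
    have "proj c (x i ^ 2 * xi i ^ 2) = proj c 1" "proj c (xi i ^ 2 * x i ^ 2) = proj c 1"
      by (simp_all add: power2_eq_square proj_mult mult.assoc p nested_mult[OF p(1)] nested_mult[OF p(2)])
    thus "x i ^ 2 * xi i ^ 2 - 1 \<in> uideal c" "xi i ^ 2 * x i ^ 2 - 1 \<in> uideal c"
      by (simp_all only: proj_eq_iff)
  qed
  moreover have "proj c (xi i ^ 2 * x i) = proj c (xi i)"
    by (simp add: power2_eq_square proj_mult mult.assoc p)
  ultimately show ?thesis
    by (simp add: True c int_pow_def2 Ut_pow Ut_simps ucls_eq_iff proj_eq_iff)
next
  case False
  hence "\<not> - c i j < 0" using gcm by (simp add: symmetric_gcm_def not_less)
  thus ?thesis using False by (simp add: int_pow_def2 Ut_pow Ut_simps)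
qed

theorem proposition6p20:
  fixes c :: "'i::finite \<Rightarrow> 'i \<Rightarrow> int"
  assumes "symmetric_gcm c"
  shows "\<exists>T :: 'i \<Rightarrow> int \<Rightarrow> 'i ugen free_alg set \<Rightarrow> 'i ugen free_alg set. \<forall>i.
    (\<forall>e\<in>{1, -1}.
      T i e \<in> alg_auto (Ut c) \<and>
      (\<forall>x\<in>carrier (Ut c). bar (T i e (bar x)) = T i (- e) x) \<and>
      (\<forall>j. T i e (uK c j) = uK c i [^]\<^bsub>Ut c\<^esub> (- c i j) \<otimes>\<^bsub>Ut c\<^esub> uK c j) \<and>
      (\<forall>j. T i e (uK' c j) = uK' c i [^]\<^bsub>Ut c\<^esub> (- c i j) \<otimes>\<^bsub>Ut c\<^esub> uK' c j)) \<and>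
    T i 1 (uF c i) = \<ominus>\<^bsub>Ut c\<^esub> (inv\<^bsub>Ut c\<^esub> (uK c i) \<otimes>\<^bsub>Ut c\<^esub> uE c i) \<and>
    T i 1 (uE c i) = \<ominus>\<^bsub>Ut c\<^esub> (uF c i \<otimes>\<^bsub>Ut c\<^esub> inv\<^bsub>Ut c\<^esub> (uK' c i)) \<and>
    T i (-1) (uF c i) = \<ominus>\<^bsub>Ut c\<^esub> (inv\<^bsub>Ut c\<^esub> (uK' c i) \<otimes>\<^bsub>Ut c\<^esub> uE c i) \<and>
    T i (-1) (uE c i) = \<ominus>\<^bsub>Ut c\<^esub> (uF c i \<otimes>\<^bsub>Ut c\<^esub> inv\<^bsub>Ut c\<^esub> (uK c i)) \<and>
    (\<forall>e\<in>{1, -1}. \<forall>j. j \<noteq> i \<longrightarrow>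
      T i (- e) (uF c j) =
        (\<Oplus>\<^bsub>Ut c\<^esub>r\<in>{0..nat (- c i j)}.
           ((-1) ^ r * vv powi (- (e * int r))) \<odot>\<^bsub>Ut c\<^esub>
             (divpow c (uF c i) r \<otimes>\<^bsub>Ut c\<^esub> uF c j \<otimes>\<^bsub>Ut c\<^esub>
                divpow c (uF c i) (nat (- c i j) - r))) \<and>
      T i (- e) (uE c j) =
        (\<Oplus>\<^bsub>Ut c\<^esub>r\<in>{0..nat (- c i j)}.
           ((-1) ^ r * vv powi (e * int r)) \<odot>\<^bsub>Ut c\<^esub>
             (divpow c (uE c i) (nat (- c i j) - r) \<otimes>\<^bsub>Ut c\<^esub> uE c j \<otimes>\<^bsub>Ut c\<^esub>
                divpow c (uE c i) r)))"
proof -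
  define T where "T i e = coset_map c (braid_sgn c i e)" for i e
  have T: "T i e (ucls c x) = ucls c (braid_sgn c i e x)" for i e x
    unfolding T_def by (rule coset_map_ucls) (simp_all only: braid_sgn_hom braid_sgn_uideal_iff[OF assms])
  have auto: "T i e \<in> alg_auto (Ut c)" for i e
    unfolding T_def
    by (rule coset_map_alg_auto) (simp_all only: braid_sgn_hom braid_sgn_uideal_iff[OF assms] braid_sgn_surj_mod[OF assms])
  have bar: "bar (T i e (bar x)) = T i (- e) x" if "e \<in> {1, -1}" "x \<in> carrier (Ut c)" for i e x
  proof -
    obtain y where "x = ucls c y" using \<open>x \<in> carrier (Ut c)\<close> by (auto simp: Ut_simps)
    thus ?thesis by (simp add: bar_ucls T braid_sgn_bar[OF \<open>e \<in> {1, -1}\<close>])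
  qed
  have K: "T i e (uK c j) = uK c i [^]\<^bsub>Ut c\<^esub> (- c i j) \<otimes>\<^bsub>Ut c\<^esub> uK c j" if "e \<in> {1, -1}" for i j e
    unfolding uK_def T braid_sgn_gen[OF that]
    by (rule torus_reflection[OF assms, of "\<lambda>i. gen (Kt i)" _ "\<lambda>i. gen (KtI i)", symmetric])
      (rule subsetD[OF urel_subset_uideal], rule urel.intros)+
  have K': "T i e (uK' c j) = uK' c i [^]\<^bsub>Ut c\<^esub> (- c i j) \<otimes>\<^bsub>Ut c\<^esub> uK' c j" if "e \<in> {1, -1}" for i j e
    unfolding uK'_def T braid_sgn_gen[OF that]
    by (rule torus_reflection[OF assms, of "\<lambda>i. gen (Kp i)" _ "\<lambda>i. gen (KpI i)", symmetric])
      (rule subsetD[OF urel_subset_uideal], rule urel.intros)+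
  have FE: "T i 1 (uF c i) = \<ominus>\<^bsub>Ut c\<^esub> (inv\<^bsub>Ut c\<^esub> (uK c i) \<otimes>\<^bsub>Ut c\<^esub> uE c i)"
    "T i 1 (uE c i) = \<ominus>\<^bsub>Ut c\<^esub> (uF c i \<otimes>\<^bsub>Ut c\<^esub> inv\<^bsub>Ut c\<^esub> (uK' c i))"
    "T i (-1) (uF c i) = \<ominus>\<^bsub>Ut c\<^esub> (inv\<^bsub>Ut c\<^esub> (uK' c i) \<otimes>\<^bsub>Ut c\<^esub> uE c i)"
    "T i (-1) (uE c i) = \<ominus>\<^bsub>Ut c\<^esub> (uF c i \<otimes>\<^bsub>Ut c\<^esub> inv\<^bsub>Ut c\<^esub> (uK c i))" for i
    unfolding inv_torus unfolding uE_def uF_def T Ut_simps Ut_a_inv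
    by (simp_all add: braid_sgn_gen)
  have F: "T i (- e) (uF c j) = (\<Oplus>\<^bsub>Ut c\<^esub>r\<in>{0..nat (- c i j)}.
           ((-1) ^ r * vv powi (- (e * int r))) \<odot>\<^bsub>Ut c\<^esub>
             (divpow c (uF c i) r \<otimes>\<^bsub>Ut c\<^esub> uF c j \<otimes>\<^bsub>Ut c\<^esub>
                divpow c (uF c i) (nat (- c i j) - r)))" if "e \<in> {1, -1}" "j \<noteq> i" for i j e
  proof -
    have e: "- e \<in> {1, -1}" using that by auto
    show ?thesis unfolding uF_def T Ut_divpow_sum braid_sgn_gen(5)[OF e that(2)] mult_minus_left ..
  qed
  have E: "T i (- e) (uE c j) = (\<Oplus>\<^bsub>Ut c\<^esub>r\<in>{0..nat (- c i j)}.
           ((-1) ^ r * vv powi (e * int r)) \<odot>\<^bsub>Ut c\<^esub>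
             (divpow c (uE c i) (nat (- c i j) - r) \<otimes>\<^bsub>Ut c\<^esub> uE c j \<otimes>\<^bsub>Ut c\<^esub>
                divpow c (uE c i) r))" if "e \<in> {1, -1}" "j \<noteq> i" for i j e
  proof -
    have e: "- e \<in> {1, -1}" using that by auto
    have swap: "qfact (nat (- c i j) - r) * qfact r = qfact r * qfact (nat (- c i j) - r)" for r
      by (rule mult.commute)
    show ?thesis
      unfolding uE_def T Ut_divpow_sum braid_sgn_gen(6)[OF e that(2)] mult_minus_left minus_minus swap ..
  qed
  show ?thesis
    by (rule exI[of _ T]) (intro allI ballI conjI impI auto bar K K' FE F E; assumption)
qed

end
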